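(* Let $L=\mathscr{W}_A(\Gamma)$ be the generalized map Virasoro algebra, with Lie bracket $\phi$, where $A$ is a unital commutative associative $\mathbb{F}$-algebra such that $A\otimes A$ is an integral domain. Every Lie bialgebra structure on $L$ is coboundary triangular. That is, for every linear map $\Delta: L\to L\otimes L$ such that $(L,\phi,\Delta)$ is a Lie bialgebra, there exists $r\in \mathrm{Im}(1\otimes 1-\tau)\subset L\otimes L$ such that $\Delta(x)=x\cdot r$ for all $x\in L$ and $c(r)=0$.
   Context: $\mathbb{F}$ is a field of characteristic zero; all tensor products are over $\mathbb{F}$. $\Gamma$ is an additive subgroup of $\mathbb{F}$ with $1\in\Gamma$. The group algebra $\mathbb{F}[\Gamma]$ has basis $\{e^\alpha\mid\alpha\in\Gamma\}$, and $\partial$ is the operator $\partial(e^\alpha)=\alpha e^\alpha$; $\mathscr{W}(\Gamma)=\mathbb{F}[\Gamma]\partial$ is the generalized Witt (centerless Virasoro) algebra, with basis $L_\alpha=e^\alpha\partial$. The generalized map Virasoro algebra is $\mathscr{W}_A(\Gamma)=\mathscr{W}(\Gamma)\otimes A$; it is spanned by the elements $L_\alpha x=e^\alpha\partial\otimes x$ ($\alpha\in\Gamma$, $x\in A$), with bracket $[L_\alpha x,L_\beta y]=(\beta-\alpha)L_{\alpha+\beta}xy$. For a vector space $L$, $\tau:L\otimes L\to L\otimes L$ is the twist $\tau(x\otimes y)=y\otimes x$, and $\varepsilon:L^{\otimes 3}\to L^{\otimes 3}$ is $\varepsilon(x_1\otimes x_2\otimes x_3)=x_2\otimes x_3\otimes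 x_1$; $1$ denotes the identity map. A Lie coalgebra is a pair $(L,\Delta)$ with $\Delta:L\to L\otimes L$ linear, $\mathrm{Im}\,\Delta\subset\mathrm{Im}(1\otimes 1-\tau)$ and $(1\otimes1\otimes1+\varepsilon+\varepsilon^2)(1\otimes\Delta)\Delta=0$. A Lie bialgebra is a triple $(L,\phi,\Delta)$ where $(L,\phi)$ is a Lie algebra with bracket $\phi:L\otimes L\to L$, $(L,\Delta)$ is a Lie coalgebra, and $\Delta\phi(x\otimes y)=x\cdot\Delta y-y\cdot\Delta x$ for all $x,y\in L$, where $\cdot$ is the adjoint diagonal action $x\cdot(a\otimes b)=[x,a]\otimes b+a\otimes[x,b]$. A coboundary Lie bialgebra is $(L,\phi,\Delta,r)$ where $(L,\phi,\Delta)$ is a Lie bialgebra, $r\in\mathrm{Im}(1\otimes1-\tau)$, and $\Delta(x)=x\cdot r$ for all $x\in L$. It is triangular if $c(r)=0$ (Classical Yang-Baxter Equation), where for $r=\sum_i a_i\otimes b_i$, in $U(L)^{\otimes3}$ ($U(L)$ the universal enveloping algebra of $L$, with identity element $1$), $r^{12}=\sum_i a_i\otimes b_i\otimes1$, $r^{13}=\sum_i a_i\otimes1\otimes b_i$, $r^{23}=\sum_i1\otimes a_i\otimes b_i$, and $c(r)=[r^{12},r^{13}]+[r^{12},r^{23}]+[r^{13},r^{23}]$. *)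

theory Defs
  imports "HOL-Algebra.Algebraic_Closure_Type" "HOL-Algebra.QuotRing" "HOL-Library.Poly_Mapping"
begin

text \<open>
  The ground field is a type of class \<open>field\<close> (later \<open>field_char_0\<close>), seen as an
  HOL-Algebra ring.  Vector spaces and (not necessarily associative or unital) algebras over it are
  HOL-Algebra \<open>module\<close> records; the field \<open>mult\<close> is the product of the algebra.  For a Lie algebra it
  is the bracket, so that \<open>x \<otimes>\<^bsub>L\<^esub> y\<close> reads \<open>[x, y]\<close> and \<open>\<one>\<^bsub>L\<^esub>\<close> is meaningless.
\<close>

abbreviation scalars :: "'f::field ring"
  where "scalars \<equiv> ring_of_type_algebra"

definition linear_map :: "('f::field, 'v) module \<Rightarrow> ('f, 'w) module \<Rightarrow> ('v \<Rightarrow> 'w) \<Rightarrow> bool"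
  where "linear_map V W h \<longleftrightarrow>
    h \<in> carrier V \<rightarrow> carrier W \<and>
    (\<forall>x\<in>carrier V. \<forall>y\<in>carrier V. h (x \<oplus>\<^bsub>V\<^esub> y) = h x \<oplus>\<^bsub>W\<^esub> h y) \<and>
    (\<forall>c. \<forall>x\<in>carrier V. h (c \<odot>\<^bsub>V\<^esub> x) = c \<odot>\<^bsub>W\<^esub> h x)"

definition lin_span :: "('f::field, 'v) module \<Rightarrow> 'v set \<Rightarrow> 'v set"
  where "lin_span V S = \<Inter>{H. submodule H scalars V \<and> S \<subseteq> H}"

text \<open>\<^const>\<open>FactRing\<close> together with the induced scalar multiplication.\<close>

definition quot_alg :: "('f, 'v) module \<Rightarrow> 'v set \<Rightarrow> ('f, 'v set) module"
  where "quot_alg V N =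
    \<lparr>carrier = a_rcosets\<^bsub>V\<^esub> N, monoid.mult = rcoset_mult V N, one = N +>\<^bsub>V\<^esub> \<one>\<^bsub>V\<^esub>,
     zero = N, add = set_add V, module.smult = (\<lambda>c Q. \<Union>x\<in>Q. N +>\<^bsub>V\<^esub> (c \<odot>\<^bsub>V\<^esub> x))\<rparr>"

text \<open>
  Finite formal linear combinations of elements of \<open>G\<close>, with the product of \<open>G\<close> extended
  bilinearly.  \<open>G\<close> need not be an actual monoid.
\<close>

definition free_alg :: "('g, 'm) monoid_scheme \<Rightarrow> ('f::field, 'g \<Rightarrow>\<^sub>0 'f) module"
  where "free_alg G =
    \<lparr>carrier = {p. Poly_Mapping.keys p \<subseteq> carrier G},
     monoid.mult = (\<lambda>p q. \<Sum>a\<in>Poly_Mapping.keys p. \<Sum>b\<in>Poly_Mapping.keys q.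
       Poly_Mapping.single (a \<otimes>\<^bsub>G\<^esub> b) (Poly_Mapping.lookup p a * Poly_Mapping.lookup q b)),
     one = Poly_Mapping.single \<one>\<^bsub>G\<^esub> 1, zero = 0, add = (+),
     module.smult = (\<lambda>c. Poly_Mapping.map ((*) c))\<rparr>"


section \<open>Tensor products\<close>

definition tensor_rel :: "('f::field, 'v) module \<Rightarrow> ('f, 'w) module \<Rightarrow> ('v \<times> 'w \<Rightarrow>\<^sub>0 'f) set"
  where "tensor_rel V W =
    {Poly_Mapping.single (x \<oplus>\<^bsub>V\<^esub> x', y) 1 - Poly_Mapping.single (x, y) 1
       - Poly_Mapping.single (x', y) 1 | x x' y.
       x \<in> carrier V \<and> x' \<in> carrier V \<and> y \<in> carrier W} \<union>
    {Poly_Mapping.single (x, y \<oplus>\<^bsub>W\<^esub> y') 1 - Poly_Mapping.single (x, y) 1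
       - Poly_Mapping.single (x, y') 1 | x y y'.
       x \<in> carrier V \<and> y \<in> carrier W \<and> y' \<in> carrier W} \<union>
    {Poly_Mapping.single (c \<odot>\<^bsub>V\<^esub> x, y) 1 - Poly_Mapping.single (x, y) c | c x y.
       x \<in> carrier V \<and> y \<in> carrier W} \<union>
    {Poly_Mapping.single (x, c \<odot>\<^bsub>W\<^esub> y) 1 - Poly_Mapping.single (x, y) c | c x y.
       x \<in> carrier V \<and> y \<in> carrier W}"

definition tensor_null :: "('f::field, 'v) module \<Rightarrow> ('f, 'w) module \<Rightarrow> ('v \<times> 'w \<Rightarrow>\<^sub>0 'f) set"
  where "tensor_null V W = lin_span (free_alg (V \<times>\<times> W)) (tensor_rel V W)"

text \<open>
  The tensor product.  Its product is \<open>(x \<otimes> y)(x' \<otimes> y') = xx' \<otimes> yy'\<close>; this is the usual tensor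
  product of algebras and, if \<open>V\<close> is a Lie algebra and \<open>W\<close> a commutative associative algebra, the
  usual bracket on \<open>V \<otimes> W\<close>.  For the square of a Lie algebra it plays no role.
\<close>

definition tensor ::
    "('f::field, 'v) module \<Rightarrow> ('f, 'w) module \<Rightarrow> ('f, ('v \<times> 'w \<Rightarrow>\<^sub>0 'f) set) module"
  where "tensor V W = quot_alg (free_alg (V \<times>\<times> W)) (tensor_null V W)"

definition tens ::
    "('f::field, 'v) module \<Rightarrow> ('f, 'w) module \<Rightarrow> 'v \<Rightarrow> 'w \<Rightarrow> ('v \<times> 'w \<Rightarrow>\<^sub>0 'f) set"
  where "tens V W x y =
    tensor_null V W +>\<^bsub>free_alg (V \<times>\<times> W)\<^esub> Poly_Mapping.single (x, y) 1"

text \<open>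
  The linear map into \<open>M\<close> with \<open>x \<otimes> y \<mapsto> g x y\<close>; for bilinear \<open>g\<close> it does not depend on the
  chosen representative.
\<close>

definition tensor_lift ::
    "('f::field, 'u) module \<Rightarrow> ('v \<Rightarrow> 'w \<Rightarrow> 'u) \<Rightarrow> ('v \<times> 'w \<Rightarrow>\<^sub>0 'f) set \<Rightarrow> 'u"
  where "tensor_lift M g t =
    (let p = (SOME p. p \<in> t) in
      \<Oplus>\<^bsub>M\<^esub>z\<in>Poly_Mapping.keys p. Poly_Mapping.lookup p z \<odot>\<^bsub>M\<^esub> g (fst z) (snd z))"

abbreviation tensor2 :: "('f::field, 'l) module \<Rightarrow> ('f, ('l \<times> 'l \<Rightarrow>\<^sub>0 'f) set) module"
  where "tensor2 L \<equiv> tensor L L"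

abbreviation tensor3 ::
    "('f::field, 'l) module \<Rightarrow> ('f, ('l \<times> ('l \<times> 'l \<Rightarrow>\<^sub>0 'f) set \<Rightarrow>\<^sub>0 'f) set) module"
  where "tensor3 L \<equiv> tensor L (tensor2 L)"

abbreviation tens3 ::
    "('f::field, 'l) module \<Rightarrow> 'l \<Rightarrow> 'l \<Rightarrow> 'l \<Rightarrow> ('l \<times> ('l \<times> 'l \<Rightarrow>\<^sub>0 'f) set \<Rightarrow>\<^sub>0 'f) set"
  where "tens3 L x y z \<equiv> tens L (tensor2 L) x (tens L L y z)"

text \<open>\<open>\<tau>(x \<otimes> y) = y \<otimes> x\<close>\<close>

definition twist :: "('f::field, 'l) module \<Rightarrow> ('l \<times> 'l \<Rightarrow>\<^sub>0 'f) set \<Rightarrow> ('l \<times> 'l \<Rightarrow>\<^sub>0 'f) set"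
  where "twist L = tensor_lift (tensor2 L) (\<lambda>x y. tens L L y x)"

text \<open>\<open>\<epsilon>(x \<otimes> y \<otimes> z) = y \<otimes> z \<otimes> x\<close>\<close>

definition cyc ::
    "('f::field, 'l) module \<Rightarrow> ('l \<times> ('l \<times> 'l \<Rightarrow>\<^sub>0 'f) set \<Rightarrow>\<^sub>0 'f) set
      \<Rightarrow> ('l \<times> ('l \<times> 'l \<Rightarrow>\<^sub>0 'f) set \<Rightarrow>\<^sub>0 'f) set"
  where "cyc L =
    tensor_lift (tensor3 L) (\<lambda>x. tensor_lift (tensor3 L) (\<lambda>y z. tens3 L y z x))"

text \<open>\<open>1 \<otimes> \<Delta>\<close>\<close>

definition id_tensor ::
    "('f::field, 'l) module \<Rightarrow> ('l \<Rightarrow> ('l \<times> 'l \<Rightarrow>\<^sub>0 'f) set) \<Rightarrow> ('l \<times> 'l \<Rightarrow>\<^sub>0 'f) set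
      \<Rightarrow> ('l \<times> ('l \<times> 'l \<Rightarrow>\<^sub>0 'f) set \<Rightarrow>\<^sub>0 'f) set"
  where "id_tensor L \<Delta> = tensor_lift (tensor3 L) (\<lambda>x y. tens L (tensor2 L) x (\<Delta> y))"

text \<open>The image of \<open>1 \<otimes> 1 - \<tau>\<close> on \<open>L \<otimes> L\<close>.\<close>

definition skew_tensors :: "('f::field, 'l) module \<Rightarrow> ('l \<times> 'l \<Rightarrow>\<^sub>0 'f) set set"
  where "skew_tensors L = (\<lambda>t. t \<ominus>\<^bsub>tensor2 L\<^esub> twist L t) ` carrier (tensor2 L)"


section \<open>Lie bialgebras\<close>

locale lie_algebra =
  module "scalars :: 'f ring" L for L :: "('f::field, 'l) module" (structure) +
  assumes bracket_closed: "\<lbrakk>x \<in> carrier L; y \<in> carrier L\<rbrakk> \<Longrightarrow> x \<otimes> y \<in> carrier L"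
    and bracket_add_left: "\<lbrakk>x \<in> carrier L; y \<in> carrier L; z \<in> carrier L\<rbrakk> \<Longrightarrow>
      (x \<oplus> y) \<otimes> z = (x \<otimes> z) \<oplus> (y \<otimes> z)"
    and bracket_add_right: "\<lbrakk>x \<in> carrier L; y \<in> carrier L; z \<in> carrier L\<rbrakk> \<Longrightarrow>
      x \<otimes> (y \<oplus> z) = (x \<otimes> y) \<oplus> (x \<otimes> z)"
    and bracket_smult_left: "\<lbrakk>x \<in> carrier L; y \<in> carrier L\<rbrakk> \<Longrightarrow> (c \<odot> x) \<otimes> y = c \<odot> (x \<otimes> y)"
    and bracket_smult_right: "\<lbrakk>x \<in> carrier L; y \<in> carrier L\<rbrakk> \<Longrightarrow> x \<otimes> (c \<odot> y) = c \<odot> (x \<otimes> y)"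
    and bracket_self: "x \<in> carrier L \<Longrightarrow> x \<otimes> x = \<zero>"
    and jacobi: "\<lbrakk>x \<in> carrier L; y \<in> carrier L; z \<in> carrier L\<rbrakk> \<Longrightarrow>
      (x \<otimes> (y \<otimes> z)) \<oplus> (y \<otimes> (z \<otimes> x)) \<oplus> (z \<otimes> (x \<otimes> y)) = \<zero>"

text \<open>The adjoint diagonal action \<open>x \<cdot> (a \<otimes> b) = [x, a] \<otimes> b + a \<otimes> [x, b]\<close>.\<close>

definition ad_action ::
    "('f::field, 'l) module \<Rightarrow> 'l \<Rightarrow> ('l \<times> 'l \<Rightarrow>\<^sub>0 'f) set \<Rightarrow> ('l \<times> 'l \<Rightarrow>\<^sub>0 'f) set"
  where "ad_action L x = tensor_lift (tensor2 L)
    (\<lambda>a b. tens L L (x \<otimes>\<^bsub>L\<^esub> a) b \<oplus>\<^bsub>tensor2 L\<^esub> tens L L a (x \<otimes>\<^bsub>L\<^esub> b))"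

definition lie_coalgebra ::
    "('f::field, 'l) module \<Rightarrow> ('l \<Rightarrow> ('l \<times> 'l \<Rightarrow>\<^sub>0 'f) set) \<Rightarrow> bool"
  where "lie_coalgebra L \<Delta> \<longleftrightarrow>
    module (scalars :: 'f ring) L \<and>
    linear_map L (tensor2 L) \<Delta> \<and>
    \<Delta> ` carrier L \<subseteq> skew_tensors L \<and>
    (\<forall>x\<in>carrier L.
      let t = id_tensor L \<Delta> (\<Delta> x)
      in t \<oplus>\<^bsub>tensor3 L\<^esub> cyc L t \<oplus>\<^bsub>tensor3 L\<^esub> cyc L (cyc L t) = \<zero>\<^bsub>tensor3 L\<^esub>)"

definition lie_bialgebra ::
    "('f::field, 'l) module \<Rightarrow> ('l \<Rightarrow> ('l \<times> 'l \<Rightarrow>\<^sub>0 'f) set) \<Rightarrow> bool"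
  where "lie_bialgebra L \<Delta> \<longleftrightarrow>
    lie_algebra L \<and> lie_coalgebra L \<Delta> \<and>
    (\<forall>x\<in>carrier L. \<forall>y\<in>carrier L.
      \<Delta> (x \<otimes>\<^bsub>L\<^esub> y) = ad_action L x (\<Delta> y) \<ominus>\<^bsub>tensor2 L\<^esub> ad_action L y (\<Delta> x))"

definition coboundary_lie_bialgebra ::
    "('f::field, 'l) module \<Rightarrow> ('l \<Rightarrow> ('l \<times> 'l \<Rightarrow>\<^sub>0 'f) set) \<Rightarrow> ('l \<times> 'l \<Rightarrow>\<^sub>0 'f) set \<Rightarrow> bool"
  where "coboundary_lie_bialgebra L \<Delta> r \<longleftrightarrow>
    lie_bialgebra L \<Delta> \<and> r \<in> skew_tensors L \<and> (\<forall>x\<in>carrier L. \<Delta> x = ad_action L x r)"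


section \<open>Universal enveloping algebra and Yang-Baxter equation\<close>

definition words :: "('f, 'l) module \<Rightarrow> 'l list monoid"
  where "words L = \<lparr>carrier = lists (carrier L), monoid.mult = (@), one = []\<rparr>"

text \<open>
  \<open>U(L)\<close> is presented as the free associative algebra on the set \<open>L\<close> modulo the two-sided ideal
  generated by the following elements.  The first two families turn the free algebra into the tensor
  algebra \<open>T(L)\<close>, the third one is \<open>x \<otimes> y - y \<otimes> x - [x, y]\<close>.
\<close>

definition uea_rel :: "('f::field, 'l) module \<Rightarrow> ('l list \<Rightarrow>\<^sub>0 'f) set"
  where "uea_rel L =
    {Poly_Mapping.single [x \<oplus>\<^bsub>L\<^esub> y] 1 - Poly_Mapping.single [x] 1 - Poly_Mapping.single [y] 1 | x y.
       x \<in> carrier L \<and> y \<in> carrier L} \<union>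
    {Poly_Mapping.single [c \<odot>\<^bsub>L\<^esub> x] 1 - Poly_Mapping.single [x] c | c x. x \<in> carrier L} \<union>
    {Poly_Mapping.single [x, y] 1 - Poly_Mapping.single [y, x] 1
       - Poly_Mapping.single [x \<otimes>\<^bsub>L\<^esub> y] 1 | x y. x \<in> carrier L \<and> y \<in> carrier L}"

definition uea_ideal :: "('f::field, 'l) module \<Rightarrow> ('l list \<Rightarrow>\<^sub>0 'f) set"
  where "uea_ideal L = Idl\<^bsub>free_alg (words L)\<^esub> (uea_rel L)"

definition uea :: "('f::field, 'l) module \<Rightarrow> ('f, ('l list \<Rightarrow>\<^sub>0 'f) set) module"
  where "uea L = quot_alg (free_alg (words L)) (uea_ideal L)"

definition uea_incl :: "('f::field, 'l) module \<Rightarrow> 'l \<Rightarrow> ('l list \<Rightarrow>\<^sub>0 'f) set"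
  where "uea_incl L x = uea_ideal L +>\<^bsub>free_alg (words L)\<^esub> Poly_Mapping.single [x] 1"

definition commutator :: "('f::field, 'u) module \<Rightarrow> 'u \<Rightarrow> 'u \<Rightarrow> 'u"
  where "commutator U x y = (x \<otimes>\<^bsub>U\<^esub> y) \<ominus>\<^bsub>U\<^esub> (y \<otimes>\<^bsub>U\<^esub> x)"

text \<open>\<open>c(r) = [r\<^sup>1\<^sup>2, r\<^sup>1\<^sup>3] + [r\<^sup>1\<^sup>2, r\<^sup>2\<^sup>3] + [r\<^sup>1\<^sup>3, r\<^sup>2\<^sup>3]\<close> in \<open>U(L) \<otimes> U(L) \<otimes> U(L)\<close>\<close>

definition cybe ::
    "('f::field, 'l) module \<Rightarrow> ('l \<times> 'l \<Rightarrow>\<^sub>0 'f) set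
      \<Rightarrow> (('l list \<Rightarrow>\<^sub>0 'f) set \<times> (('l list \<Rightarrow>\<^sub>0 'f) set \<times> ('l list \<Rightarrow>\<^sub>0 'f) set \<Rightarrow>\<^sub>0 'f) set \<Rightarrow>\<^sub>0 'f) set"
  where "cybe L r =
    (let U = uea L; U3 = tensor3 U; i = uea_incl L;
         r12 = tensor_lift U3 (\<lambda>a b. tens3 U (i a) (i b) \<one>\<^bsub>U\<^esub>) r;
         r13 = tensor_lift U3 (\<lambda>a b. tens3 U (i a) \<one>\<^bsub>U\<^esub> (i b)) r;
         r23 = tensor_lift U3 (\<lambda>a b. tens3 U \<one>\<^bsub>U\<^esub> (i a) (i b)) r
     in commutator U3 r12 r13 \<oplus>\<^bsub>U3\<^esub> commutator U3 r12 r23 \<oplus>\<^bsub>U3\<^esub> commutator U3 r13 r23)"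

definition triangular_lie_bialgebra ::
    "('f::field, 'l) module \<Rightarrow> ('l \<Rightarrow> ('l \<times> 'l \<Rightarrow>\<^sub>0 'f) set) \<Rightarrow> ('l \<times> 'l \<Rightarrow>\<^sub>0 'f) set \<Rightarrow> bool"
  where "triangular_lie_bialgebra L \<Delta> r \<longleftrightarrow>
    coboundary_lie_bialgebra L \<Delta> r \<and> cybe L r = \<zero>\<^bsub>tensor3 (uea L)\<^esub>"


section \<open>The generalized map Virasoro algebra\<close>

text \<open>
  The group algebra of \<open>\<Gamma>\<close> is the set of \<open>f :: 'f \<Rightarrow>\<^sub>0 'f\<close> supported in \<open>\<Gamma>\<close>, with
  \<open>e\<^sup>\<alpha> = Poly_Mapping.single \<alpha> 1\<close> and the (convolution) product of \<open>Poly_Mapping\<close>.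
\<close>

definition deriv_op :: "('f::field \<Rightarrow>\<^sub>0 'f) \<Rightarrow> ('f \<Rightarrow>\<^sub>0 'f)"
  where "deriv_op f =
    (\<Sum>\<alpha>\<in>Poly_Mapping.keys f. Poly_Mapping.single \<alpha> (\<alpha> * Poly_Mapping.lookup f \<alpha>))"

text \<open>
  The element \<open>f\<partial>\<close> of the Witt algebra is represented by \<open>f\<close>; the bracket is the commutator of
  derivations, \<open>[f\<partial>, g\<partial>] = (f \<partial>(g) - g \<partial>(f))\<partial>\<close>.
\<close>

definition witt :: "'f::field set \<Rightarrow> ('f, 'f \<Rightarrow>\<^sub>0 'f) module"
  where "witt \<Gamma> =
    \<lparr>carrier = {f. Poly_Mapping.keys f \<subseteq> \<Gamma>}, monoid.mult = (\<lambda>f g. f * deriv_op g - g * deriv_op f),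
     one = undefined, zero = 0, add = (+), module.smult = (\<lambda>c. Poly_Mapping.map ((*) c))\<rparr>"

definition map_virasoro ::
    "'f::field set \<Rightarrow> ('f, 'a) module \<Rightarrow> ('f, (('f \<Rightarrow>\<^sub>0 'f) \<times> 'a \<Rightarrow>\<^sub>0 'f) set) module"
  where "map_virasoro \<Gamma> A = tensor (witt \<Gamma>) A"

end

theory Submission
  imports Defs "HOL-Library.Product_Plus"
begin

text \<open>Throughout, \<open>L\<close> is the map Virasoro algebra, \<open>1\<close> in \<open>L\<^sub>n 1\<close> is the unit of \<open>A\<close>, and \<open>L\<^sub>n 1\<close> is
written \<open>L\<^sub>n\<close>.  For integral \<open>n\<close> these elements span a copy of the Witt algebra over the integers,
and everything rests on its action on tensor powers of \<open>L\<close>.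

\<^bold>\<open>Every cocycle is a coboundary.\<close>  A Lie bialgebra structure \<open>\<Delta>\<close> is a 1-cocycle of \<open>L\<close> with values
in \<open>L \<otimes> L\<close>.  A basis of \<open>A\<close> splits \<open>L \<otimes> L\<close> into copies of the group algebra of \<open>\<Gamma> \<times> \<Gamma>\<close>, whose
elements are Laurent-like polynomials in \<open>x\<close> and \<open>y\<close> with exponents in \<open>\<Gamma>\<close>; on each copy \<open>L\<^sub>n\<close> acts by
\<open>x\<^sup>n (E\<^sub>x - n) + y\<^sup>n (E\<^sub>y - n)\<close> with the Euler operators \<open>E\<^sub>x\<close>, \<open>E\<^sub>y\<close>.  Subtracting a coboundary makes
\<open>\<Delta> L\<^sub>0 = 0\<close>: the part of \<open>\<Delta> L\<^sub>0\<close> of nonzero weight is removed by division by the weight, and what is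
left is invariant under all \<open>L\<^sub>n\<close>, hence zero.  Then \<open>f\<^sub>n = \<Delta> L\<^sub>n\<close> has weight \<open>n\<close>.  If \<open>f\<^sub>1 = L\<^sub>1 v\<close> and
\<open>f\<^sub>2 = L\<^sub>2 v\<close> with \<open>v\<close> of weight zero, then eliminating the derivative of \<open>v\<close> gives
\<open>(x - y)\<^sup>2 v = (x + y) f\<^sub>1 - f\<^sub>2\<close>.  Conversely, the cocycle identities for \<open>[L\<^sub>1, L\<^sub>-\<^sub>1]\<close> and
\<open>[L\<^sub>-\<^sub>1, L\<^sub>2]\<close> show that the right-hand side is divisible by \<open>(x - y)\<^sup>2\<close> and that the quotient \<open>v\<close>
solves both equations up to a one-parameter defect \<open>(x - y) (x\<^sup>2 - 3 x y + y\<^sup>2) h\<close>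
(\<open>witt_cocycle_up_to_defect\<close>).  The relation \<open>3 [L\<^sub>2, L\<^sub>3] = [L\<^sub>1, L\<^sub>4]\<close> turns into \<open>(x - y)\<^sup>7 h = 0\<close>,
so \<open>h = 0\<close> (\<open>witt_cocycle_defect_zero\<close>).  After subtracting the coboundary of \<open>v\<close>, the cocycle kills
\<open>L\<^sub>1\<close> and \<open>L\<^sub>2\<close>, hence all \<open>L\<^sub>n\<close> with \<open>n \<ge> 1\<close>, and so commutes with their action.  Then
\<open>L\<^sub>n L\<^sub>m \<Delta>(L\<^sub>\<gamma> a)\<close> and \<open>L\<^sub>m\<^sub>+\<^sub>n \<Delta>(L\<^sub>\<gamma> a)\<close> are both multiples of \<open>\<Delta>(L\<^sub>\<gamma>\<^sub>+\<^sub>m\<^sub>+\<^sub>n a)\<close>.  The first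
one has terms in which one tensor factor is shifted by \<open>m\<close> and the other by \<open>n\<close>; the second one shifts a
single factor and cannot match them for generic large \<open>m\<close>, \<open>n\<close>.  This forces
\<open>\<Delta>(L\<^sub>\<gamma> a) = 0\<close> (\<open>witt_act_equivariant_zero\<close>, \<open>cocycle_coboundary\<close>).

\<^bold>\<open>The coboundary is triangular.\<close>  The same device, a shift by a generic large \<open>n\<close>, shows that no
nonzero element of \<open>L \<otimes> L\<close> or \<open>L \<otimes> L \<otimes> L\<close> is killed by all \<open>L\<^sub>n\<close> (\<open>act_invariant_zero\<close>,
\<open>act3_invariant_zero\<close>).  If \<open>\<Delta> x = x \<cdot> r\<close>, skewness of \<open>\<Delta>\<close> says that \<open>r + \<tau> r\<close> is invariant, so it
vanishes.  For skew \<open>r\<close> the co-Jacobi expression of \<open>x\<close> equals \<open>x \<cdot> C(r)\<close>, where \<open>C(r)\<close> is the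
Yang-Baxter expression formed with brackets in \<open>L \<otimes> L \<otimes> L\<close> (\<open>cojacobiator_skew\<close>); so \<open>C(r)\<close> is
invariant and vanishes too.  Finally \<open>c(r)\<close> is the image of \<open>C(r)\<close> in the third tensor power of the
enveloping algebra (\<open>cybe_eq\<close>).

\<^bold>\<open>Coordinates.\<close>  Tensor products and enveloping algebras are sets of cosets of formal sums.  The
universal property of the tensor product (\<open>tensor_lift\<close>) and the existence of bases (\<open>coords_exist\<close>,
\<open>tensor_coords\<close>) carry both arguments to finitely supported functions, where they are statements
about coefficients.\<close>

section \<open>Finitely supported functions\<close>

abbreviation keys :: "('i \<Rightarrow>\<^sub>0 'b::zero) \<Rightarrow> 'i set"
  where "keys \<equiv> Poly_Mapping.keys"

abbreviation lookup :: "('i \<Rightarrow>\<^sub>0 'b::zero) \<Rightarrow> 'i \<Rightarrow> 'b"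
  where "lookup \<equiv> Poly_Mapping.lookup"

abbreviation single :: "'i \<Rightarrow> 'b \<Rightarrow> ('i \<Rightarrow>\<^sub>0 'b::zero)"
  where "single \<equiv> Poly_Mapping.single"

lemma poly_mapping_additive_induct [case_names single add]:
  fixes p :: "'i \<Rightarrow>\<^sub>0 'b::comm_monoid_add"
  assumes single: "\<And>i c. P (single i c)"
    and add: "\<And>p q. P p \<Longrightarrow> P q \<Longrightarrow> P (p + q)"
  shows "P p"
proof -
  have *: "P (\<Sum>i\<in>S. single i (lookup p i))" if "finite S" for S
    using that
  proof induction
    case empty
    then show ?case using single[of _ 0] by simp
  qed (simp add: single add)
  have "p = (\<Sum>i\<in>keys p. single i (lookup p i))"
    by (rule poly_mapping_eqI) (auto simp: lookup_sum lookup_single when_def in_keys_iff)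
  then show ?thesis using *[OF finite_keys[of p]] by simp
qed

abbreviation pscale :: "'f::field \<Rightarrow> ('i \<Rightarrow>\<^sub>0 'f) \<Rightarrow> ('i \<Rightarrow>\<^sub>0 'f)"
  where "pscale c \<equiv> Poly_Mapping.map ((*) c)"

abbreviation unit_vec :: "'i \<Rightarrow> ('i \<Rightarrow>\<^sub>0 'f::field)"
  where "unit_vec i \<equiv> single i 1"

lemma lookup_pscale: "lookup (pscale c p) k = c * lookup p k"
  by (simp add: Poly_Mapping.map.rep_eq when_def)

lemma pscale_add: "pscale c (p + q) = pscale c p + pscale c q"
  and pscale_diff: "pscale c (p - q) = pscale c p - pscale c q"
  and pscale_uminus: "pscale c (- p) = - pscale c p"
  and pscale_add_left: "pscale (c + d) p = pscale c p + pscale d p"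
  and pscale_uminus_left: "pscale (- c) p = - pscale c p"
  and pscale_pscale: "pscale c (pscale d p) = pscale (c * d) p"
  and pscale_1: "pscale 1 p = p"
  and pscale_0: "pscale 0 p = 0"
  and pscale_zero: "pscale c 0 = (0 :: 'i \<Rightarrow>\<^sub>0 'f::field)"
  and pscale_single: "pscale c (single i d) = single i (c * d)"
  for p q :: "'i \<Rightarrow>\<^sub>0 'f::field"
  by (auto intro!: poly_mapping_eqI simp: lookup_pscale lookup_add lookup_minus algebra_simps
      lookup_single when_def)

lemma keys_pscale: "keys (pscale c p) \<subseteq> keys p"
  by (auto simp: in_keys_iff lookup_pscale)

text \<open>The linear extension of a map on basis vectors.\<close>

definition ext :: "('i \<Rightarrow> ('j \<Rightarrow>\<^sub>0 'f)) \<Rightarrow> ('i \<Rightarrow>\<^sub>0 'f::field) \<Rightarrow> ('j \<Rightarrow>\<^sub>0 'f)"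
  where "ext g p = (\<Sum>i\<in>keys p. pscale (lookup p i) (g i))"

lemma ext_superset:
  assumes "finite S" "keys p \<subseteq> S"
  shows "ext g p = (\<Sum>i\<in>S. pscale (lookup p i) (g i))"
  unfolding ext_def
  by (rule sum.mono_neutral_left) (use assms in \<open>auto simp: in_keys_iff pscale_0\<close>)

lemma pscale_sum: "pscale c (sum h S) = (\<Sum>i\<in>S. pscale c (h i))"
  by (induction S rule: infinite_finite_induct) (simp_all add: pscale_zero pscale_add)

lemma ext_add: "ext g (p + q) = ext g p + ext g q"
proof -
  let ?S = "keys p \<union> keys q"
  have "keys (p + q) \<subseteq> ?S" by (rule Poly_Mapping.keys_add)
  then show ?thesis
    by (simp add: ext_superset[of ?S] lookup_add pscale_add_left sum.distrib)
qed

lemma ext_pscale: "ext g (pscale c p) = pscale c (ext g p)"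
  by (subst ext_superset[OF finite_keys keys_pscale])
    (simp add: ext_def lookup_pscale pscale_sum pscale_pscale)

lemma ext_0 [simp]: "ext g 0 = 0"
  by (simp add: ext_def)

lemma ext_single: "ext g (single i c) = pscale c (g i)"
  by (cases "c = 0") (simp_all add: ext_def pscale_0)

lemma ext_fun_add: "ext (\<lambda>i. g i + h i) p = ext g p + ext h p"
  by (simp add: ext_def pscale_add sum.distrib)

lemma ext_fun_pscale: "ext (\<lambda>i. pscale c (g i)) p = pscale c (ext g p)"
  by (simp add: ext_def pscale_sum pscale_pscale mult.commute)

lemma ext_fun_zero [simp]: "ext (\<lambda>i. 0) p = 0"
  by (simp add: ext_def pscale_zero)

lemma ext_unit_vec: "ext unit_vec p = p"
  by (induction p rule: poly_mapping_additive_induct) (simp_all add: ext_add ext_single pscale_single)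

lemma keys_ext:
  assumes "keys p \<subseteq> J" "\<And>i. i \<in> J \<Longrightarrow> keys (g i) \<subseteq> K"
  shows "keys (ext g p) \<subseteq> K"
proof -
  have "k \<in> K" if "k \<in> keys (ext g p)" for k
  proof (rule ccontr)
    assume "k \<notin> K"
    then have "lookup (g i) k = 0" if "i \<in> keys p" for i
      using assms(1) assms(2)[of i] that by (auto simp: in_keys_iff subset_iff)
    then have "lookup (ext g p) k = 0"
      by (simp add: ext_def lookup_sum lookup_pscale)
    then show False using that by (simp add: in_keys_iff)
  qed
  then show ?thesis by blast
qed

section \<open>Vector spaces and linear maps\<close>

abbreviation vspace :: "('f::field, 'v) module \<Rightarrow> bool"
  where "vspace V \<equiv> module (scalars :: 'f ring) V"

lemma scalars_simps [simp]:
  "carrier (scalars :: 'f::field ring) = UNIV" "x \<oplus>\<^bsub>scalars\<^esub> y = (x + y :: 'f)" "x \<otimes>\<^bsub>scalars\<^esub> y = (x * y :: 'f)"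
  "\<zero>\<^bsub>scalars\<^esub> = (0 :: 'f)" "\<one>\<^bsub>scalars\<^esub> = (1 :: 'f)"
  by (simp_all add: ring_of_type_algebra_def)

lemma scalars_uminus [simp]: "\<ominus>\<^bsub>scalars\<^esub> x = (- x :: 'f::field)"
proof -
  interpret cring "scalars :: 'f ring" by (rule cring_from_type_algebra)
  show ?thesis by (metis UNIV_I add.inv_equality add_eq_0_iff scalars_simps(1,2,4) add.commute)
qed

lemma linear_mapI:
  assumes "\<And>x. x \<in> carrier V \<Longrightarrow> h x \<in> carrier W"
    and "\<And>x y. x \<in> carrier V \<Longrightarrow> y \<in> carrier V \<Longrightarrow> h (x \<oplus>\<^bsub>V\<^esub> y) = h x \<oplus>\<^bsub>W\<^esub> h y"
    and "\<And>c x. x \<in> carrier V \<Longrightarrow> h (c \<odot>\<^bsub>V\<^esub> x) = c \<odot>\<^bsub>W\<^esub> h x"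
  shows "linear_map V W h"
  using assms by (auto simp: linear_map_def)

lemma linear_mapD:
  assumes "linear_map V W h"
  shows "x \<in> carrier V \<Longrightarrow> h x \<in> carrier W"
    and "x \<in> carrier V \<Longrightarrow> y \<in> carrier V \<Longrightarrow> h (x \<oplus>\<^bsub>V\<^esub> y) = h x \<oplus>\<^bsub>W\<^esub> h y"
    and "x \<in> carrier V \<Longrightarrow> h (c \<odot>\<^bsub>V\<^esub> x) = c \<odot>\<^bsub>W\<^esub> h x"
  using assms by (auto simp: linear_map_def)

text \<open>The vector space laws as plain facts about a named space.  Several spaces occur side by side in the
proofs below, and interpreting the module locale for each would bring in competing simplification
rules.\<close>

lemma vspaceD:
  assumes "vspace V"
  shows "x \<in> carrier V \<Longrightarrow> y \<in> carrier V \<Longrightarrow> x \<oplus>\<^bsub>V\<^esub> y \<in> carrier V"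
    and "x \<in> carrier V \<Longrightarrow> c \<odot>\<^bsub>V\<^esub> x \<in> carrier V"
    and "\<zero>\<^bsub>V\<^esub> \<in> carrier V"
    and "x \<in> carrier V \<Longrightarrow> \<ominus>\<^bsub>V\<^esub> x \<in> carrier V"
    and "x \<in> carrier V \<Longrightarrow> 0 \<odot>\<^bsub>V\<^esub> x = \<zero>\<^bsub>V\<^esub>"
    and "x \<in> carrier V \<Longrightarrow> 1 \<odot>\<^bsub>V\<^esub> x = x"
    and "x \<in> carrier V \<Longrightarrow> (- 1) \<odot>\<^bsub>V\<^esub> x = \<ominus>\<^bsub>V\<^esub> x"
    and "x \<in> carrier V \<Longrightarrow> y \<in> carrier V \<Longrightarrow> x \<ominus>\<^bsub>V\<^esub> y = x \<oplus>\<^bsub>V\<^esub> (- 1) \<odot>\<^bsub>V\<^esub> y"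
    and "x \<in> carrier V \<Longrightarrow> y \<in> carrier V \<Longrightarrow> x \<ominus>\<^bsub>V\<^esub> y \<in> carrier V"
    and "x \<in> carrier V \<Longrightarrow> y \<in> carrier V \<Longrightarrow> x \<oplus>\<^bsub>V\<^esub> y = y \<oplus>\<^bsub>V\<^esub> x"
    and "x \<in> carrier V \<Longrightarrow> y \<in> carrier V \<Longrightarrow> c \<odot>\<^bsub>V\<^esub> (x \<oplus>\<^bsub>V\<^esub> y) = c \<odot>\<^bsub>V\<^esub> x \<oplus>\<^bsub>V\<^esub> c \<odot>\<^bsub>V\<^esub> y"
    and "x \<in> carrier V \<Longrightarrow> (c + d) \<odot>\<^bsub>V\<^esub> x = c \<odot>\<^bsub>V\<^esub> x \<oplus>\<^bsub>V\<^esub> d \<odot>\<^bsub>V\<^esub> x"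
    and "x \<in> carrier V \<Longrightarrow> (c * d) \<odot>\<^bsub>V\<^esub> x = c \<odot>\<^bsub>V\<^esub> (d \<odot>\<^bsub>V\<^esub> x)"
    and "x \<in> carrier V \<Longrightarrow> y \<in> carrier V \<Longrightarrow> x \<ominus>\<^bsub>V\<^esub> y = \<zero>\<^bsub>V\<^esub> \<longleftrightarrow> x = y"
    and "x \<in> carrier V \<Longrightarrow> x \<oplus>\<^bsub>V\<^esub> \<zero>\<^bsub>V\<^esub> = x"
    and "x \<in> carrier V \<Longrightarrow> \<zero>\<^bsub>V\<^esub> \<oplus>\<^bsub>V\<^esub> x = x"
    and "c \<odot>\<^bsub>V\<^esub> \<zero>\<^bsub>V\<^esub> = \<zero>\<^bsub>V\<^esub>"
proof -
  interpret V: module scalars V by fact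
  show "x \<in> carrier V \<Longrightarrow> y \<in> carrier V \<Longrightarrow> x \<oplus>\<^bsub>V\<^esub> y \<in> carrier V"
    "x \<in> carrier V \<Longrightarrow> c \<odot>\<^bsub>V\<^esub> x \<in> carrier V"
    "\<zero>\<^bsub>V\<^esub> \<in> carrier V" "x \<in> carrier V \<Longrightarrow> \<ominus>\<^bsub>V\<^esub> x \<in> carrier V"
    "x \<in> carrier V \<Longrightarrow> 0 \<odot>\<^bsub>V\<^esub> x = \<zero>\<^bsub>V\<^esub>" "x \<in> carrier V \<Longrightarrow> 1 \<odot>\<^bsub>V\<^esub> x = x"
    "x \<in> carrier V \<Longrightarrow> y \<in> carrier V \<Longrightarrow> x \<ominus>\<^bsub>V\<^esub> y \<in> carrier V"
    "x \<in> carrier V \<Longrightarrow> y \<in> carrier V \<Longrightarrow> x \<oplus>\<^bsub>V\<^esub> y = y \<oplus>\<^bsub>V\<^esub> x"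
    "x \<in> carrier V \<Longrightarrow> y \<in> carrier V \<Longrightarrow> c \<odot>\<^bsub>V\<^esub> (x \<oplus>\<^bsub>V\<^esub> y) = c \<odot>\<^bsub>V\<^esub> x \<oplus>\<^bsub>V\<^esub> c \<odot>\<^bsub>V\<^esub> y"
    "x \<in> carrier V \<Longrightarrow> (c + d) \<odot>\<^bsub>V\<^esub> x = c \<odot>\<^bsub>V\<^esub> x \<oplus>\<^bsub>V\<^esub> d \<odot>\<^bsub>V\<^esub> x"
    "x \<in> carrier V \<Longrightarrow> (c * d) \<odot>\<^bsub>V\<^esub> x = c \<odot>\<^bsub>V\<^esub> (d \<odot>\<^bsub>V\<^esub> x)"
    "x \<in> carrier V \<Longrightarrow> x \<oplus>\<^bsub>V\<^esub> \<zero>\<^bsub>V\<^esub> = x" "x \<in> carrier V \<Longrightarrow> \<zero>\<^bsub>V\<^esub> \<oplus>\<^bsub>V\<^esub> x = x"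
    "c \<odot>\<^bsub>V\<^esub> \<zero>\<^bsub>V\<^esub> = \<zero>\<^bsub>V\<^esub>"
    using V.smult_closed[of c x] V.smult_l_null[of x] V.smult_one[of x] V.smult_r_distr[of c x y]
      V.smult_l_distr[of c d x] V.smult_assoc1[of c d x] V.smult_r_null[of c]
    by (simp_all add: V.M.a_comm)
  show neg: "x \<in> carrier V \<Longrightarrow> (- 1) \<odot>\<^bsub>V\<^esub> x = \<ominus>\<^bsub>V\<^esub> x" for x
    using V.smult_l_minus[of 1 x] V.smult_one[of x] by simp
  show "x \<in> carrier V \<Longrightarrow> y \<in> carrier V \<Longrightarrow> x \<ominus>\<^bsub>V\<^esub> y = x \<oplus>\<^bsub>V\<^esub> (- 1) \<odot>\<^bsub>V\<^esub> y"
    by (simp add: a_minus_def neg)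
  show "x \<in> carrier V \<Longrightarrow> y \<in> carrier V \<Longrightarrow> x \<ominus>\<^bsub>V\<^esub> y = \<zero>\<^bsub>V\<^esub> \<longleftrightarrow> x = y"
    by (metis V.M.add.inv_solve_right V.M.minus_eq V.M.l_zero V.M.zero_closed)
qed

lemma linear_map_zero:
  assumes "vspace V" "vspace W" "linear_map V W h"
  shows "h \<zero>\<^bsub>V\<^esub> = \<zero>\<^bsub>W\<^esub>"
  using linear_mapD(1,3)[OF assms(3), of "\<zero>\<^bsub>V\<^esub>"] vspaceD(3,5)[OF assms(1)] vspaceD(5)[OF assms(2)]
  by metis

lemma linear_map_minus:
  assumes "vspace V" "vspace W" "linear_map V W h" "x \<in> carrier V" "y \<in> carrier V"
  shows "h (x \<ominus>\<^bsub>V\<^esub> y) = h x \<ominus>\<^bsub>W\<^esub> h y"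
  unfolding vspaceD(8)[OF assms(1,4,5)]
  using assms by (simp add: vspaceD(2,8) linear_mapD[OF assms(3)])

lemma linear_map_compose:
  "linear_map V W h \<Longrightarrow> linear_map W U k \<Longrightarrow> linear_map V U (\<lambda>x. k (h x))"
  by (auto simp: linear_map_def Pi_iff)

lemma linear_map_add:
  assumes "vspace W" "linear_map V W h" "linear_map V W k"
  shows "linear_map V W (\<lambda>x. h x \<oplus>\<^bsub>W\<^esub> k x)"
proof -
  interpret W: module scalars W by fact
  show ?thesis
    by (rule linear_mapI)
      (use W.smult_r_distr in \<open>simp_all add: linear_mapD[OF assms(2)] linear_mapD[OF assms(3)] W.M.a_ac\<close>)
qed

lemma linear_map_smult:
  assumes "vspace W" "linear_map V W h"
  shows "linear_map V W (\<lambda>x. c \<odot>\<^bsub>W\<^esub> h x)"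
  by (rule linear_mapI)
    (simp_all add: linear_mapD[OF assms(2)] vspaceD[OF assms(1)] mult.commute flip: vspaceD(13)[OF assms(1)])

lemma linear_map_diff:
  assumes "vspace W" "linear_map V W h" "linear_map V W k"
  shows "linear_map V W (\<lambda>x. h x \<ominus>\<^bsub>W\<^esub> k x)"
proof -
  have "linear_map V W (\<lambda>x. h x \<oplus>\<^bsub>W\<^esub> (- 1) \<odot>\<^bsub>W\<^esub> k x)"
    by (intro linear_map_add linear_map_smult assms)
  then show ?thesis
    by (auto simp: linear_map_def vspaceD(8)[OF assms(1)] Pi_iff vspaceD(1,2)[OF assms(1)]
        linear_mapD[OF assms(2)] linear_mapD[OF assms(3)])
qed

text \<open>All module axioms are equations, so they pass to a surjective image on which the operations are
compatible.  Stated for an arbitrary structure \<open>Q\<close> because quotients are not known to be modules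
beforehand.\<close>

lemma vspace_image:
  fixes V :: "('f::field, 'v) module" and Q :: "('f, 'w) module"
  assumes V: "vspace V" and onto: "carrier Q = \<pi> ` carrier V"
    and add: "\<And>x y. x \<in> carrier V \<Longrightarrow> y \<in> carrier V \<Longrightarrow> \<pi> (x \<oplus>\<^bsub>V\<^esub> y) = \<pi> x \<oplus>\<^bsub>Q\<^esub> \<pi> y"
    and smult: "\<And>c x. x \<in> carrier V \<Longrightarrow> \<pi> (c \<odot>\<^bsub>V\<^esub> x) = c \<odot>\<^bsub>Q\<^esub> \<pi> x"
    and zero: "\<zero>\<^bsub>Q\<^esub> = \<pi> \<zero>\<^bsub>V\<^esub>"
  shows "vspace Q"
proof -
  interpret V: module "scalars :: 'f ring" V by fact
  note VD = vspaceD[OF V]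
  have group: "abelian_group Q"
  proof (rule abelian_groupI)
    fix x assume "x \<in> carrier Q"
    then obtain a where a: "x = \<pi> a" "a \<in> carrier V" using onto by auto
    then show "\<exists>y\<in>carrier Q. y \<oplus>\<^bsub>Q\<^esub> x = \<zero>\<^bsub>Q\<^esub>"
      by (intro bexI[of _ "\<pi> (\<ominus>\<^bsub>V\<^esub> a)"]) (auto simp: zero onto V.M.l_neg simp flip: add)
  qed (auto simp: onto zero V.M.a_ac simp flip: add)
  show ?thesis
    by (rule moduleI) (use group VD(11-13) V.R.is_cring in \<open>auto simp: onto VD simp flip: add smult\<close>)
qed

section \<open>Quotient spaces\<close>

locale subspace =
  fixes V :: "('f::field, 'v) module" and N
  assumes vspace: "vspace V" and submodule: "submodule N scalars V"
begin

abbreviation \<pi> where "\<pi> x \<equiv> N +>\<^bsub>V\<^esub> x"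

lemma abelian_group: "abelian_group V"
  using vspace by (rule module.axioms(2))

lemma abelian_subgroup: "abelian_subgroup N V"
proof (rule abelian_subgroupI3)
  show "additive_subgroup N V"
    using submodule by (simp add: submodule_def additive_subgroupI)
qed (rule abelian_group)

lemmas coset_facts =
  abelian_subgroup.a_elemrcos_carrier[OF abelian_subgroup]
  abelian_subgroup.a_rcos_self[OF abelian_subgroup]
  abelian_subgroup.a_repr_independence'[OF abelian_subgroup]
  abelian_subgroup.a_rcos_module[OF abelian_subgroup]
  abelian_subgroup.a_rcos_sum[OF abelian_subgroup]
  additive_subgroup.a_subset[OF abelian_subgroup.axioms(1)[OF abelian_subgroup]]

lemma mem_proj: "x \<in> carrier V \<Longrightarrow> y \<in> \<pi> x \<longleftrightarrow> y \<in> carrier V \<and> \<pi> y = \<pi> x"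
  using coset_facts(1)[of x y] coset_facts(2)[of y] coset_facts(3)[of y x] by metis

lemma proj_eq_iff:
  assumes x: "x \<in> carrier V" and y: "y \<in> carrier V"
  shows "\<pi> x = \<pi> y \<longleftrightarrow> x \<ominus>\<^bsub>V\<^esub> y \<in> N"
proof -
  have "\<pi> x = \<pi> y \<longleftrightarrow> x \<in> \<pi> y" using x y by (simp add: mem_proj)
  also have "\<dots> \<longleftrightarrow> x \<ominus>\<^bsub>V\<^esub> y \<in> N"
    using x y by (simp add: coset_facts(4) a_minus_def)
  finally show ?thesis .
qed

lemma mem_proj_iff: "x \<in> carrier V \<Longrightarrow> y \<in> \<pi> x \<longleftrightarrow> y \<in> carrier V \<and> y \<ominus>\<^bsub>V\<^esub> x \<in> N"
  using mem_proj[of x y] proj_eq_iff[of y x] by argo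

lemma quot_carrier: "carrier (quot_alg V N) = \<pi> ` carrier V"
  by (auto simp: quot_alg_def A_RCOSETS_defs a_r_coset_def)

lemma quot_add: "x \<in> carrier V \<Longrightarrow> y \<in> carrier V \<Longrightarrow> \<pi> (x \<oplus>\<^bsub>V\<^esub> y) = \<pi> x \<oplus>\<^bsub>quot_alg V N\<^esub> \<pi> y"
  by (simp add: quot_alg_def coset_facts(5))

lemma quot_zero: "\<zero>\<^bsub>quot_alg V N\<^esub> = \<pi> \<zero>\<^bsub>V\<^esub>"
  unfolding quot_alg_def using abelian_group.a_coset_add_zero[OF abelian_group coset_facts(6)] by (simp only: ring.simps)

text \<open>The scalar multiple of a coset is a union over all of its representatives; it is a single coset
because the representatives differ by elements of the subspace.\<close>

lemma quot_smult:
  assumes x: "x \<in> carrier V"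
  shows "\<pi> (c \<odot>\<^bsub>V\<^esub> x) = c \<odot>\<^bsub>quot_alg V N\<^esub> \<pi> x"
proof -
  have "\<pi> (c \<odot>\<^bsub>V\<^esub> y) = \<pi> (c \<odot>\<^bsub>V\<^esub> x)" if "y \<in> \<pi> x" for y
  proof -
    have y: "y \<in> carrier V" "y \<ominus>\<^bsub>V\<^esub> x \<in> N" using that x by (simp_all only: mem_proj_iff)
    have "c \<odot>\<^bsub>V\<^esub> y \<ominus>\<^bsub>V\<^esub> c \<odot>\<^bsub>V\<^esub> x = c \<odot>\<^bsub>V\<^esub> (y \<ominus>\<^bsub>V\<^esub> x)"
    proof -
      have "c \<odot>\<^bsub>V\<^esub> (y \<ominus>\<^bsub>V\<^esub> x) = c \<odot>\<^bsub>V\<^esub> y \<oplus>\<^bsub>V\<^esub> c \<odot>\<^bsub>V\<^esub> ((- 1) \<odot>\<^bsub>V\<^esub> x)"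
        using x y(1) vspaceD(2,8,11)[OF vspace] by metis
      also have "c \<odot>\<^bsub>V\<^esub> ((- 1) \<odot>\<^bsub>V\<^esub> x) = (- 1) \<odot>\<^bsub>V\<^esub> (c \<odot>\<^bsub>V\<^esub> x)"
        using vspaceD(13)[OF vspace x] by (metis mult.commute)
      finally show ?thesis using x y(1) vspaceD(2,8)[OF vspace] by metis
    qed
    then show ?thesis using x y submodule.smult_closed[OF submodule, of c]
      by (simp add: proj_eq_iff vspaceD(2)[OF vspace])
  qed
  moreover have "x \<in> \<pi> x" using x by (rule coset_facts(2))
  ultimately have "(\<Union>y\<in>\<pi> x. \<pi> (c \<odot>\<^bsub>V\<^esub> y)) = \<pi> (c \<odot>\<^bsub>V\<^esub> x)" by (intro SUP_eq_const) blast+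
  then show ?thesis by (simp only: quot_alg_def module.simps)
qed

lemma quot_vspace: "vspace (quot_alg V N)"
  by (rule vspace_image[OF vspace quot_carrier quot_add quot_smult quot_zero])

lemma proj_linear: "linear_map V (quot_alg V N) \<pi>"
  by (rule linear_mapI[OF _ quot_add quot_smult]) (simp_all only: quot_carrier imageI)

text \<open>Both closure conditions are needed for independence of the representatives: one factor is changed at a
time, \<open>x' y' - x y = (x' - x) y' + x (y' - y)\<close>.\<close>

lemma quot_mult:
  assumes l: "\<And>x n. x \<in> carrier V \<Longrightarrow> n \<in> N \<Longrightarrow> x \<otimes>\<^bsub>V\<^esub> n \<in> N"
    and r: "\<And>x n. x \<in> carrier V \<Longrightarrow> n \<in> N \<Longrightarrow> n \<otimes>\<^bsub>V\<^esub> x \<in> N"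
    and closed: "\<And>x y. x \<in> carrier V \<Longrightarrow> y \<in> carrier V \<Longrightarrow> x \<otimes>\<^bsub>V\<^esub> y \<in> carrier V"
    and minus_l: "\<And>x y z. x \<in> carrier V \<Longrightarrow> y \<in> carrier V \<Longrightarrow> z \<in> carrier V \<Longrightarrow>
      (x \<ominus>\<^bsub>V\<^esub> y) \<otimes>\<^bsub>V\<^esub> z = x \<otimes>\<^bsub>V\<^esub> z \<ominus>\<^bsub>V\<^esub> y \<otimes>\<^bsub>V\<^esub> z"
    and minus_r: "\<And>x y z. x \<in> carrier V \<Longrightarrow> y \<in> carrier V \<Longrightarrow> z \<in> carrier V \<Longrightarrow>
      z \<otimes>\<^bsub>V\<^esub> (x \<ominus>\<^bsub>V\<^esub> y) = z \<otimes>\<^bsub>V\<^esub> x \<ominus>\<^bsub>V\<^esub> z \<otimes>\<^bsub>V\<^esub> y"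
    and x: "x \<in> carrier V" and y: "y \<in> carrier V"
  shows "\<pi> (x \<otimes>\<^bsub>V\<^esub> y) = \<pi> x \<otimes>\<^bsub>quot_alg V N\<^esub> \<pi> y"
proof -
  have "\<pi> (x' \<otimes>\<^bsub>V\<^esub> y') = \<pi> (x \<otimes>\<^bsub>V\<^esub> y)" if "x' \<in> \<pi> x" "y' \<in> \<pi> y" for x' y'
  proof -
    have x': "x' \<in> carrier V" "x' \<ominus>\<^bsub>V\<^esub> x \<in> N" and y': "y' \<in> carrier V" "y' \<ominus>\<^bsub>V\<^esub> y \<in> N"
      using that x y by (simp_all only: mem_proj_iff)
    have "\<pi> (x' \<otimes>\<^bsub>V\<^esub> y') = \<pi> (x \<otimes>\<^bsub>V\<^esub> y')"
      using r[OF y'(1) x'(2)] minus_l x x' y' closed by (simp add: proj_eq_iff)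
    also have "\<dots> = \<pi> (x \<otimes>\<^bsub>V\<^esub> y)"
      using l[OF x y'(2)] minus_r x y y' closed by (simp add: proj_eq_iff)
    finally show ?thesis .
  qed
  moreover have "x \<in> \<pi> x" "y \<in> \<pi> y" using x y coset_facts(2) by blast+
  ultimately have "(\<Union>x'\<in>\<pi> x. \<Union>y'\<in>\<pi> y. \<pi> (x' \<otimes>\<^bsub>V\<^esub> y')) = \<pi> (x \<otimes>\<^bsub>V\<^esub> y)"
    by (intro SUP_eq_const) blast+
  then show ?thesis by (simp only: quot_alg_def rcoset_mult_def monoid.simps)
qed

lemma proj_eq_zero_iff: "x \<in> carrier V \<Longrightarrow> \<pi> x = \<zero>\<^bsub>quot_alg V N\<^esub> \<longleftrightarrow> x \<in> N"
  unfolding quot_zero by (subst proj_eq_iff) (simp_all add: vspaceD(3,8,15,17)[OF vspace])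

end

section \<open>Formal linear combinations\<close>

lemma free_alg_simps:
  "carrier (free_alg G) = {p. keys p \<subseteq> carrier G}" "p \<oplus>\<^bsub>free_alg G\<^esub> q = p + q"
  "\<zero>\<^bsub>free_alg G\<^esub> = 0" "c \<odot>\<^bsub>free_alg G\<^esub> p = pscale c p" "\<one>\<^bsub>free_alg G\<^esub> = unit_vec \<one>\<^bsub>G\<^esub>"
  by (simp_all add: free_alg_def)

lemma free_alg_vspace: "vspace (free_alg G :: ('f::field, 'g \<Rightarrow>\<^sub>0 'f) module)"
proof -
  have add: "keys (p + q) \<subseteq> carrier G"
    if "keys p \<subseteq> carrier G" "keys q \<subseteq> carrier G" for p q :: "'g \<Rightarrow>\<^sub>0 'f"
    using that by (intro order_trans[OF Poly_Mapping.keys_add] Un_least)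
  have scale: "keys (pscale c p) \<subseteq> carrier G" if "keys p \<subseteq> carrier G" for c and p :: "'g \<Rightarrow>\<^sub>0 'f"
    using that by (intro order_trans[OF keys_pscale])
  have "abelian_group (free_alg G :: ('f, 'g \<Rightarrow>\<^sub>0 'f) module)"
  proof (rule abelian_groupI)
    fix p :: "'g \<Rightarrow>\<^sub>0 'f" assume "p \<in> carrier (free_alg G)"
    then have "pscale (- 1) p \<in> carrier (free_alg G)"
      unfolding free_alg_simps mem_Collect_eq by (rule scale)
    moreover have "pscale (- 1) p \<oplus>\<^bsub>free_alg G\<^esub> p = \<zero>\<^bsub>free_alg G\<^esub>"
      by (simp add: free_alg_simps pscale_uminus_left pscale_1)
    ultimately show "\<exists>q\<in>carrier (free_alg G). q \<oplus>\<^bsub>free_alg G\<^esub> p = \<zero>\<^bsub>free_alg G\<^esub>"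
      by blast
  qed (simp_all add: free_alg_simps add add_ac)
  then show ?thesis
    by (intro moduleI) (simp_all add: free_alg_simps pscale_add pscale_add_left pscale_pscale pscale_1
        cring_from_type_algebra scale)
qed

lemma free_alg_minus:
  fixes p q :: "'g \<Rightarrow>\<^sub>0 'f::field"
  assumes "p \<in> carrier (free_alg G)" "q \<in> carrier (free_alg G)"
  shows "p \<ominus>\<^bsub>free_alg G\<^esub> q = p - q"
  using assms by (simp add: vspaceD(8)[OF free_alg_vspace] free_alg_simps pscale_uminus_left pscale_1)

lemma free_alg_induct [consumes 1, case_names single add zero]:
  fixes p :: "'g \<Rightarrow>\<^sub>0 'f::field"
  assumes p: "p \<in> carrier (free_alg G)"
    and single: "\<And>i c. i \<in> carrier G \<Longrightarrow> P (single i c)"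
    and add: "\<And>p q. p \<in> carrier (free_alg G) \<Longrightarrow> q \<in> carrier (free_alg G) \<Longrightarrow> P p \<Longrightarrow> P q \<Longrightarrow> P (p + q)"
    and zero: "P 0"
  shows "P p"
proof -
  have *: "P (\<Sum>i\<in>S. single i (lookup p i)) \<and>
      (\<Sum>i\<in>S. single i (lookup p i)) \<in> carrier (free_alg G)"
    if "finite S" "S \<subseteq> carrier G" for S
    using that
  proof induction
    case empty
    then show ?case using zero by (simp add: free_alg_simps)
  next
    case (insert i S)
    have "single i (lookup p i) \<in> carrier (free_alg G)"
      using insert by (simp add: free_alg_simps)
    moreover have "P (single i (lookup p i))"
      using insert by (intro single) simp
    ultimately have "P (single i (lookup p i) + (\<Sum>i\<in>S. single i (lookup p i)))"
      "single i (lookup p i) + (\<Sum>i\<in>S. single i (lookup p i)) \<in> carrier (free_alg G)"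
      using insert vspaceD(1)[OF free_alg_vspace[of G], unfolded free_alg_simps(2)] by (blast intro: add)+
    then show ?case
      using insert by simp
  qed
  have "p = (\<Sum>i\<in>keys p. single i (lookup p i))"
    by (rule poly_mapping_eqI) (auto simp: lookup_sum lookup_single when_def in_keys_iff)
  then show ?thesis using *[OF finite_keys[of p]] p by (simp add: free_alg_simps)
qed

text \<open>The linear map out of the free vector space that sends the basis vector \<open>i\<close> to \<open>e i\<close>.\<close>

definition lin_comb :: "('f::field, 'v) module \<Rightarrow> ('g \<Rightarrow> 'v) \<Rightarrow> ('g \<Rightarrow>\<^sub>0 'f) \<Rightarrow> 'v"
  where "lin_comb M e p = (\<Oplus>\<^bsub>M\<^esub>i\<in>keys p. lookup p i \<odot>\<^bsub>M\<^esub> e i)"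

text \<open>Sums of two formal combinations are compared over a common index set, larger than either support.\<close>

lemma lin_comb_superset:
  assumes M: "vspace M" and "finite S" "keys p \<subseteq> S" and e: "\<And>i. i \<in> S \<Longrightarrow> e i \<in> carrier M"
  shows "lin_comb M e p = (\<Oplus>\<^bsub>M\<^esub>i\<in>S. lookup p i \<odot>\<^bsub>M\<^esub> e i)"
proof -
  interpret M: module scalars M by fact
  show ?thesis unfolding lin_comb_def
    by (rule M.M.add.finprod_mono_neutral_cong_left)
      (use assms vspaceD(2,5)[OF M] in \<open>auto simp: in_keys_iff Pi_iff\<close>)
qed

lemma lin_comb_linear:
  fixes M :: "('f::field, 'v) module" and e :: "'g \<Rightarrow> 'v"
  assumes M: "vspace M" and e: "\<And>i. i \<in> carrier G \<Longrightarrow> e i \<in> carrier M"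
  shows "linear_map (free_alg G) M (lin_comb M e)"
proof (rule linear_mapI)
  interpret M: module scalars M by fact
  fix p q :: "'g \<Rightarrow>\<^sub>0 'f" and c
  assume p: "p \<in> carrier (free_alg G)"
  then have ep: "i \<in> keys p \<Longrightarrow> e i \<in> carrier M" for i
    using e by (auto simp: free_alg_simps)
  show "lin_comb M e p \<in> carrier M"
    unfolding lin_comb_def by (rule M.M.finsum_closed) (use ep vspaceD(2)[OF M] in auto)
  have "lin_comb M e (pscale c p) = (\<Oplus>\<^bsub>M\<^esub>i\<in>keys p. c \<odot>\<^bsub>M\<^esub> (lookup p i \<odot>\<^bsub>M\<^esub> e i))"
    by (subst lin_comb_superset[OF M finite_keys keys_pscale])
      (auto intro!: M.M.finsum_cong' simp: ep lookup_pscale vspaceD[OF M])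
  also have "\<dots> = c \<odot>\<^bsub>M\<^esub> lin_comb M e p"
    unfolding lin_comb_def using ep
    by (subst M.finsum_smult_ldistr) (auto simp: vspaceD[OF M])
  finally show "lin_comb M e (c \<odot>\<^bsub>free_alg G\<^esub> p) = c \<odot>\<^bsub>M\<^esub> lin_comb M e p"
    by (simp add: free_alg_simps)
  assume q: "q \<in> carrier (free_alg G)"
  let ?S = "keys p \<union> keys q"
  have eS: "i \<in> ?S \<Longrightarrow> e i \<in> carrier M" for i
    using p q e by (auto simp: free_alg_simps)
  have "lin_comb M e (p + q) = (\<Oplus>\<^bsub>M\<^esub>i\<in>?S. lookup p i \<odot>\<^bsub>M\<^esub> e i \<oplus>\<^bsub>M\<^esub> lookup q i \<odot>\<^bsub>M\<^esub> e i)"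
  proof -
    have "lin_comb M e (p + q) = (\<Oplus>\<^bsub>M\<^esub>i\<in>?S. lookup (p + q) i \<odot>\<^bsub>M\<^esub> e i)"
      by (rule lin_comb_superset[OF M]) (use Poly_Mapping.keys_add[of p q] eS in auto)
    also have "\<dots> = (\<Oplus>\<^bsub>M\<^esub>i\<in>?S. lookup p i \<odot>\<^bsub>M\<^esub> e i \<oplus>\<^bsub>M\<^esub> lookup q i \<odot>\<^bsub>M\<^esub> e i)"
      by (rule M.M.finsum_cong') (use eS in \<open>auto simp: lookup_add vspaceD(1,2,12)[OF M]\<close>)
    finally show ?thesis .
  qed
  also have "\<dots> = lin_comb M e p \<oplus>\<^bsub>M\<^esub> lin_comb M e q"
  proof -
    have "lin_comb M e p = (\<Oplus>\<^bsub>M\<^esub>i\<in>?S. lookup p i \<odot>\<^bsub>M\<^esub> e i)"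
      "lin_comb M e q = (\<Oplus>\<^bsub>M\<^esub>i\<in>?S. lookup q i \<odot>\<^bsub>M\<^esub> e i)"
      by (rule lin_comb_superset[OF M]; use eS in auto)+
    then show ?thesis
      by (simp only:) (rule M.M.finsum_addf; use eS in \<open>auto simp: vspaceD(2)[OF M]\<close>)
  qed
  finally show "lin_comb M e (p \<oplus>\<^bsub>free_alg G\<^esub> q) = lin_comb M e p \<oplus>\<^bsub>M\<^esub> lin_comb M e q"
    by (simp add: free_alg_simps)
qed

lemma lin_comb_single:
  assumes M: "vspace M" and e: "e i \<in> carrier M"
  shows "lin_comb M e (single i c) = c \<odot>\<^bsub>M\<^esub> e i"
proof -
  interpret M: module scalars M by fact
  show ?thesis
    by (subst lin_comb_superset[OF M, of "{i}"]) (use e in \<open>auto simp: vspaceD[OF M] split: if_splits\<close>)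
qed

lemma free_alg_eqI:
  fixes p :: "'g \<Rightarrow>\<^sub>0 'f::field"
  assumes h: "linear_map (free_alg G) M h" and k: "linear_map (free_alg G) M k" and M: "vspace M"
    and eq: "\<And>i. i \<in> carrier G \<Longrightarrow> h (unit_vec i) = k (unit_vec i)"
    and p: "p \<in> carrier (free_alg G)"
  shows "h p = k p"
  using p
proof (induction p rule: free_alg_induct)
  case (single i c)
  then show ?case
    using linear_mapD(3)[OF h, of "unit_vec i" c] linear_mapD(3)[OF k, of "unit_vec i" c] eq[of i]
    by (simp add: free_alg_simps pscale_single)
next
  case (add p q)
  then show ?case
    using linear_mapD(2)[OF h, of p q] linear_mapD(2)[OF k, of p q] by (simp add: free_alg_simps)
next
  case zero
  then show ?case
    using linear_map_zero[OF free_alg_vspace M h] linear_map_zero[OF free_alg_vspace M k]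
    by (simp add: free_alg_simps)
qed

section \<open>Linear spans\<close>

lemma linear_map_neg:
  assumes "vspace V" "vspace W" "linear_map V W h" "x \<in> carrier V"
  shows "h (\<ominus>\<^bsub>V\<^esub> x) = \<ominus>\<^bsub>W\<^esub> h x"
  using assms by (simp only: linear_mapD(1,3)[OF assms(3)] flip: vspaceD(7))

lemma submodule_zero: "submodule N R V \<Longrightarrow> \<zero>\<^bsub>V\<^esub> \<in> N"
  using subgroup.one_closed by (fastforce simp: submodule_def)

lemma submodule_zero_set: "vspace V \<Longrightarrow> submodule {\<zero>\<^bsub>V\<^esub>} scalars V"
  by (rule module.submoduleI) (auto simp: vspaceD(2,3,15,17) vspaceD(17) simp flip: vspaceD(7))

lemma submodule_preimage:
  assumes V: "vspace V" and W: "vspace W" and h: "linear_map V W h" and N: "submodule N scalars W"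
  shows "submodule {x \<in> carrier V. h x \<in> N} scalars V"
proof (rule module.submoduleI[OF V])
  note hD = linear_mapD[OF h] and E = module.submoduleE[OF W N]
  show "\<zero>\<^bsub>V\<^esub> \<in> {x \<in> carrier V. h x \<in> N}"
    by (simp add: linear_map_zero[OF V W h] submodule_zero[OF N] vspaceD(3)[OF V])
  show "\<ominus>\<^bsub>V\<^esub> a \<in> {x \<in> carrier V. h x \<in> N}" if "a \<in> {x \<in> carrier V. h x \<in> N}" for a
    using that by (simp add: linear_map_neg[OF V W h] E(3) vspaceD(4)[OF V])
  show "a \<oplus>\<^bsub>V\<^esub> b \<in> {x \<in> carrier V. h x \<in> N}"
    if "a \<in> {x \<in> carrier V. h x \<in> N}" "b \<in> {x \<in> carrier V. h x \<in> N}" for a b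
    using that by (simp add: hD E(5) vspaceD(1)[OF V])
  show "a \<odot>\<^bsub>V\<^esub> x \<in> {x \<in> carrier V. h x \<in> N}"
    if "a \<in> carrier scalars" "x \<in> {x \<in> carrier V. h x \<in> N}" for a x
    using that by (simp add: hD E(4) vspaceD(2)[OF V])
qed auto

lemma submodule_Inter:
  assumes V: "vspace V" and "\<H> \<noteq> {}" and H: "\<And>H. H \<in> \<H> \<Longrightarrow> submodule H scalars V"
  shows "submodule (\<Inter>\<H>) scalars V"
proof (rule module.submoduleI[OF V])
  obtain H where "H \<in> \<H>" using assms(2) by blast
  then show "\<Inter>\<H> \<subseteq> carrier V" using module.submoduleE(1)[OF V H] by blast
qed (use module.submoduleE(3-5)[OF V H] submodule_zero[OF H] in blast)+

lemma lin_span_submodule: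
  assumes "vspace V" "S \<subseteq> carrier V"
  shows "submodule (lin_span V S) scalars V"
  unfolding lin_span_def
  using assms module.carrier_is_submodule[OF assms(1)] by (intro submodule_Inter) auto

lemma lin_span_superset: "S \<subseteq> lin_span V S"
  by (auto simp: lin_span_def)

lemma lin_span_minimal: "submodule H scalars V \<Longrightarrow> S \<subseteq> H \<Longrightarrow> lin_span V S \<subseteq> H"
  by (auto simp: lin_span_def)

text \<open>The preimage of a subspace is a subspace, so it suffices to look at generators.\<close>

lemma lin_span_into:
  assumes V: "vspace V" and W: "vspace W" and h: "linear_map V W h" and S: "S \<subseteq> carrier V"
    and N: "submodule N scalars W" and SN: "h ` S \<subseteq> N" and x: "x \<in> lin_span V S"
  shows "h x \<in> N"
  using lin_span_minimal[OF submodule_preimage[OF V W h N], of S] S SN x by auto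

section \<open>Tensor products\<close>

definition bilinear_on :: "('f::field, 'v) module \<Rightarrow> ('f, 'w) module \<Rightarrow> ('f, 'u) module \<Rightarrow> ('v \<Rightarrow> 'w \<Rightarrow> 'u) \<Rightarrow> bool"
  where "bilinear_on V W M g \<longleftrightarrow>
    (\<forall>x\<in>carrier V. linear_map W M (g x)) \<and> (\<forall>y\<in>carrier W. linear_map V M (\<lambda>x. g x y))"

lemma bilinear_onI:
  assumes "\<And>x. x \<in> carrier V \<Longrightarrow> linear_map W M (g x)" "\<And>y. y \<in> carrier W \<Longrightarrow> linear_map V M (\<lambda>x. g x y)"
  shows "bilinear_on V W M g"
  using assms by (simp add: bilinear_on_def)

lemma bilinear_onD:
  assumes "bilinear_on V W M g"
  shows "x \<in> carrier V \<Longrightarrow> linear_map W M (g x)" "y \<in> carrier W \<Longrightarrow> linear_map V M (\<lambda>x. g x y)"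
    and "x \<in> carrier V \<Longrightarrow> y \<in> carrier W \<Longrightarrow> g x y \<in> carrier M"
  using assms by (auto simp: bilinear_on_def linear_map_def)

lemma bilinear_on_compose:
  assumes g: "bilinear_on V W M g" and h: "linear_map V' V h" and k: "linear_map W' W k"
  shows "bilinear_on V' W' M (\<lambda>x y. g (h x) (k y))"
  using linear_map_compose[OF k bilinear_onD(1)[OF g]] linear_map_compose[OF h bilinear_onD(2)[OF g]]
    linear_mapD(1)[OF h] linear_mapD(1)[OF k]
  by (intro bilinear_onI) auto

lemma bilinear_on_add:
  assumes M: "vspace M" and "bilinear_on V W M g" and "bilinear_on V W M h"
  shows "bilinear_on V W M (\<lambda>x y. g x y \<oplus>\<^bsub>M\<^esub> h x y)"
  using assms by (intro bilinear_onI linear_map_add) (auto simp: bilinear_on_def)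

lemma bilinear_on_diff:
  assumes M: "vspace M" and "bilinear_on V W M g" and "bilinear_on V W M h"
  shows "bilinear_on V W M (\<lambda>x y. g x y \<ominus>\<^bsub>M\<^esub> h x y)"
  using assms by (intro bilinear_onI linear_map_diff) (auto simp: bilinear_on_def)

lemma bilinear_on_linear:
  assumes "bilinear_on V W M g" and "linear_map M M' h"
  shows "bilinear_on V W M' (\<lambda>x y. h (g x y))"
  using assms by (auto intro!: bilinear_onI linear_map_compose[OF _ assms(2)] simp: bilinear_on_def)

lemma bilinear_on_swap: "bilinear_on V W M g \<Longrightarrow> bilinear_on W V M (\<lambda>x y. g y x)"
  by (simp add: bilinear_on_def)

lemma linear_map_ident: "linear_map V V (\<lambda>x. x)"
  by (rule linear_mapI) simp_all

lemma linear_map_const_zero: "vspace W \<Longrightarrow> linear_map V W (\<lambda>x. \<zero>\<^bsub>W\<^esub>)"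
  by (rule linear_mapI) (simp_all add: vspaceD(3,15,17))

text \<open>The generators in the shape \<open>p - q\<close> in which they say that \<open>p\<close> and \<open>q\<close> have the same coset.\<close>

lemma tensor_relI:
  "x \<in> carrier V \<Longrightarrow> x' \<in> carrier V \<Longrightarrow> y \<in> carrier W \<Longrightarrow>
    unit_vec (x \<oplus>\<^bsub>V\<^esub> x', y) - (unit_vec (x, y) + unit_vec (x', y)) \<in> tensor_rel V W"
  "x \<in> carrier V \<Longrightarrow> y \<in> carrier W \<Longrightarrow> y' \<in> carrier W \<Longrightarrow>
    unit_vec (x, y \<oplus>\<^bsub>W\<^esub> y') - (unit_vec (x, y) + unit_vec (x, y')) \<in> tensor_rel V W"
  "x \<in> carrier V \<Longrightarrow> y \<in> carrier W \<Longrightarrow>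
    unit_vec (c \<odot>\<^bsub>V\<^esub> x, y) - single (x, y) c \<in> tensor_rel V W"
  "x \<in> carrier V \<Longrightarrow> y \<in> carrier W \<Longrightarrow>
    unit_vec (x, c \<odot>\<^bsub>W\<^esub> y) - single (x, y) c \<in> tensor_rel V W"
  unfolding tensor_rel_def diff_diff_eq[symmetric] by blast+

lemma tensor_rel_carrier:
  assumes "vspace V" "vspace W"
  shows "tensor_rel V W \<subseteq> carrier (free_alg (V \<times>\<times> W))"
proof -
  have minus: "p - q \<in> carrier (free_alg (V \<times>\<times> W))"
    if "p \<in> carrier (free_alg (V \<times>\<times> W))" "q \<in> carrier (free_alg (V \<times>\<times> W))" for p q :: "'b \<times> 'c \<Rightarrow>\<^sub>0 'a"
    using vspaceD(9)[OF free_alg_vspace that] free_alg_minus[OF that] by simp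
  have single: "single (x, y) c \<in> carrier (free_alg (V \<times>\<times> W))"
    if "x \<in> carrier V" "y \<in> carrier W" for x y and c :: 'a
    using that by (simp add: free_alg_simps DirProd_def)
  show ?thesis
    unfolding tensor_rel_def using vspaceD(1,2)[OF assms(1)] vspaceD(1,2)[OF assms(2)]
    by (auto intro!: minus single)
qed

lemma tensor_subspace:
  assumes "vspace V" "vspace W"
  shows "subspace (free_alg (V \<times>\<times> W)) (tensor_null V W)"
  unfolding subspace_def tensor_null_def
  using assms by (simp add: free_alg_vspace lin_span_submodule tensor_rel_carrier)

lemma tensor_vspace: "vspace V \<Longrightarrow> vspace W \<Longrightarrow> vspace (tensor V W)"
  unfolding tensor_def by (intro subspace.quot_vspace tensor_subspace)

lemma unit_in_free_prod:
  "x \<in> carrier V \<Longrightarrow> y \<in> carrier W \<Longrightarrow> single (x, y) c \<in> carrier (free_alg (V \<times>\<times> W))"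
  by (simp add: free_alg_simps DirProd_def)

lemma tens_closed:
  "vspace V \<Longrightarrow> vspace W \<Longrightarrow> x \<in> carrier V \<Longrightarrow> y \<in> carrier W \<Longrightarrow> tens V W x y \<in> carrier (tensor V W)"
  unfolding tens_def tensor_def
  by (simp only: subspace.quot_carrier[OF tensor_subspace] imageI unit_in_free_prod)

lemma tens_single:
  assumes "vspace V" "vspace W" "x \<in> carrier V" "y \<in> carrier W"
  shows "tensor_null V W +>\<^bsub>free_alg (V \<times>\<times> W)\<^esub> single (x, y) c = c \<odot>\<^bsub>tensor V W\<^esub> tens V W x y"
  unfolding tensor_def tens_def
  using assms subspace.quot_smult[OF tensor_subspace[OF assms(1,2)], of "unit_vec (x, y)" c, symmetric]
  by (simp add: unit_in_free_prod free_alg_simps pscale_single)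

lemma tens_bilinear:
  fixes V :: "('f::field, 'v) module" and W :: "('f, 'w) module"
  assumes V: "vspace V" and W: "vspace W"
  shows "bilinear_on V W (tensor V W) (tens V W)"
proof -
  interpret T: subspace "free_alg (V \<times>\<times> W)" "tensor_null V W"
    using V W by (rule tensor_subspace)
  note unit = unit_in_free_prod[of _ V _ W]
  have rel: "r \<in> tensor_null V W" if "r \<in> tensor_rel V W" for r
    using subsetD[OF lin_span_superset that] by (simp add: tensor_null_def)
  have eq: "T.\<pi> p = T.\<pi> q"
    if "p - q \<in> tensor_rel V W" "p \<in> carrier (free_alg (V \<times>\<times> W))" "q \<in> carrier (free_alg (V \<times>\<times> W))" for p q
    using that rel by (simp add: T.proj_eq_iff free_alg_minus)
  have add: "T.\<pi> p \<oplus>\<^bsub>tensor V W\<^esub> T.\<pi> q = T.\<pi> (p + q)"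
    if "p \<in> carrier (free_alg (V \<times>\<times> W))" "q \<in> carrier (free_alg (V \<times>\<times> W))" for p q
    using T.quot_add[OF that] by (simp add: tensor_def free_alg_simps)
  have plus: "p + q \<in> carrier (free_alg (V \<times>\<times> W))"
    if "p \<in> carrier (free_alg (V \<times>\<times> W))" "q \<in> carrier (free_alg (V \<times>\<times> W))" for p q :: "'v \<times> 'w \<Rightarrow>\<^sub>0 'f"
    using vspaceD(1)[OF free_alg_vspace that] by (simp add: free_alg_simps)
  note VD = vspaceD(1,2)[OF V] and WD = vspaceD(1,2)[OF W]
  show ?thesis
  proof (intro bilinear_onI linear_mapI)
    fix x y assume x: "x \<in> carrier V" and y: "y \<in> carrier W"
    show "tens V W x y \<in> carrier (tensor V W)" "tens V W x y \<in> carrier (tensor V W)"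
      using tens_closed[OF V W x y] by simp_all
    show "tens V W x (c \<odot>\<^bsub>W\<^esub> y) = c \<odot>\<^bsub>tensor V W\<^esub> tens V W x y" for c
      unfolding tens_single[OF V W x y, symmetric] unfolding tens_def
      by (rule eq) (use x y WD in \<open>simp_all add: tensor_relI unit\<close>)
    show "tens V W (c \<odot>\<^bsub>V\<^esub> x) y = c \<odot>\<^bsub>tensor V W\<^esub> tens V W x y" for c
      unfolding tens_single[OF V W x y, symmetric] unfolding tens_def
      by (rule eq) (use x y VD in \<open>simp_all add: tensor_relI unit\<close>)
    show "tens V W (x \<oplus>\<^bsub>V\<^esub> x') y = tens V W x y \<oplus>\<^bsub>tensor V W\<^esub> tens V W x' y" if x': "x' \<in> carrier V" for x'
    proof -
      have "T.\<pi> (unit_vec (x \<oplus>\<^bsub>V\<^esub> x', y)) = T.\<pi> (unit_vec (x, y) + unit_vec (x', y))"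
        by (rule eq) (use x y x' VD in \<open>simp_all add: tensor_relI unit plus\<close>)
      then show ?thesis
        using x y x' by (simp add: tens_def add unit)
    qed
    show "tens V W x (y \<oplus>\<^bsub>W\<^esub> y') = tens V W x y \<oplus>\<^bsub>tensor V W\<^esub> tens V W x y'" if y': "y' \<in> carrier W" for y'
    proof -
      have "T.\<pi> (unit_vec (x, y \<oplus>\<^bsub>W\<^esub> y')) = T.\<pi> (unit_vec (x, y) + unit_vec (x, y'))"
        by (rule eq) (use x y y' WD in \<open>simp_all add: tensor_relI unit plus\<close>)
      then show ?thesis
        using x y y' by (simp add: tens_def add unit)
    qed
  qed
qed

text \<open>Every coset contains a formal sum of pairs, so the tensor product is spanned by pure tensors.\<close>

lemma tensor_induct [consumes 3, case_names tens add smult]: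
  assumes V: "vspace V" and W: "vspace W" and t: "t \<in> carrier (tensor V W)"
    and tens: "\<And>x y. x \<in> carrier V \<Longrightarrow> y \<in> carrier W \<Longrightarrow> P (tens V W x y)"
    and add: "\<And>s t. s \<in> carrier (tensor V W) \<Longrightarrow> t \<in> carrier (tensor V W) \<Longrightarrow> P s \<Longrightarrow> P t \<Longrightarrow> P (s \<oplus>\<^bsub>tensor V W\<^esub> t)"
    and smult: "\<And>c t. t \<in> carrier (tensor V W) \<Longrightarrow> P t \<Longrightarrow> P (c \<odot>\<^bsub>tensor V W\<^esub> t)"
  shows "P t"
proof -
  interpret T: subspace "free_alg (V \<times>\<times> W)" "tensor_null V W"
    using V W by (rule tensor_subspace)
  have psingle: "P (T.\<pi> (single (x, y) c))" if "x \<in> carrier V" "y \<in> carrier W" for x y c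
    unfolding tens_single[OF V W that] using that by (intro smult tens tens_closed V W)
  have "P (T.\<pi> p)" if "p \<in> carrier (free_alg (V \<times>\<times> W))" for p
    using that
  proof (induction p rule: free_alg_induct)
    case (single i c)
    then show ?case using psingle[of "fst i" "snd i" c] by (auto simp: DirProd_def)
  next
    case (add p q)
    have "T.\<pi> p \<in> carrier (tensor V W)" "T.\<pi> q \<in> carrier (tensor V W)"
      using add by (simp_all add: tensor_def T.quot_carrier)
    then show ?case
      using assms(5)[of "T.\<pi> p" "T.\<pi> q"] add T.quot_add[of p q] by (simp add: tensor_def free_alg_simps)
  next
    case zero
    show ?case using psingle[OF vspaceD(3)[OF V] vspaceD(3)[OF W], of 0] by simp
  qed
  then show ?thesis using t by (auto simp: tensor_def T.quot_carrier)
qed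

lemma tensor_eqI:
  assumes V: "vspace V" and W: "vspace W"
    and h: "linear_map (tensor V W) M h" and k: "linear_map (tensor V W) M k"
    and eq: "\<And>x y. x \<in> carrier V \<Longrightarrow> y \<in> carrier W \<Longrightarrow> h (tens V W x y) = k (tens V W x y)"
    and t: "t \<in> carrier (tensor V W)"
  shows "h t = k t"
  using V W t by (induction rule: tensor_induct) (simp_all add: eq linear_mapD[OF h] linear_mapD[OF k])

text \<open>The universal property.  The linear extension of \<open>g\<close> to formal sums kills the defining relations
because \<open>g\<close> is bilinear, so it is constant on cosets, and the representative chosen in the definition
of the lift does not matter.\<close>

lemma tensor_lift:
  fixes V :: "('f::field, 'v) module" and W :: "('f, 'w) module" and M :: "('f, 'u) module"
  assumes V: "vspace V" and W: "vspace W" and M: "vspace M" and g: "bilinear_on V W M g"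
  shows tensor_lift_linear: "linear_map (tensor V W) M (tensor_lift M g)"
    and tensor_lift_tens: "x \<in> carrier V \<Longrightarrow> y \<in> carrier W \<Longrightarrow> tensor_lift M g (tens V W x y) = g x y"
proof -
  interpret T: subspace "free_alg (V \<times>\<times> W)" "tensor_null V W"
    using V W by (rule tensor_subspace)
  let ?E = "lin_comb M (\<lambda>z. g (fst z) (snd z))"
  have gc: "z \<in> carrier (V \<times>\<times> W) \<Longrightarrow> g (fst z) (snd z) \<in> carrier M" for z
    using bilinear_onD(3)[OF g] by (auto simp: DirProd_def)
  have E: "linear_map (free_alg (V \<times>\<times> W)) M ?E"
    by (rule lin_comb_linear[OF M gc])
  have single: "?E (single (x, y) c) = c \<odot>\<^bsub>M\<^esub> g x y"
    if "x \<in> carrier V" "y \<in> carrier W" for x y c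
    using lin_comb_single[OF M, where e = "\<lambda>z. g (fst z) (snd z)" and i = "(x, y)"] bilinear_onD(3)[OF g] that by simp
  note unit = unit_in_free_prod[of _ V _ W]
  note VD = vspaceD(1,2)[OF V] and WD = vspaceD(1,2)[OF W] and MD = vspaceD[OF M]
  have minus: "?E (p - q) = ?E p \<ominus>\<^bsub>M\<^esub> ?E q" "p - q \<in> carrier (free_alg (V \<times>\<times> W))"
    if "p \<in> carrier (free_alg (V \<times>\<times> W))" "q \<in> carrier (free_alg (V \<times>\<times> W))" for p q
    using linear_map_minus[OF T.vspace M E that] vspaceD(9)[OF T.vspace that] by (simp_all add: free_alg_minus that)
  have cancel: "a \<oplus>\<^bsub>M\<^esub> b \<ominus>\<^bsub>M\<^esub> a \<ominus>\<^bsub>M\<^esub> b = \<zero>\<^bsub>M\<^esub>" if "a \<in> carrier M" "b \<in> carrier M" for a b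
  proof -
    interpret M: abelian_group M using M by (rule module.axioms(2))
    show ?thesis using that
      by (metis M.a_comm M.add.inv_solve_right' M.add.m_closed M.minus_eq MD(14) a_minus_def)
  qed
  have self: "a \<ominus>\<^bsub>M\<^esub> a = \<zero>\<^bsub>M\<^esub>" if "a \<in> carrier M" for a
    using MD(14)[OF that that] by simp
  have "?E r = \<zero>\<^bsub>M\<^esub>" if "r \<in> tensor_rel V W" for r
    using that unfolding tensor_rel_def
    by (auto simp: minus single unit VD WD MD(1,2,6) linear_mapD(2,3)[OF bilinear_onD(1)[OF g]]
        linear_mapD(2,3)[OF bilinear_onD(2)[OF g]] bilinear_onD(3)[OF g] intro!: cancel self)
  then have null: "?E r = \<zero>\<^bsub>M\<^esub>" if "r \<in> tensor_null V W" for r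
  proof -
    have "?E r \<in> {\<zero>\<^bsub>M\<^esub>}"
    proof (rule lin_span_into[OF T.vspace M E tensor_rel_carrier[OF V W] submodule_zero_set[OF M]])
      show "r \<in> lin_span (free_alg (V \<times>\<times> W)) (tensor_rel V W)"
        using that by (simp add: tensor_null_def)
    qed (use \<open>\<And>r. r \<in> tensor_rel V W \<Longrightarrow> ?E r = \<zero>\<^bsub>M\<^esub>\<close> in blast)
    then show ?thesis by simp
  qed
  have lift: "tensor_lift M g (T.\<pi> p) = ?E p" if p: "p \<in> carrier (free_alg (V \<times>\<times> W))" for p
  proof -
    have "p \<in> T.\<pi> p"
      using T.mem_proj[OF p, of p] p by simp
    then have some: "(SOME q. q \<in> T.\<pi> p) \<in> T.\<pi> p"
      by (rule someI)
    have mem: "q \<in> carrier (free_alg (V \<times>\<times> W)) \<and> q - p \<in> tensor_null V W" if "q \<in> T.\<pi> p" for q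
      using that p by (auto simp: T.mem_proj_iff free_alg_minus)
    note q = conjunct1[OF mem[OF some]] conjunct2[OF mem[OF some]]
    have "?E (SOME q. q \<in> T.\<pi> p) \<ominus>\<^bsub>M\<^esub> ?E p = \<zero>\<^bsub>M\<^esub>"
      using null[OF q(2)] unfolding minus(1)[OF q(1) p] .
    then have "?E (SOME q. q \<in> T.\<pi> p) = ?E p"
      using MD(14)[OF linear_mapD(1)[OF E q(1)] linear_mapD(1)[OF E p]] by blast
    then show ?thesis
      by (simp add: tensor_lift_def lin_comb_def Let_def)
  qed
  show "x \<in> carrier V \<Longrightarrow> y \<in> carrier W \<Longrightarrow> tensor_lift M g (tens V W x y) = g x y" for x y
    using lift[of "unit_vec (x, y)"] single[of x y 1] bilinear_onD(3)[OF g]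
    by (simp add: tens_def unit MD(6))
  show "linear_map (tensor V W) M (tensor_lift M g)"
  proof (rule linear_mapI)
    fix s assume "s \<in> carrier (tensor V W)"
    then obtain p where p: "s = T.\<pi> p" "p \<in> carrier (free_alg (V \<times>\<times> W))"
      by (auto simp: tensor_def T.quot_carrier)
    show "tensor_lift M g s \<in> carrier M"
      using p by (simp add: lift linear_mapD[OF E])
    show "tensor_lift M g (c \<odot>\<^bsub>tensor V W\<^esub> s) = c \<odot>\<^bsub>M\<^esub> tensor_lift M g s" for c
      using T.quot_smult[OF p(2), of c] lift[of "c \<odot>\<^bsub>free_alg (V \<times>\<times> W)\<^esub> p"] vspaceD(2)[OF T.vspace p(2), of c]
      by (simp add: p lift linear_mapD[OF E] flip: tensor_def)
    fix t assume "t \<in> carrier (tensor V W)"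
    then obtain q where q: "t = T.\<pi> q" "q \<in> carrier (free_alg (V \<times>\<times> W))"
      by (auto simp: tensor_def T.quot_carrier)
    show "tensor_lift M g (s \<oplus>\<^bsub>tensor V W\<^esub> t) = tensor_lift M g s \<oplus>\<^bsub>M\<^esub> tensor_lift M g t"
      using T.quot_add[OF p(2) q(2)] lift[of "p \<oplus>\<^bsub>free_alg (V \<times>\<times> W)\<^esub> q"] vspaceD(1)[OF T.vspace p(2) q(2)]
      by (simp add: p q lift linear_mapD[OF E] flip: tensor_def)
  qed
qed

section \<open>Products on tensor products\<close>

text \<open>A bilinear product is all that Lie algebras and associative algebras have in common, and all that is
needed to multiply tensors factor by factor.\<close>

definition nonassoc_algebra :: "('f::field, 'v) module \<Rightarrow> bool"
  where "nonassoc_algebra V \<longleftrightarrow> vspace V \<and> bilinear_on V V V (monoid.mult V)"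

lemma free_alg_mult: "p \<otimes>\<^bsub>free_alg G\<^esub> q = ext (\<lambda>a. ext (\<lambda>b. unit_vec (a \<otimes>\<^bsub>G\<^esub> b)) q) p"
  by (simp add: free_alg_def ext_def pscale_sum pscale_single)

lemma free_alg_mult_single:
  "single a c \<otimes>\<^bsub>free_alg G\<^esub> single b d = single (a \<otimes>\<^bsub>G\<^esub> b) (c * d)"
  by (simp add: free_alg_mult ext_single pscale_single)

lemma free_alg_algebra:
  fixes G :: "('g, 'm) monoid_scheme"
  assumes G: "\<And>a b. a \<in> carrier G \<Longrightarrow> b \<in> carrier G \<Longrightarrow> a \<otimes>\<^bsub>G\<^esub> b \<in> carrier G"
  shows "nonassoc_algebra (free_alg G :: ('f::field, 'g \<Rightarrow>\<^sub>0 'f) module)"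
proof -
  have closed: "keys (p \<otimes>\<^bsub>free_alg G\<^esub> q) \<subseteq> carrier G"
    if "keys p \<subseteq> carrier G" "keys q \<subseteq> carrier G" for p q :: "'g \<Rightarrow>\<^sub>0 'f"
    unfolding free_alg_mult by (intro keys_ext[OF that(1)] keys_ext[OF that(2)]) (simp add: G)
  show ?thesis
    unfolding nonassoc_algebra_def
  proof (intro conjI bilinear_onI linear_mapI free_alg_vspace)
    fix p q r :: "'g \<Rightarrow>\<^sub>0 'f" and c
    show "p \<in> carrier (free_alg G) \<Longrightarrow> q \<in> carrier (free_alg G) \<Longrightarrow> p \<otimes>\<^bsub>free_alg G\<^esub> q \<in> carrier (free_alg G)"
      "p \<in> carrier (free_alg G) \<Longrightarrow> q \<in> carrier (free_alg G) \<Longrightarrow> q \<otimes>\<^bsub>free_alg G\<^esub> p \<in> carrier (free_alg G)"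
      by (simp_all add: free_alg_simps closed)
    show "p \<otimes>\<^bsub>free_alg G\<^esub> (q \<oplus>\<^bsub>free_alg G\<^esub> r) = p \<otimes>\<^bsub>free_alg G\<^esub> q \<oplus>\<^bsub>free_alg G\<^esub> p \<otimes>\<^bsub>free_alg G\<^esub> r"
      "p \<otimes>\<^bsub>free_alg G\<^esub> (c \<odot>\<^bsub>free_alg G\<^esub> q) = c \<odot>\<^bsub>free_alg G\<^esub> (p \<otimes>\<^bsub>free_alg G\<^esub> q)"
      "(q \<oplus>\<^bsub>free_alg G\<^esub> r) \<otimes>\<^bsub>free_alg G\<^esub> p = q \<otimes>\<^bsub>free_alg G\<^esub> p \<oplus>\<^bsub>free_alg G\<^esub> r \<otimes>\<^bsub>free_alg G\<^esub> p"
      "(c \<odot>\<^bsub>free_alg G\<^esub> q) \<otimes>\<^bsub>free_alg G\<^esub> p = c \<odot>\<^bsub>free_alg G\<^esub> (q \<otimes>\<^bsub>free_alg G\<^esub> p)"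
      by (simp_all add: free_alg_simps free_alg_mult ext_add ext_pscale ext_fun_add ext_fun_pscale)
  qed
qed

lemma quot_algebra:
  assumes V: "nonassoc_algebra V" and N: "submodule N scalars V"
    and l: "\<And>x n. x \<in> carrier V \<Longrightarrow> n \<in> N \<Longrightarrow> x \<otimes>\<^bsub>V\<^esub> n \<in> N"
    and r: "\<And>x n. x \<in> carrier V \<Longrightarrow> n \<in> N \<Longrightarrow> n \<otimes>\<^bsub>V\<^esub> x \<in> N"
  shows quot_algebra_nonassoc: "nonassoc_algebra (quot_alg V N)"
    and quot_algebra_mult: "x \<in> carrier V \<Longrightarrow> y \<in> carrier V \<Longrightarrow>
      N +>\<^bsub>V\<^esub> (x \<otimes>\<^bsub>V\<^esub> y) = (N +>\<^bsub>V\<^esub> x) \<otimes>\<^bsub>quot_alg V N\<^esub> (N +>\<^bsub>V\<^esub> y)"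
proof -
  have vV: "vspace V" and m: "bilinear_on V V V (monoid.mult V)"
    using V by (simp_all add: nonassoc_algebra_def)
  interpret Q: subspace V N
    using vV N by (rule subspace.intro)
  have mult: "Q.\<pi> (x \<otimes>\<^bsub>V\<^esub> y) = Q.\<pi> x \<otimes>\<^bsub>quot_alg V N\<^esub> Q.\<pi> y" if "x \<in> carrier V" "y \<in> carrier V" for x y
    using l r bilinear_onD(3)[OF m] that linear_map_minus[OF vV vV bilinear_onD(1)[OF m]]
      linear_map_minus[OF vV vV bilinear_onD(2)[OF m]]
    by (intro Q.quot_mult) auto
  then show "x \<in> carrier V \<Longrightarrow> y \<in> carrier V \<Longrightarrow>
      N +>\<^bsub>V\<^esub> (x \<otimes>\<^bsub>V\<^esub> y) = (N +>\<^bsub>V\<^esub> x) \<otimes>\<^bsub>quot_alg V N\<^esub> (N +>\<^bsub>V\<^esub> y)" for x y .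
  note D = linear_mapD[OF bilinear_onD(1)[OF m]] linear_mapD[OF bilinear_onD(2)[OF m]]
  note VD = vspaceD(1,2)[OF vV]
  have "bilinear_on (quot_alg V N) (quot_alg V N) (quot_alg V N) (monoid.mult (quot_alg V N))"
    by (intro bilinear_onI linear_mapI; unfold Q.quot_carrier; elim imageE;
        simp add: D VD flip: mult Q.quot_add Q.quot_smult)
  then show "nonassoc_algebra (quot_alg V N)"
    by (simp add: nonassoc_algebra_def Q.quot_vspace)
qed

text \<open>The product is well defined if the null space is a two-sided ideal.  Multiplication by a generator
\<open>(x, y)\<close> covers the lift of the bilinear map \<open>a, b \<mapsto> xa \<otimes> yb\<close> (or \<open>ax \<otimes> by\<close>) to the tensor product,
which sends \<open>0\<close> to \<open>0\<close>; hence it preserves the null space, and by linearity so does multiplication by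
any formal sum.\<close>

lemma tensor_algebra:
  fixes V :: "('f::field, 'v) module" and W :: "('f, 'w) module"
  assumes V: "nonassoc_algebra V" and W: "nonassoc_algebra W"
  shows tensor_algebra_nonassoc: "nonassoc_algebra (tensor V W)"
    and tens_mult: "x \<in> carrier V \<Longrightarrow> y \<in> carrier W \<Longrightarrow> x' \<in> carrier V \<Longrightarrow> y' \<in> carrier W \<Longrightarrow>
      tens V W x y \<otimes>\<^bsub>tensor V W\<^esub> tens V W x' y' = tens V W (x \<otimes>\<^bsub>V\<^esub> x') (y \<otimes>\<^bsub>W\<^esub> y')"
proof -
  have vV: "vspace V" and mV: "bilinear_on V V V (monoid.mult V)"
    and vW: "vspace W" and mW: "bilinear_on W W W (monoid.mult W)"
    using V W by (simp_all add: nonassoc_algebra_def)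
  let ?F = "free_alg (V \<times>\<times> W) :: ('f, 'v \<times> 'w \<Rightarrow>\<^sub>0 'f) module"
  interpret T: subspace ?F "tensor_null V W"
    using vV vW by (rule tensor_subspace)
  have F: "nonassoc_algebra ?F"
    by (rule free_alg_algebra) (use bilinear_onD(3)[OF mV] bilinear_onD(3)[OF mW] in \<open>auto simp: DirProd_def\<close>)
  then have mF: "bilinear_on ?F ?F ?F (monoid.mult ?F)" by (simp add: nonassoc_algebra_def)
  note vT = tensor_vspace[OF vV vW] and bT = tens_bilinear[OF vV vW]
  note unit = unit_in_free_prod[of _ V _ W]
  have proj: "linear_map ?F (tensor V W) T.\<pi>"
    using T.proj_linear by (simp add: tensor_def)
  have kernel: "n \<in> tensor_null V W \<longleftrightarrow> T.\<pi> n = \<zero>\<^bsub>tensor V W\<^esub>" if "n \<in> carrier ?F" for n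
    using T.proj_eq_zero_iff[OF that] by (simp add: tensor_def)
  have NF: "n \<in> tensor_null V W \<Longrightarrow> n \<in> carrier ?F" for n
    using module.submoduleE(1)[OF T.vspace T.submodule] by blast
  have unit_mult: "T.\<pi> (unit_vec (x, y) \<otimes>\<^bsub>?F\<^esub> n) = \<zero>\<^bsub>tensor V W\<^esub>" "T.\<pi> (n \<otimes>\<^bsub>?F\<^esub> unit_vec (x, y)) = \<zero>\<^bsub>tensor V W\<^esub>"
    if x: "x \<in> carrier V" and y: "y \<in> carrier W" and n: "n \<in> tensor_null V W" for x y n
  proof -
    \<comment> \<open>\<open>h\<close> is multiplication by the generator, \<open>g\<close> the bilinear map whose lift it covers.\<close>
    have gen: "T.\<pi> (h n) = \<zero>\<^bsub>tensor V W\<^esub>"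
      if g: "bilinear_on V W (tensor V W) g" and h: "linear_map ?F ?F h"
        and eq: "\<And>a b. a \<in> carrier V \<Longrightarrow> b \<in> carrier W \<Longrightarrow> T.\<pi> (h (unit_vec (a, b))) = g a b" for g h
    proof -
      have "T.\<pi> (h n) = tensor_lift (tensor V W) g (T.\<pi> n)"
      proof (rule free_alg_eqI[where h = "\<lambda>n. T.\<pi> (h n)"])
        show "linear_map ?F (tensor V W) (\<lambda>n. T.\<pi> (h n))"
          by (rule linear_map_compose[OF h proj])
        show "linear_map ?F (tensor V W) (\<lambda>n. tensor_lift (tensor V W) g (T.\<pi> n))"
          by (rule linear_map_compose[OF proj tensor_lift_linear[OF vV vW vT g]])
        show "T.\<pi> (h (unit_vec i)) = tensor_lift (tensor V W) g (T.\<pi> (unit_vec i))" if "i \<in> carrier (V \<times>\<times> W)" for i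
          using that eq tensor_lift_tens[OF vV vW vT g] by (auto simp: DirProd_def tens_def)
      qed (use vT NF n in auto)
      also have "T.\<pi> n = \<zero>\<^bsub>tensor V W\<^esub>"
        using kernel NF n by blast
      finally show ?thesis
        using linear_map_zero[OF vT vT tensor_lift_linear[OF vV vW vT g]] by simp
    qed
    show "T.\<pi> (unit_vec (x, y) \<otimes>\<^bsub>?F\<^esub> n) = \<zero>\<^bsub>tensor V W\<^esub>"
      by (rule gen[OF bilinear_on_compose[OF bT bilinear_onD(1)[OF mV x] bilinear_onD(1)[OF mW y]]
            bilinear_onD(1)[OF mF unit[OF x y]]])
        (simp add: free_alg_mult_single tens_def)
    show "T.\<pi> (n \<otimes>\<^bsub>?F\<^esub> unit_vec (x, y)) = \<zero>\<^bsub>tensor V W\<^esub>"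
      by (rule gen[OF bilinear_on_compose[OF bT bilinear_onD(2)[OF mV x] bilinear_onD(2)[OF mW y]]
            bilinear_onD(2)[OF mF unit[OF x y]]])
        (simp add: free_alg_mult_single tens_def)
  qed
  have l: "p \<otimes>\<^bsub>?F\<^esub> n \<in> tensor_null V W" and r: "n \<otimes>\<^bsub>?F\<^esub> p \<in> tensor_null V W"
    if p: "p \<in> carrier ?F" and n: "n \<in> tensor_null V W" for p n
  proof -
    have "T.\<pi> (p \<otimes>\<^bsub>?F\<^esub> n) = \<zero>\<^bsub>tensor V W\<^esub>"
      by (rule free_alg_eqI[where h = "\<lambda>p. T.\<pi> (p \<otimes>\<^bsub>?F\<^esub> n)" and k = "\<lambda>_. \<zero>\<^bsub>tensor V W\<^esub>", OF
            linear_map_compose[OF bilinear_onD(2)[OF mF NF[OF n]] proj] linear_map_const_zero[OF vT] vT _ p])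
        (use unit_mult n in \<open>auto simp: DirProd_def\<close>)
    then show "p \<otimes>\<^bsub>?F\<^esub> n \<in> tensor_null V W"
      using kernel bilinear_onD(3)[OF mF p NF[OF n]] by blast
    have "T.\<pi> (n \<otimes>\<^bsub>?F\<^esub> p) = \<zero>\<^bsub>tensor V W\<^esub>"
      by (rule free_alg_eqI[where h = "\<lambda>p. T.\<pi> (n \<otimes>\<^bsub>?F\<^esub> p)" and k = "\<lambda>_. \<zero>\<^bsub>tensor V W\<^esub>", OF
            linear_map_compose[OF bilinear_onD(1)[OF mF NF[OF n]] proj] linear_map_const_zero[OF vT] vT _ p])
        (use unit_mult n in \<open>auto simp: DirProd_def\<close>)
    then show "n \<otimes>\<^bsub>?F\<^esub> p \<in> tensor_null V W"
      using kernel bilinear_onD(3)[OF mF NF[OF n] p] by blast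
  qed
  show "nonassoc_algebra (tensor V W)"
    unfolding tensor_def by (rule quot_algebra_nonassoc[OF F T.submodule l r])
  show "x \<in> carrier V \<Longrightarrow> y \<in> carrier W \<Longrightarrow> x' \<in> carrier V \<Longrightarrow> y' \<in> carrier W \<Longrightarrow>
      tens V W x y \<otimes>\<^bsub>tensor V W\<^esub> tens V W x' y' = tens V W (x \<otimes>\<^bsub>V\<^esub> x') (y \<otimes>\<^bsub>W\<^esub> y')" for x y x' y'
    unfolding tens_def tensor_def
    by (subst quot_algebra_mult[OF F T.submodule l r, symmetric])
      (simp_all add: unit free_alg_mult_single)
qed

section \<open>Maps out of iterated tensor products\<close>

text \<open>Linearity in a parameter is checked on pure tensors.  This is what makes a lift of lifts well defined,
as in maps out of \<open>V \<otimes> (V \<otimes> V)\<close> or out of two tensors at once.\<close>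

lemma tensor_lift_param:
  assumes V: "vspace V" and W: "vspace W" and M: "vspace M"
    and g: "\<And>x. x \<in> carrier X1 \<Longrightarrow> bilinear_on V W M (g x)"
    and lin: "\<And>v w. v \<in> carrier V \<Longrightarrow> w \<in> carrier W \<Longrightarrow> linear_map X1 M (\<lambda>x. g x v w)"
    and X1: "vspace X1" and t: "t \<in> carrier (tensor V W)"
  shows "linear_map X1 M (\<lambda>x. tensor_lift M (g x) t)"
proof (rule linear_mapI)
  note L = tensor_lift_linear[OF V W M g] and LT = tensor_lift_tens[OF V W M g]
  note XD = vspaceD(1,2)[OF X1] and l = linear_mapD[OF lin]
  show "tensor_lift M (g x) t \<in> carrier M" if "x \<in> carrier X1" for x
    by (rule linear_mapD(1)[OF L[OF that] t])
  show "tensor_lift M (g (x \<oplus>\<^bsub>X1\<^esub> y)) t = tensor_lift M (g x) t \<oplus>\<^bsub>M\<^esub> tensor_lift M (g y) t"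
    if x: "x \<in> carrier X1" and y: "y \<in> carrier X1" for x y
    by (rule tensor_eqI[OF V W L[OF XD(1)[OF x y]] linear_map_add[OF M L[OF x] L[OF y]] _ t])
      (simp add: LT x y XD l)
  show "tensor_lift M (g (c \<odot>\<^bsub>X1\<^esub> x)) t = c \<odot>\<^bsub>M\<^esub> tensor_lift M (g x) t" if x: "x \<in> carrier X1" for c x
    by (rule tensor_eqI[OF V W L[OF XD(2)[OF x]] linear_map_smult[OF M L[OF x]] _ t])
      (simp add: LT x XD l)
qed

lemma tensor_lift_bilinear:
  assumes V: "vspace V" and W: "vspace W" and M: "vspace M" and X1: "vspace X1"
    and g: "\<And>x. x \<in> carrier X1 \<Longrightarrow> bilinear_on V W M (g x)"
    and lin: "\<And>v w. v \<in> carrier V \<Longrightarrow> w \<in> carrier W \<Longrightarrow> linear_map X1 M (\<lambda>x. g x v w)"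
  shows "bilinear_on X1 (tensor V W) M (\<lambda>x. tensor_lift M (g x))"
  by (rule bilinear_onI)
    (rule tensor_lift_linear[OF V W M g], assumption, rule tensor_lift_param[OF V W M g lin X1])

lemma tensor_lift2_bilinear:
  assumes V: "vspace V" and W: "vspace W" and V': "vspace V'" and W': "vspace W'" and M: "vspace M"
    and g: "\<And>a b. a \<in> carrier V \<Longrightarrow> b \<in> carrier W \<Longrightarrow> bilinear_on V' W' M (g a b)"
    and g': "\<And>c d. c \<in> carrier V' \<Longrightarrow> d \<in> carrier W' \<Longrightarrow> bilinear_on V W M (\<lambda>a b. g a b c d)"
  shows "bilinear_on (tensor V W) (tensor V' W') M (\<lambda>r s. tensor_lift M (\<lambda>a b. tensor_lift M (g a b) s) r)"
    and tensor_lift2_tens: "a \<in> carrier V \<Longrightarrow> b \<in> carrier W \<Longrightarrow> c \<in> carrier V' \<Longrightarrow> d \<in> carrier W' \<Longrightarrow>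
      tensor_lift M (\<lambda>a b. tensor_lift M (g a b) (tens V' W' c d)) (tens V W a b) = g a b c d"
proof -
  have inner: "bilinear_on V W M (\<lambda>a b. tensor_lift M (g a b) s)" if s: "s \<in> carrier (tensor V' W')" for s
  proof (rule bilinear_onI)
    show "linear_map W M (\<lambda>b. tensor_lift M (g a b) s)" if "a \<in> carrier V" for a
      by (rule tensor_lift_param[OF V' W' M g[OF that] bilinear_onD(1)[OF g' that] W s])
    show "linear_map V M (\<lambda>a. tensor_lift M (g a b) s)" if "b \<in> carrier W" for b
      by (rule tensor_lift_param[OF V' W' M g[OF _ that] bilinear_onD(2)[OF g' that] V s])
  qed
  have "linear_map (tensor V' W') M (\<lambda>s. tensor_lift M (\<lambda>a b. tensor_lift M (g a b) s) r)"
    if "r \<in> carrier (tensor V W)" for r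
    by (rule tensor_lift_param[OF V W M inner tensor_lift_linear[OF V' W' M g] tensor_vspace[OF V' W'] that])
  moreover have "linear_map (tensor V W) M (tensor_lift M (\<lambda>a b. tensor_lift M (g a b) s))"
    if "s \<in> carrier (tensor V' W')" for s
    by (rule tensor_lift_linear[OF V W M inner[OF that]])
  ultimately show "bilinear_on (tensor V W) (tensor V' W') M (\<lambda>r s. tensor_lift M (\<lambda>a b. tensor_lift M (g a b) s) r)"
    by (simp add: bilinear_on_def)
  show "tensor_lift M (\<lambda>a b. tensor_lift M (g a b) (tens V' W' c d)) (tens V W a b) = g a b c d"
    if "a \<in> carrier V" "b \<in> carrier W" "c \<in> carrier V'" "d \<in> carrier W'"
    using that tens_closed[OF V' W'] by (simp add: tensor_lift_tens[OF V W M inner] tensor_lift_tens[OF V' W' M g])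
qed

lemma tensor_eqI2:
  assumes V: "vspace V" and W: "vspace W" and V': "vspace V'" and W': "vspace W'"
    and F: "bilinear_on (tensor V W) (tensor V' W') M F" and G: "bilinear_on (tensor V W) (tensor V' W') M G"
    and eq: "\<And>a b c d. a \<in> carrier V \<Longrightarrow> b \<in> carrier W \<Longrightarrow> c \<in> carrier V' \<Longrightarrow> d \<in> carrier W' \<Longrightarrow>
      F (tens V W a b) (tens V' W' c d) = G (tens V W a b) (tens V' W' c d)"
    and r: "r \<in> carrier (tensor V W)" and s: "s \<in> carrier (tensor V' W')"
  shows "F r s = G r s"
proof (rule tensor_eqI[OF V W bilinear_onD(2)[OF F s] bilinear_onD(2)[OF G s] _ r])
  fix a b assume a: "a \<in> carrier V" and b: "b \<in> carrier W"
  note ab = tens_closed[OF V W a b]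
  show "F (tens V W a b) s = G (tens V W a b) s"
    by (rule tensor_eqI[OF V' W' bilinear_onD(1)[OF F ab] bilinear_onD(1)[OF G ab] eq[OF a b] s])
qed

text \<open>The linear maps \<open>h\<close>, \<open>k\<close>, \<open>l\<close> are built in so that the same fact serves for tensors with a bracket or
an embedded element in one of the places.\<close>

lemma tens_trilinear:
  assumes U: "vspace U" and V: "vspace V" and W: "vspace W"
    and h: "linear_map X1 U h" and k: "linear_map Y V k" and l: "linear_map Z W l"
  shows "y \<in> carrier Y \<Longrightarrow> z \<in> carrier Z \<Longrightarrow> linear_map X1 (tensor U (tensor V W)) (\<lambda>x. tens U (tensor V W) (h x) (tens V W (k y) (l z)))"
    and "x \<in> carrier X1 \<Longrightarrow> z \<in> carrier Z \<Longrightarrow> linear_map Y (tensor U (tensor V W)) (\<lambda>y. tens U (tensor V W) (h x) (tens V W (k y) (l z)))"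
    and "x \<in> carrier X1 \<Longrightarrow> y \<in> carrier Y \<Longrightarrow> linear_map Z (tensor U (tensor V W)) (\<lambda>z. tens U (tensor V W) (h x) (tens V W (k y) (l z)))"
proof -
  note VW = tensor_vspace[OF V W] tens_bilinear[OF V W]
  note b2 = bilinear_on_compose[OF VW(2) k l]
  note b3 = bilinear_on_compose[OF tens_bilinear[OF U VW(1)] h linear_map_ident]
  note c = bilinear_onD(3)[OF b2]
  show "y \<in> carrier Y \<Longrightarrow> z \<in> carrier Z \<Longrightarrow> linear_map X1 (tensor U (tensor V W)) (\<lambda>x. tens U (tensor V W) (h x) (tens V W (k y) (l z)))"
    by (rule bilinear_onD(2)[OF b3 c])
  show "x \<in> carrier X1 \<Longrightarrow> z \<in> carrier Z \<Longrightarrow> linear_map Y (tensor U (tensor V W)) (\<lambda>y. tens U (tensor V W) (h x) (tens V W (k y) (l z)))"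
    by (rule linear_map_compose[OF bilinear_onD(2)[OF b2] bilinear_onD(1)[OF b3]])
  show "x \<in> carrier X1 \<Longrightarrow> y \<in> carrier Y \<Longrightarrow> linear_map Z (tensor U (tensor V W)) (\<lambda>z. tens U (tensor V W) (h x) (tens V W (k y) (l z)))"
    by (rule linear_map_compose[OF bilinear_onD(1)[OF b2] bilinear_onD(1)[OF b3]])
qed

section \<open>The universal enveloping algebra\<close>

text \<open>The enveloping algebra is defined by a ring-theoretic ideal of the free algebra on words; reasoning
about that ideal requires the free algebra to be a ring.\<close>

lemma free_alg_ring:
  fixes G :: "('g, 'm) monoid_scheme"
  assumes G: "monoid G"
  shows "ring (free_alg G :: ('f::field, 'g \<Rightarrow>\<^sub>0 'f) module)"
proof -
  let ?F = "free_alg G :: ('f::field, 'g \<Rightarrow>\<^sub>0 'f) module"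
  interpret monoid G by fact
  have "nonassoc_algebra ?F" by (rule free_alg_algebra[OF m_closed])
  then have F: "bilinear_on ?F ?F ?F (monoid.mult ?F)" by (simp add: nonassoc_algebra_def)
  note closed = bilinear_onD(3)[OF F]
  note D = linear_mapD(2)[OF bilinear_onD(1)[OF F]] linear_mapD(2)[OF bilinear_onD(2)[OF F]]
  have plus: "x + y \<in> carrier ?F" if "x \<in> carrier ?F" "y \<in> carrier ?F" for x y
    using vspaceD(1)[OF free_alg_vspace that] by (simp add: free_alg_simps)
  note D' = D[unfolded free_alg_simps(2)]
  have z: "0 \<otimes>\<^bsub>?F\<^esub> p = 0" "p \<otimes>\<^bsub>?F\<^esub> 0 = 0" for p
    by (simp_all add: free_alg_mult)
  have unit: "single a c \<in> carrier ?F" if "a \<in> carrier G" for a c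
    using that by (simp add: free_alg_simps)
  have assoc: "p \<otimes>\<^bsub>?F\<^esub> q \<otimes>\<^bsub>?F\<^esub> r = p \<otimes>\<^bsub>?F\<^esub> (q \<otimes>\<^bsub>?F\<^esub> r)"
    if p: "p \<in> carrier ?F" and q: "q \<in> carrier ?F" and r: "r \<in> carrier ?F" for p q r
    using p
  proof (induction p rule: free_alg_induct)
    case (single a c)
    note a = this
    show ?case using q
    proof (induction q rule: free_alg_induct)
      case (single b d)
      note b = this
      show ?case using r
      proof (induction r rule: free_alg_induct)
        case (single e f)
        then show ?case using a b by (simp add: free_alg_mult_single m_assoc mult.assoc)
      qed (use a b in \<open>simp_all add: D' z closed unit free_alg_mult_single\<close>)
    qed (use a r in \<open>simp_all add: D' z closed unit plus\<close>)
  qed (use q r in \<open>simp_all add: D' z closed plus\<close>)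
  have one: "\<one>\<^bsub>?F\<^esub> \<in> carrier ?F" by (simp add: free_alg_simps)
  have "monoid ?F"
  proof (rule monoidI)
    show "\<one>\<^bsub>?F\<^esub> \<otimes>\<^bsub>?F\<^esub> p = p" if "p \<in> carrier ?F" for p
      using that by (induction p rule: free_alg_induct)
        (simp_all add: D' z unit one free_alg_simps(5) free_alg_mult_single)
    show "p \<otimes>\<^bsub>?F\<^esub> \<one>\<^bsub>?F\<^esub> = p" if "p \<in> carrier ?F" for p
      using that by (induction p rule: free_alg_induct)
        (simp_all add: D' z unit one free_alg_simps(5) free_alg_mult_single)
  qed (simp_all add: closed assoc one)
  then show ?thesis
    using module.axioms(2)[OF free_alg_vspace] by (intro ringI) (simp_all add: D)
qed

locale enveloping_algebra =
  fixes L :: "('f::field, 'l) module"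
  assumes L: "lie_algebra L"
begin

abbreviation F :: "('f, 'l list \<Rightarrow>\<^sub>0 'f) module" where "F \<equiv> free_alg (words L)"
abbreviation U where "U \<equiv> uea L"
abbreviation incl where "incl \<equiv> uea_incl L"

lemma vL: "vspace L"
  using L by (simp add: lie_algebra_def)

lemma bracket_bilinear: "bilinear_on L L L (monoid.mult L)"
  by (intro bilinear_onI linear_mapI)
    (simp_all add: lie_algebra.bracket_closed[OF L] lie_algebra.bracket_add_left[OF L]
      lie_algebra.bracket_add_right[OF L] lie_algebra.bracket_smult_left[OF L]
      lie_algebra.bracket_smult_right[OF L])

lemma words_simps: "carrier (words L) = lists (carrier L)" "a \<otimes>\<^bsub>words L\<^esub> b = a @ b" "\<one>\<^bsub>words L\<^esub> = []"
  by (simp_all add: words_def)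

lemma words_monoid: "monoid (words L)"
  by (rule monoidI) (auto simp: words_def)

lemma ring_F: "ring F"
  by (rule free_alg_ring[OF words_monoid])

lemma F_algebra: "nonassoc_algebra F"
  by (rule free_alg_algebra) (auto simp: words_def)

lemma word_in_F: "set w \<subseteq> carrier L \<Longrightarrow> single w c \<in> carrier F"
  by (auto simp: free_alg_simps words_def lists_eq_set)

lemma F_minus: "p \<in> carrier F \<Longrightarrow> q \<in> carrier F \<Longrightarrow> p - q \<in> carrier F"
  using vspaceD(9)[OF free_alg_vspace, of p "words L" q] by (simp add: free_alg_minus)

lemma uea_rel_carrier: "uea_rel L \<subseteq> carrier F"
  unfolding uea_rel_def using vspaceD(1,2)[OF vL] lie_algebra.bracket_closed[OF L]
  by (auto intro!: F_minus word_in_F)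

lemma uea_ideal: "ideal (uea_ideal L) F"
  unfolding uea_ideal_def by (rule ring.genideal_ideal[OF ring_F uea_rel_carrier])

lemma uea_rel_ideal: "r \<in> uea_rel L \<Longrightarrow> r \<in> uea_ideal L"
  unfolding uea_ideal_def using ring.genideal_self[OF ring_F uea_rel_carrier] by blast

text \<open>An ideal is closed under scalar multiplication because scalars embed as multiples of the empty word.\<close>

lemma uea_submodule: "submodule (uea_ideal L) scalars F"
proof (rule module.submoduleI[OF free_alg_vspace])
  interpret I: ideal "uea_ideal L" F by (rule uea_ideal)
  show "uea_ideal L \<subseteq> carrier F" by (rule I.a_subset)
  show "\<zero>\<^bsub>F\<^esub> \<in> uea_ideal L" by (rule additive_subgroup.zero_closed[OF I.is_additive_subgroup])
  show "a \<oplus>\<^bsub>F\<^esub> b \<in> uea_ideal L" if "a \<in> uea_ideal L" "b \<in> uea_ideal L" for a b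
    using that by (rule additive_subgroup.a_closed[OF I.is_additive_subgroup])
  show smult: "c \<odot>\<^bsub>F\<^esub> x \<in> uea_ideal L" if x: "x \<in> uea_ideal L" for c x
  proof -
    have "single [] c \<otimes>\<^bsub>F\<^esub> x \<in> uea_ideal L"
      using I.I_l_closed[OF x word_in_F[of "[]" c]] by simp
    also have "single [] c \<otimes>\<^bsub>F\<^esub> x = c \<odot>\<^bsub>F\<^esub> x"
      by (simp add: free_alg_mult ext_single free_alg_simps words_def ext_unit_vec)
    finally show ?thesis .
  qed
  show "\<ominus>\<^bsub>F\<^esub> a \<in> uea_ideal L" if "a \<in> uea_ideal L" for a
    using smult[OF that, of "- 1"] vspaceD(7)[OF free_alg_vspace subsetD[OF I.a_subset that]] by simp
qed

sublocale Q: subspace F "uea_ideal L"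
  by (intro subspace.intro free_alg_vspace uea_submodule)

lemma U_algebra: "nonassoc_algebra U"
  unfolding uea_def
  by (rule quot_algebra_nonassoc[OF F_algebra uea_submodule])
    (simp_all add: ideal.I_l_closed[OF uea_ideal] ideal.I_r_closed[OF uea_ideal])

lemma U_mult: "p \<in> carrier F \<Longrightarrow> q \<in> carrier F \<Longrightarrow> Q.\<pi> p \<otimes>\<^bsub>U\<^esub> Q.\<pi> q = Q.\<pi> (p \<otimes>\<^bsub>F\<^esub> q)"
  unfolding uea_def
  by (subst quot_algebra_mult[OF F_algebra uea_submodule])
    (simp_all add: ideal.I_l_closed[OF uea_ideal] ideal.I_r_closed[OF uea_ideal])

lemma vU: "vspace U"
  using U_algebra by (simp add: nonassoc_algebra_def)

lemma U_one: "\<one>\<^bsub>U\<^esub> = Q.\<pi> (unit_vec [])"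
  by (simp add: uea_def quot_alg_def free_alg_simps words_def)

lemma U_one_closed: "\<one>\<^bsub>U\<^esub> \<in> carrier U"
  unfolding U_one unfolding uea_def Q.quot_carrier by (intro imageI word_in_F) simp

lemma incl_closed: "x \<in> carrier L \<Longrightarrow> incl x \<in> carrier U"
  unfolding uea_incl_def uea_def Q.quot_carrier by (intro imageI word_in_F) simp

lemma incl_one: "x \<in> carrier L \<Longrightarrow> incl x \<otimes>\<^bsub>U\<^esub> \<one>\<^bsub>U\<^esub> = incl x" "x \<in> carrier L \<Longrightarrow> \<one>\<^bsub>U\<^esub> \<otimes>\<^bsub>U\<^esub> incl x = incl x"
  and one_one: "\<one>\<^bsub>U\<^esub> \<otimes>\<^bsub>U\<^esub> \<one>\<^bsub>U\<^esub> = \<one>\<^bsub>U\<^esub>"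
  unfolding U_one uea_incl_def by (simp_all add: U_mult word_in_F free_alg_mult_single words_simps)

lemma proj_eqI: "p - q \<in> uea_rel L \<Longrightarrow> p \<in> carrier F \<Longrightarrow> q \<in> carrier F \<Longrightarrow> Q.\<pi> p = Q.\<pi> q"
  using uea_rel_ideal by (simp add: Q.proj_eq_iff free_alg_minus)

lemma U_add: "p \<in> carrier F \<Longrightarrow> q \<in> carrier F \<Longrightarrow> Q.\<pi> p \<oplus>\<^bsub>U\<^esub> Q.\<pi> q = Q.\<pi> (p + q)"
  using Q.quot_add[of p q] by (simp add: uea_def free_alg_simps)

lemma F_plus: "p \<in> carrier F \<Longrightarrow> q \<in> carrier F \<Longrightarrow> p + q \<in> carrier F"
  using vspaceD(1)[OF free_alg_vspace, of p "words L" q] by (simp add: free_alg_simps)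

lemma incl_linear: "linear_map L U incl"
proof (rule linear_mapI)
  fix x y assume x: "x \<in> carrier L" and y: "y \<in> carrier L"
  have "Q.\<pi> (unit_vec [x \<oplus>\<^bsub>L\<^esub> y]) = Q.\<pi> (unit_vec [x] + unit_vec [y])"
  proof (rule proj_eqI)
    show "unit_vec [x \<oplus>\<^bsub>L\<^esub> y] - (unit_vec [x] + unit_vec [y]) \<in> uea_rel L"
      unfolding uea_rel_def diff_diff_eq[symmetric] using x y by blast
  qed (use x y vspaceD(1)[OF vL] in \<open>auto intro!: F_plus word_in_F\<close>)
  then show "incl (x \<oplus>\<^bsub>L\<^esub> y) = incl x \<oplus>\<^bsub>U\<^esub> incl y"
    using x y by (simp add: uea_incl_def U_add word_in_F)
next
  fix c x assume x: "x \<in> carrier L"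
  have "Q.\<pi> (unit_vec [c \<odot>\<^bsub>L\<^esub> x]) = Q.\<pi> (single [x] c)"
  proof (rule proj_eqI)
    show "unit_vec [c \<odot>\<^bsub>L\<^esub> x] - single [x] c \<in> uea_rel L"
      unfolding uea_rel_def using x by blast
  qed (use x vspaceD(2)[OF vL] in \<open>auto intro!: word_in_F\<close>)
  also have "\<dots> = Q.\<pi> (c \<odot>\<^bsub>F\<^esub> unit_vec [x])"
    by (simp add: free_alg_simps pscale_single)
  also have "\<dots> = c \<odot>\<^bsub>U\<^esub> Q.\<pi> (unit_vec [x])"
    using x by (simp add: Q.quot_smult word_in_F uea_def)
  finally show "incl (c \<odot>\<^bsub>L\<^esub> x) = c \<odot>\<^bsub>U\<^esub> incl x"
    by (simp add: uea_incl_def)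
qed (rule incl_closed)

text \<open>The third family of relations says exactly this.\<close>

lemma incl_bracket:
  assumes x: "x \<in> carrier L" and y: "y \<in> carrier L"
  shows "incl (x \<otimes>\<^bsub>L\<^esub> y) = incl x \<otimes>\<^bsub>U\<^esub> incl y \<ominus>\<^bsub>U\<^esub> incl y \<otimes>\<^bsub>U\<^esub> incl x"
proof -
  have xy: "Q.\<pi> (unit_vec [x, y]) = Q.\<pi> (unit_vec [x \<otimes>\<^bsub>L\<^esub> y] + unit_vec [y, x])"
  proof (rule proj_eqI)
    have "unit_vec [x, y] - unit_vec [y, x] - unit_vec [x \<otimes>\<^bsub>L\<^esub> y] \<in> uea_rel L"
      unfolding uea_rel_def using x y by blast
    then show "unit_vec [x, y] - (unit_vec [x \<otimes>\<^bsub>L\<^esub> y] + unit_vec [y, x]) \<in> uea_rel L"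
      by (simp add: diff_diff_eq add.commute)
  qed (use x y lie_algebra.bracket_closed[OF L] in \<open>auto intro!: F_plus word_in_F\<close>)
  have m: "incl x \<otimes>\<^bsub>U\<^esub> incl y = Q.\<pi> (unit_vec [x, y])" "incl y \<otimes>\<^bsub>U\<^esub> incl x = Q.\<pi> (unit_vec [y, x])"
    using x y by (simp_all add: uea_incl_def U_mult word_in_F free_alg_mult_single words_simps)
  have "incl x \<otimes>\<^bsub>U\<^esub> incl y = incl (x \<otimes>\<^bsub>L\<^esub> y) \<oplus>\<^bsub>U\<^esub> incl y \<otimes>\<^bsub>U\<^esub> incl x"
    unfolding m xy unfolding uea_incl_def using x y lie_algebra.bracket_closed[OF L x y]
    by (simp add: U_add word_in_F)
  moreover have "incl (x \<otimes>\<^bsub>L\<^esub> y) \<in> carrier U" "incl y \<otimes>\<^bsub>U\<^esub> incl x \<in> carrier U"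
    using x y U_algebra by (auto simp: nonassoc_algebra_def incl_closed lie_algebra.bracket_closed[OF L]
        intro!: bilinear_onD(3)[of U U U "monoid.mult U"])
  ultimately show ?thesis
    using abelian_group.minus_eq[OF module.axioms(2)[OF vU]] abelian_group.r_neg[OF module.axioms(2)[OF vU]]
    by (simp add: abelian_monoid.a_assoc[OF abelian_group.axioms(1)[OF module.axioms(2)[OF vU]]]
        abelian_group.a_inv_closed[OF module.axioms(2)[OF vU]] vspaceD(15)[OF vU])
qed

section \<open>The classical Yang-Baxter expression\<close>

abbreviation "L2 \<equiv> tensor2 L"
abbreviation "L3 \<equiv> tensor3 L"
abbreviation "U2 \<equiv> tensor2 U"
abbreviation "U3 \<equiv> tensor3 U"

lemma vL2: "vspace L2" and vL3: "vspace L3" and vU3: "vspace U3"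
  by (intro tensor_vspace vL vU)+

lemma U2_algebra: "nonassoc_algebra U2" and U3_algebra: "nonassoc_algebra U3"
  by (intro tensor_algebra_nonassoc U_algebra)+

text \<open>The map \<open>L \<otimes> L \<otimes> L \<rightarrow> U \<otimes> U \<otimes> U\<close> induced by the canonical map \<open>L \<rightarrow> U\<close>.\<close>

definition incl3 where "incl3 = tensor_lift U3 (\<lambda>x. tensor_lift U3 (\<lambda>y z. tens3 U (incl x) (incl y) (incl z)))"

lemma incl_trilinear:
  "y \<in> carrier L \<Longrightarrow> z \<in> carrier L \<Longrightarrow> linear_map L U3 (\<lambda>x. tens3 U (incl x) (incl y) (incl z))"
  "x \<in> carrier L \<Longrightarrow> z \<in> carrier L \<Longrightarrow> linear_map L U3 (\<lambda>y. tens3 U (incl x) (incl y) (incl z))"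
  "x \<in> carrier L \<Longrightarrow> y \<in> carrier L \<Longrightarrow> linear_map L U3 (\<lambda>z. tens3 U (incl x) (incl y) (incl z))"
  by (rule tens_trilinear[OF vU vU vU incl_linear incl_linear incl_linear]; assumption)+

lemma incl3_linear: "linear_map L3 U3 incl3"
  and incl3_tens: "x \<in> carrier L \<Longrightarrow> y \<in> carrier L \<Longrightarrow> z \<in> carrier L \<Longrightarrow>
    incl3 (tens3 L x y z) = tens3 U (incl x) (incl y) (incl z)"
proof -
  have g: "bilinear_on L L U3 (\<lambda>y z. tens3 U (incl x) (incl y) (incl z))" if "x \<in> carrier L" for x
    using incl_trilinear that by (intro bilinear_onI) auto
  have b: "bilinear_on L L2 U3 (\<lambda>x. tensor_lift U3 (\<lambda>y z. tens3 U (incl x) (incl y) (incl z)))"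
    by (rule tensor_lift_bilinear[OF vL vL vU3 vL g incl_trilinear(1)])
  show "linear_map L3 U3 incl3"
    unfolding incl3_def by (rule tensor_lift_linear[OF vL vL2 vU3 b])
  show "x \<in> carrier L \<Longrightarrow> y \<in> carrier L \<Longrightarrow> z \<in> carrier L \<Longrightarrow>
      incl3 (tens3 L x y z) = tens3 U (incl x) (incl y) (incl z)"
    by (simp add: incl3_def tensor_lift_tens[OF vL vL2 vU3 b] tens_closed vL tensor_lift_tens[OF vL vL vU3 g])
qed

text \<open>The brackets \<open>[r\<^sup>1\<^sup>2, s\<^sup>1\<^sup>3]\<close>, \<open>[r\<^sup>1\<^sup>2, s\<^sup>2\<^sup>3]\<close> and \<open>[r\<^sup>1\<^sup>3, s\<^sup>2\<^sup>3]\<close>, formed in \<open>L \<otimes> L \<otimes> L\<close> instead of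
in the enveloping algebra.  With two independent arguments they are bilinear, so identities can be
checked on pure tensors.\<close>

definition yb12_13 where "yb12_13 r s = tensor_lift L3 (\<lambda>a b. tensor_lift L3 (\<lambda>c d. tens3 L (a \<otimes>\<^bsub>L\<^esub> c) b d) s) r"
definition yb12_23 where "yb12_23 r s = tensor_lift L3 (\<lambda>a b. tensor_lift L3 (\<lambda>c d. tens3 L a (b \<otimes>\<^bsub>L\<^esub> c) d) s) r"
definition yb13_23 where "yb13_23 r s = tensor_lift L3 (\<lambda>a b. tensor_lift L3 (\<lambda>c d. tens3 L a c (b \<otimes>\<^bsub>L\<^esub> d)) s) r"

lemmas bracket_lin = bilinear_onD[OF bracket_bilinear]
lemmas tri = tens_trilinear[OF vL vL vL]

lemma yb_bilinear_aux:
  "a \<in> carrier L \<Longrightarrow> b \<in> carrier L \<Longrightarrow> bilinear_on L L L3 (\<lambda>c d. tens3 L (a \<otimes>\<^bsub>L\<^esub> c) b d)"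
  "c \<in> carrier L \<Longrightarrow> d \<in> carrier L \<Longrightarrow> bilinear_on L L L3 (\<lambda>a b. tens3 L (a \<otimes>\<^bsub>L\<^esub> c) b d)"
  "a \<in> carrier L \<Longrightarrow> b \<in> carrier L \<Longrightarrow> bilinear_on L L L3 (\<lambda>c d. tens3 L a (b \<otimes>\<^bsub>L\<^esub> c) d)"
  "c \<in> carrier L \<Longrightarrow> d \<in> carrier L \<Longrightarrow> bilinear_on L L L3 (\<lambda>a b. tens3 L a (b \<otimes>\<^bsub>L\<^esub> c) d)"
  "a \<in> carrier L \<Longrightarrow> b \<in> carrier L \<Longrightarrow> bilinear_on L L L3 (\<lambda>c d. tens3 L a c (b \<otimes>\<^bsub>L\<^esub> d))"
  "c \<in> carrier L \<Longrightarrow> d \<in> carrier L \<Longrightarrow> bilinear_on L L L3 (\<lambda>a b. tens3 L a c (b \<otimes>\<^bsub>L\<^esub> d))"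
  by (rule bilinear_onI;
      (rule tri(1)[OF bracket_lin(1) linear_map_ident linear_map_ident] tri(1)[OF bracket_lin(2) linear_map_ident linear_map_ident]
        tri(1)[OF linear_map_ident linear_map_ident linear_map_ident]
        tri(2)[OF linear_map_ident bracket_lin(1) linear_map_ident] tri(2)[OF linear_map_ident bracket_lin(2) linear_map_ident]
        tri(2)[OF linear_map_ident linear_map_ident linear_map_ident]
        tri(3)[OF linear_map_ident linear_map_ident bracket_lin(1)] tri(3)[OF linear_map_ident linear_map_ident bracket_lin(2)]
        tri(3)[OF linear_map_ident linear_map_ident linear_map_ident]);
      simp add: bracket_lin(3); fail)+

lemma yb_bilinear:
  "bilinear_on L2 L2 L3 yb12_13" "bilinear_on L2 L2 L3 yb12_23" "bilinear_on L2 L2 L3 yb13_23"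
  unfolding yb12_13_def yb12_23_def yb13_23_def
  by (rule tensor_lift2_bilinear[OF vL vL vL vL vL3]; rule yb_bilinear_aux; assumption)+

lemma yb_tens:
  assumes "a \<in> carrier L" "b \<in> carrier L" "c \<in> carrier L" "d \<in> carrier L"
  shows "yb12_13 (tens L L a b) (tens L L c d) = tens3 L (a \<otimes>\<^bsub>L\<^esub> c) b d"
    and "yb12_23 (tens L L a b) (tens L L c d) = tens3 L a (b \<otimes>\<^bsub>L\<^esub> c) d"
    and "yb13_23 (tens L L a b) (tens L L c d) = tens3 L a c (b \<otimes>\<^bsub>L\<^esub> d)"
  unfolding yb12_13_def yb12_23_def yb13_23_def
  by (rule tensor_lift2_tens[OF vL vL vL vL vL3 _ _ assms]; rule yb_bilinear_aux; assumption)+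

definition leg12 where "leg12 = tensor_lift U3 (\<lambda>a b. tens3 U (incl a) (incl b) \<one>\<^bsub>U\<^esub>)"
definition leg13 where "leg13 = tensor_lift U3 (\<lambda>a b. tens3 U (incl a) \<one>\<^bsub>U\<^esub> (incl b))"
definition leg23 where "leg23 = tensor_lift U3 (\<lambda>a b. tens3 U \<one>\<^bsub>U\<^esub> (incl a) (incl b))"

lemmas triU = tens_trilinear[OF vU vU vU]

lemma leg_bilinear:
  "bilinear_on L L U3 (\<lambda>a b. tens3 U (incl a) (incl b) \<one>\<^bsub>U\<^esub>)"
  "bilinear_on L L U3 (\<lambda>a b. tens3 U (incl a) \<one>\<^bsub>U\<^esub> (incl b))"
  "bilinear_on L L U3 (\<lambda>a b. tens3 U \<one>\<^bsub>U\<^esub> (incl a) (incl b))"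
  by (rule bilinear_onI;
      (rule triU(1)[OF incl_linear incl_linear linear_map_ident] triU(2)[OF incl_linear incl_linear linear_map_ident]
        triU(1)[OF incl_linear linear_map_ident incl_linear] triU(3)[OF incl_linear linear_map_ident incl_linear]
        triU(2)[OF linear_map_ident incl_linear incl_linear] triU(3)[OF linear_map_ident incl_linear incl_linear]);
      simp add: U_one_closed; fail)+

lemma leg_linear: "linear_map L2 U3 leg12" "linear_map L2 U3 leg13" "linear_map L2 U3 leg23"
  unfolding leg12_def leg13_def leg23_def
  by (rule tensor_lift_linear[OF vL vL vU3 leg_bilinear(1)] tensor_lift_linear[OF vL vL vU3 leg_bilinear(2)]
      tensor_lift_linear[OF vL vL vU3 leg_bilinear(3)])+

lemma leg_tens:
  assumes "a \<in> carrier L" "b \<in> carrier L"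
  shows "leg12 (tens L L a b) = tens3 U (incl a) (incl b) \<one>\<^bsub>U\<^esub>"
    and "leg13 (tens L L a b) = tens3 U (incl a) \<one>\<^bsub>U\<^esub> (incl b)"
    and "leg23 (tens L L a b) = tens3 U \<one>\<^bsub>U\<^esub> (incl a) (incl b)"
  unfolding leg12_def leg13_def leg23_def
  using assms by (simp_all add: tensor_lift_tens[OF vL vL vU3 leg_bilinear(1)]
      tensor_lift_tens[OF vL vL vU3 leg_bilinear(2)] tensor_lift_tens[OF vL vL vU3 leg_bilinear(3)])

lemma tens3U_mult:
  assumes "a \<in> carrier U" "b \<in> carrier U" "c \<in> carrier U" "a' \<in> carrier U" "b' \<in> carrier U" "c' \<in> carrier U"
  shows "tens3 U a b c \<otimes>\<^bsub>U3\<^esub> tens3 U a' b' c' = tens3 U (a \<otimes>\<^bsub>U\<^esub> a') (b \<otimes>\<^bsub>U\<^esub> b') (c \<otimes>\<^bsub>U\<^esub> c')"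
  using assms by (simp add: tens_mult[OF U_algebra U2_algebra] tens_mult[OF U_algebra U_algebra] tens_closed vU)

lemma tens3U_diff:
  assumes "a \<in> carrier U" "b \<in> carrier U" "c \<in> carrier U" "d \<in> carrier U"
  shows "tens3 U (a \<ominus>\<^bsub>U\<^esub> b) c d = tens3 U a c d \<ominus>\<^bsub>U3\<^esub> tens3 U b c d"
    and "tens3 U c (a \<ominus>\<^bsub>U\<^esub> b) d = tens3 U c a d \<ominus>\<^bsub>U3\<^esub> tens3 U c b d"
    and "tens3 U c d (a \<ominus>\<^bsub>U\<^esub> b) = tens3 U c d a \<ominus>\<^bsub>U3\<^esub> tens3 U c d b"
  using linear_map_minus[OF vU vU3 triU(1)[OF linear_map_ident linear_map_ident linear_map_ident]]
    linear_map_minus[OF vU vU3 triU(2)[OF linear_map_ident linear_map_ident linear_map_ident]]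
    linear_map_minus[OF vU vU3 triU(3)[OF linear_map_ident linear_map_ident linear_map_ident]] assms
  by auto

lemma commutator_bilinear:
  assumes "linear_map L2 U3 h" "linear_map L2 U3 k"
  shows "bilinear_on L2 L2 U3 (\<lambda>r s. commutator U3 (h r) (k s))"
proof -
  have m: "bilinear_on U3 U3 U3 (monoid.mult U3)" using U3_algebra by (simp add: nonassoc_algebra_def)
  show ?thesis
    unfolding commutator_def
    by (rule bilinear_on_diff[OF vU3 bilinear_on_compose[OF m assms]
          bilinear_on_swap[OF bilinear_on_compose[OF m assms(2,1)]]])
qed

text \<open>On pure tensors the two legs share one tensor factor only; in the others one of the two elements is the
unit.  So the commutator is a commutator in the shared factor, that is, a bracket of \<open>L\<close>.\<close>

lemma commutator_legs:
  assumes r: "r \<in> carrier L2" and s: "s \<in> carrier L2"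
  shows "commutator U3 (leg12 r) (leg13 s) = incl3 (yb12_13 r s)"
    and "commutator U3 (leg12 r) (leg23 s) = incl3 (yb12_23 r s)"
    and "commutator U3 (leg13 r) (leg23 s) = incl3 (yb13_23 r s)"
proof -
  note eqI = tensor_eqI2[OF vL vL vL vL _ _ _ r s]
  note mU = bilinear_onD(3)[OF conjunct2[OF U_algebra[unfolded nonassoc_algebra_def]]]
  note s = leg_tens yb_tens commutator_def incl3_tens tens3U_mult incl_closed U_one_closed
    lie_algebra.bracket_closed[OF L] incl_one one_one incl_bracket tens3U_diff mU
  show "commutator U3 (leg12 r) (leg13 s) = incl3 (yb12_13 r s)"
    by (rule eqI[where F = "\<lambda>r s. commutator U3 (leg12 r) (leg13 s)",
          OF commutator_bilinear[OF leg_linear(1,2)] bilinear_on_linear[OF yb_bilinear(1) incl3_linear]])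
      (simp add: s)
  show "commutator U3 (leg12 r) (leg23 s) = incl3 (yb12_23 r s)"
    by (rule eqI[where F = "\<lambda>r s. commutator U3 (leg12 r) (leg23 s)",
          OF commutator_bilinear[OF leg_linear(1,3)] bilinear_on_linear[OF yb_bilinear(2) incl3_linear]])
      (simp add: s)
  show "commutator U3 (leg13 r) (leg23 s) = incl3 (yb13_23 r s)"
    by (rule eqI[where F = "\<lambda>r s. commutator U3 (leg13 r) (leg23 s)",
          OF commutator_bilinear[OF leg_linear(2,3)] bilinear_on_linear[OF yb_bilinear(3) incl3_linear]])
      (simp add: s)
qed

definition yb where "yb r = yb12_13 r r \<oplus>\<^bsub>L3\<^esub> yb12_23 r r \<oplus>\<^bsub>L3\<^esub> yb13_23 r r"

lemma cybe_eq:
  assumes r: "r \<in> carrier L2"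
  shows "cybe L r = incl3 (yb r)"
proof -
  have "cybe L r = commutator U3 (leg12 r) (leg13 r) \<oplus>\<^bsub>U3\<^esub> commutator U3 (leg12 r) (leg23 r)
      \<oplus>\<^bsub>U3\<^esub> commutator U3 (leg13 r) (leg23 r)"
    by (simp add: cybe_def leg12_def leg13_def leg23_def Let_def)
  also have "\<dots> = incl3 (yb r)"
    unfolding commutator_legs[OF r r] yb_def
    using bilinear_onD(3)[OF yb_bilinear(1) r r] bilinear_onD(3)[OF yb_bilinear(2) r r]
      bilinear_onD(3)[OF yb_bilinear(3) r r]
    by (simp add: linear_mapD(2)[OF incl3_linear] vspaceD(1)[OF vL3])
  finally show ?thesis .
qed

end

section \<open>Tensor calculus in coordinates\<close>

text \<open>A constant rather than an abbreviation, so that simplification treats basis vectors as atoms.\<close>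

definition vec :: "'i \<Rightarrow> ('i \<Rightarrow>\<^sub>0 'f::field)"
  where "vec i = single i 1"

lemma ext_vec [simp]: "ext g (vec i) = g i"
  by (simp add: vec_def ext_single pscale_1)

lemma lookup_vec: "lookup (vec i) j = (if i = j then 1 else 0)"
  by (simp add: vec_def lookup_single when_def)

text \<open>The counterpart of \<open>linear_map\<close> without carriers, for functions on a whole type.\<close>

definition lin :: "(('i \<Rightarrow>\<^sub>0 'f::field) \<Rightarrow> ('j \<Rightarrow>\<^sub>0 'f)) \<Rightarrow> bool"
  where "lin h \<longleftrightarrow> (\<forall>p q. h (p + q) = h p + h q) \<and> (\<forall>c p. h (pscale c p) = pscale c (h p))"

lemma lin_add: "lin h \<Longrightarrow> h (p + q) = h p + h q"
  and lin_pscale: "lin h \<Longrightarrow> h (pscale c p) = pscale c (h p)"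
  by (simp_all add: lin_def)

lemma lin_0: "lin h \<Longrightarrow> h 0 = 0"
  using lin_pscale[of h 0 0] by (simp add: pscale_0)

lemma lin_uminus: "lin h \<Longrightarrow> h (- p) = - h p"
  using lin_pscale[of h "- 1" p] by (simp add: pscale_uminus_left pscale_1)

lemma lin_diff: "lin h \<Longrightarrow> h (p - q) = h p - h q"
  using lin_add[of h p "- q"] by (simp add: lin_uminus)

lemmas linD = lin_add lin_pscale lin_0 lin_uminus lin_diff

lemma lin_ident: "lin (\<lambda>p. p)"
  and lin_ext: "lin (ext g)"
  and lin_compose: "lin h \<Longrightarrow> lin k \<Longrightarrow> lin (\<lambda>p. k (h p))"
  and lin_plus: "lin h \<Longrightarrow> lin h' \<Longrightarrow> lin (\<lambda>p. h p + h' p)"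
  and lin_minus: "lin h \<Longrightarrow> lin h' \<Longrightarrow> lin (\<lambda>p. h p - h' p)"
  by (simp_all add: lin_def ext_add ext_pscale pscale_add pscale_zero pscale_diff pscale_uminus pscale_pscale mult.commute)

lemma lin_ext_fun:
  assumes "\<And>i. lin (\<lambda>p. g p i)"
  shows "lin (\<lambda>p. ext (g p) t)"
  using linD(1,2)[OF assms] by (simp add: lin_def ext_def pscale_sum pscale_pscale sum.distrib mult.commute pscale_add)

lemma vec_span_induct [consumes 1, case_names zero vec add]:
  assumes "keys p \<subseteq> J" "P 0"
    and vec: "\<And>i c. i \<in> J \<Longrightarrow> P (pscale c (vec i))"
    and add: "\<And>p q. keys p \<subseteq> J \<Longrightarrow> keys q \<subseteq> J \<Longrightarrow> P p \<Longrightarrow> P q \<Longrightarrow> P (p + q)"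
  shows "P p"
proof -
  have "p \<in> carrier (free_alg \<lparr>carrier = J, monoid.mult = undefined, one = undefined\<rparr>)"
    using assms(1) by (simp add: free_alg_simps)
  then show ?thesis
    by (induction p rule: free_alg_induct)
      (use assms in \<open>auto simp: free_alg_simps vec_def pscale_single\<close>)
qed

lemma lin_eq_on:
  assumes "lin h" "lin k" "keys p \<subseteq> J" and "\<And>i. i \<in> J \<Longrightarrow> h (vec i) = k (vec i)"
  shows "h p = k p"
  using assms(3) by (induction p rule: vec_span_induct) (simp_all add: linD assms)

lemma lin_eqI:
  assumes "lin h" "lin k" "\<And>i. h (vec i) = k (vec i)"
  shows "h p = k p"
  using assms lin_eq_on[of h k p UNIV] by simp

lemma lin_eqI2:
  assumes "\<And>x. lin (F x)" "\<And>x. lin (G x)" "\<And>y. lin (\<lambda>x. F x y)" "\<And>y. lin (\<lambda>x. G x y)"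
    and "\<And>i j. F (vec i) (vec j) = G (vec i) (vec j)"
  shows "F x y = G x y"
proof -
  have "F (vec i) y = G (vec i) y" for i
    by (rule lin_eqI[OF assms(1,2)]) (rule assms)
  then show ?thesis
    by (rule lin_eqI[OF assms(3,4)])
qed

definition tp :: "('i \<Rightarrow>\<^sub>0 'f::field) \<Rightarrow> ('j \<Rightarrow>\<^sub>0 'f) \<Rightarrow> ('i \<times> 'j \<Rightarrow>\<^sub>0 'f)"
  where "tp p q = ext (\<lambda>i. ext (\<lambda>j. vec (i, j)) q) p"

lemma tp_vec [simp]: "tp (vec i) (vec j) = vec (i, j)"
  by (simp add: tp_def)

lemma tp_lin1: "lin (\<lambda>p. tp p q)"
  unfolding tp_def by (rule lin_ext)

lemma tp_lin2: "lin (tp p)"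
  unfolding tp_def by (intro lin_ext_fun lin_ext)

lemmas tp_simps = linD[OF tp_lin1] linD[OF tp_lin2]

lemma keys_vec: "keys (vec i) = {i}"
  by (simp add: vec_def)

lemma keys_tp: "keys p \<subseteq> J \<Longrightarrow> keys q \<subseteq> K \<Longrightarrow> keys (tp p q) \<subseteq> J \<times> K"
  unfolding tp_def by (intro keys_ext) (auto simp: keys_vec)

text \<open>A bilinear operation given on pairs of basis vectors has the expected value on all pure tensors.  The
operations on tensors below are defined through \<open>ext\<close>, and this supplies their formulas.\<close>

lemma ext_tp:
  assumes "\<And>x. lin (F x)" "\<And>y. lin (\<lambda>x. F x y)"
  shows "ext (\<lambda>(i, j). F (vec i) (vec j)) (tp p q) = F p q"
proof (rule lin_eqI2[where F = "\<lambda>p q. ext (\<lambda>(i, j). F (vec i) (vec j)) (tp p q)"])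
  show "lin (\<lambda>q. ext (\<lambda>(i, j). F (vec i) (vec j)) (tp x q))" for x
    by (rule lin_compose[OF tp_lin2 lin_ext])
  show "lin (\<lambda>p. ext (\<lambda>(i, j). F (vec i) (vec j)) (tp p y))" for y
    by (rule lin_compose[OF tp_lin1 lin_ext])
qed (simp_all add: assms)

definition twist_vec :: "('i \<times> 'i \<Rightarrow>\<^sub>0 'f::field) \<Rightarrow> ('i \<times> 'i \<Rightarrow>\<^sub>0 'f)"
  where "twist_vec = ext (\<lambda>(i, j). vec (j, i))"

definition cyc_vec :: "('i \<times> 'i \<times> 'i \<Rightarrow>\<^sub>0 'f::field) \<Rightarrow> ('i \<times> 'i \<times> 'i \<Rightarrow>\<^sub>0 'f)"
  where "cyc_vec = ext (\<lambda>(i, j, k). vec (j, k, i))"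

definition id_tensor_vec :: "(('i \<Rightarrow>\<^sub>0 'f::field) \<Rightarrow> ('j \<Rightarrow>\<^sub>0 'f)) \<Rightarrow> ('i \<times> 'i \<Rightarrow>\<^sub>0 'f) \<Rightarrow> ('i \<times> 'j \<Rightarrow>\<^sub>0 'f)"
  where "id_tensor_vec h = ext (\<lambda>(i, j). tp (vec i) (h (vec j)))"

lemma lin_twist_vec: "lin twist_vec" and lin_cyc_vec: "lin cyc_vec" and lin_id_tensor_vec: "lin (id_tensor_vec h)"
  unfolding twist_vec_def cyc_vec_def id_tensor_vec_def by (rule lin_ext)+

lemma twist_vec_tp: "twist_vec (tp p q) = tp q p"
  using ext_tp[of "\<lambda>p q. tp q p" p q] by (simp add: twist_vec_def tp_lin1 tp_lin2)

lemma cyc_vec_tp: "cyc_vec (tp p (tp q r)) = tp q (tp r p)"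
proof -
  have "cyc_vec (tp (vec i) (tp q r)) = tp q (tp r (vec i))" for i
  proof (rule lin_eqI2[where F = "\<lambda>q r. cyc_vec (tp (vec i) (tp q r))"])
    show "cyc_vec (tp (vec i) (tp (vec j) (vec k))) = tp (vec j) (tp (vec k) (vec i))" for j k
      by (simp add: cyc_vec_def)
  qed (intro tp_lin1 lin_compose[OF tp_lin1 tp_lin2] lin_compose[OF lin_compose[OF tp_lin1 tp_lin2] lin_cyc_vec]
      lin_compose[OF lin_compose[OF tp_lin2 tp_lin2] lin_cyc_vec])+
  then show ?thesis
    by (rule lin_eqI[where h = "\<lambda>p. cyc_vec (tp p (tp q r))",
          OF lin_compose[OF tp_lin1 lin_cyc_vec] lin_compose[OF tp_lin2 tp_lin2]])
qed

lemma id_tensor_vec_tp: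
  assumes "lin h"
  shows "id_tensor_vec h (tp p q) = tp p (h q)"
  unfolding id_tensor_vec_def by (rule ext_tp) (intro lin_compose[OF assms tp_lin2] tp_lin1)+

section \<open>The co-Jacobi identity and the Yang-Baxter expression\<close>

text \<open>A Lie bracket on all finitely supported functions, without carrier conditions.\<close>

locale lie_algebra_vec =
  fixes br :: "('i \<Rightarrow>\<^sub>0 'f::field_char_0) \<Rightarrow> ('i \<Rightarrow>\<^sub>0 'f) \<Rightarrow> ('i \<Rightarrow>\<^sub>0 'f)"
  assumes br_lin1: "lin (\<lambda>p. br p q)" and br_lin2: "lin (br p)"
    and br_self: "br x x = 0"
    and br_jacobi: "br x (br y z) + br y (br z x) + br z (br x y) = 0"
begin

lemmas br_simps = linD[OF br_lin1] linD[OF br_lin2]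

lemma br_swap: "br y x = - br x y"
proof -
  have "br (x + y) (x + y) = br x x + br x y + (br y x + br y y)"
    by (simp add: br_simps add_ac)
  then show ?thesis by (simp add: br_self eq_neg_iff_add_eq_0 add.commute)
qed

text \<open>The Jacobi identity oriented as a rewrite rule: an outer bracket with \<open>x\<close> moves inwards.\<close>

lemma br_derivation: "br x (br y z) = br (br x y) z - br (br x z) y"
  using br_jacobi[of x y z] br_swap[of z "br x y"] br_swap[of y "br x z"] br_swap[of z x]
  by (simp add: br_simps) (metis add.commute add_diff_cancel_left' diff_eq_eq eq_iff_diff_eq_0 add_diff_eq add_uminus_conv_diff)

definition act :: "('i \<Rightarrow>\<^sub>0 'f) \<Rightarrow> ('i \<times> 'i \<Rightarrow>\<^sub>0 'f) \<Rightarrow> ('i \<times> 'i \<Rightarrow>\<^sub>0 'f)"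
  where "act x = ext (\<lambda>(i, j). tp (br x (vec i)) (vec j) + tp (vec i) (br x (vec j)))"

definition act3 :: "('i \<Rightarrow>\<^sub>0 'f) \<Rightarrow> ('i \<times> 'i \<times> 'i \<Rightarrow>\<^sub>0 'f) \<Rightarrow> ('i \<times> 'i \<times> 'i \<Rightarrow>\<^sub>0 'f)"
  where "act3 x = ext (\<lambda>(i, j). tp (br x (vec i)) (vec j) + tp (vec i) (act x (vec j)))"

lemma act_lin2: "lin (act x)" and act3_lin2: "lin (act3 x)"
  unfolding act_def act3_def by (rule lin_ext)+

lemma act_lin1: "lin (\<lambda>x. act x t)"
  unfolding act_def case_prod_unfold
  by (intro lin_ext_fun lin_plus lin_compose[OF br_lin1 tp_lin1] lin_compose[OF br_lin1 tp_lin2])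

lemma act_tp: "act x (tp p q) = tp (br x p) q + tp p (br x q)"
  unfolding act_def
  by (rule ext_tp) (intro lin_plus tp_lin1 tp_lin2 lin_compose[OF br_lin2 tp_lin1] lin_compose[OF br_lin2 tp_lin2])+

lemma act3_tp: "act3 x (tp p q) = tp (br x p) q + tp p (act x q)"
  unfolding act3_def
  by (rule ext_tp) (intro lin_plus tp_lin1 tp_lin2 lin_compose[OF br_lin2 tp_lin1] lin_compose[OF act_lin2 tp_lin2])+

lemma act_br: "act (br x y) t = act x (act y t) - act y (act x t)"
proof (rule lin_eqI[where h = "act (br x y)"])
  show "lin (\<lambda>t. act x (act y t) - act y (act x t))"
    by (intro lin_minus lin_compose[OF act_lin2 act_lin2])
  fix k :: "'i \<times> 'i"
  obtain i j where k: "k = (i, j)" by fastforce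
  have "br (br x y) z = br x (br y z) - br y (br x z)" for z
    using br_derivation[of x y z] br_swap[of "br x z" y] by simp
  then show "act (br x y) (vec k) = act x (act y (vec k)) - act y (act x (vec k))"
    by (simp add: k act_tp tp_simps linD[OF act_lin2] flip: tp_vec)
qed (rule act_lin2)

definition yb12_13_vec where "yb12_13_vec r s = ext (\<lambda>(a, b). ext (\<lambda>(c, d). tp (br (vec a) (vec c)) (vec (b, d))) s) r"
definition yb12_23_vec where "yb12_23_vec r s = ext (\<lambda>(a, b). ext (\<lambda>(c, d). tp (vec a) (tp (br (vec b) (vec c)) (vec d))) s) r"
definition yb13_23_vec where "yb13_23_vec r s = ext (\<lambda>(a, b). ext (\<lambda>(c, d). tp (vec a) (tp (vec c) (br (vec b) (vec d)))) s) r"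

definition yb_vec where "yb_vec r s = yb12_13_vec r s + yb12_23_vec r s + yb13_23_vec r s"

lemma yb_leg_vec_lin: "lin (\<lambda>r. yb12_13_vec r s)" "lin (yb12_13_vec r)" "lin (\<lambda>r. yb12_23_vec r s)" "lin (yb12_23_vec r)"
    "lin (\<lambda>r. yb13_23_vec r s)" "lin (yb13_23_vec r)"
  unfolding yb12_13_vec_def yb12_23_vec_def yb13_23_vec_def case_prod_unfold by (intro lin_ext_fun lin_ext)+

lemma ext_tp2:
  assumes "\<And>p q s. lin (\<lambda>r. G p q r s)" "\<And>p q r. lin (G p q r)"
    "\<And>q r s. lin (\<lambda>p. G p q r s)" "\<And>p r s. lin (\<lambda>q. G p q r s)"
  shows "ext (\<lambda>(a, b). ext (\<lambda>(c, d). G (vec a) (vec b) (vec c) (vec d)) (tp r s)) (tp p q) = G p q r s"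
proof -
  have "ext (\<lambda>(c, d). G p q (vec c) (vec d)) (tp r s) = G p q r s" for p q
    by (rule ext_tp[where F = "G p q"]) (simp_all add: assms)
  then show ?thesis
    using ext_tp[of "\<lambda>p q. G p q r s" p q] by (simp add: assms)
qed

lemma yb_leg_vec_tp:
  "yb12_13_vec (tp p q) (tp r s) = tp (br p r) (tp q s)"
  "yb12_23_vec (tp p q) (tp r s) = tp p (tp (br q r) s)"
  "yb13_23_vec (tp p q) (tp r s) = tp p (tp r (br q s))"
  unfolding yb12_13_vec_def yb12_23_vec_def yb13_23_vec_def tp_vec[symmetric]
  by (rule ext_tp2; intro tp_lin1 tp_lin2 lin_compose[OF br_lin1 tp_lin1] lin_compose[OF br_lin2 tp_lin1]
    lin_compose[OF tp_lin1 tp_lin2] lin_compose[OF tp_lin2 tp_lin2]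
    lin_compose[OF lin_compose[OF br_lin1 tp_lin1] tp_lin2] lin_compose[OF lin_compose[OF br_lin2 tp_lin1] tp_lin2]
    lin_compose[OF lin_compose[OF br_lin1 tp_lin2] tp_lin2] lin_compose[OF lin_compose[OF br_lin2 tp_lin2] tp_lin2])+

text \<open>The map \<open>1 \<otimes> \<Delta>\<^sub>r\<close> for the coboundary \<open>\<Delta>\<^sub>r y = y \<cdot> r\<close>.\<close>

definition id_cobracket where "id_cobracket r = id_tensor_vec (\<lambda>y. act y r)"

lemma id_cobracket_lin2: "lin (id_cobracket r)"
  unfolding id_cobracket_def by (rule lin_id_tensor_vec)

lemma id_cobracket_lin1: "lin (\<lambda>r. id_cobracket r t)"
  unfolding id_cobracket_def id_tensor_vec_def case_prod_unfold by (intro lin_ext_fun lin_compose[OF act_lin2 tp_lin2])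

lemma id_cobracket_tp: "id_cobracket r (tp p q) = tp p (act q r)"
  unfolding id_cobracket_def by (rule id_tensor_vec_tp[OF act_lin1])

text \<open>The left-hand side of the co-Jacobi identity at \<open>x\<close>, with \<open>\<Delta>\<^sub>s\<close> applied first and \<open>\<Delta>\<^sub>r\<close> second.
Distinguishing \<open>r\<close> from \<open>s\<close> makes it bilinear.\<close>

definition cojacobiator where "cojacobiator r s x = id_cobracket r (act x s) + cyc_vec (id_cobracket r (act x s)) + cyc_vec (cyc_vec (id_cobracket r (act x s)))"

text \<open>Both sides are linear in each of \<open>a\<close>, \<open>b\<close>, \<open>c\<close>, \<open>d\<close>, and expand into sums of pure tensors.
Orienting the brackets among \<open>a\<close>, \<open>b\<close>, \<open>c\<close>, \<open>d\<close> by antisymmetry and moving \<open>x\<close> inwards by the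
derivation rule brings the two sums to the same normal form.  The sum of the two orders is the polar
form of the quadratic identity for a single skew tensor.\<close>

lemma cojacobiator_wedge:
  "cojacobiator (tp a b - tp b a) (tp c d - tp d c) x + cojacobiator (tp c d - tp d c) (tp a b - tp b a) x
    = act3 x (yb_vec (tp a b - tp b a) (tp c d - tp d c) + yb_vec (tp c d - tp d c) (tp a b - tp b a))"
proof -
  have o: "br b a = - br a b" "br c a = - br a c" "br d a = - br a d" "br c b = - br b c"
      "br d b = - br b d" "br d c = - br c d"
    by (rule br_swap)+
  show ?thesis
    unfolding cojacobiator_def yb_vec_def
    by (simp add: act_tp act3_tp tp_simps linD[OF act_lin2] linD[OF act3_lin2] linD[OF yb_leg_vec_lin(1)] linD[OF yb_leg_vec_lin(2)]
        linD[OF yb_leg_vec_lin(3)] linD[OF yb_leg_vec_lin(4)] linD[OF yb_leg_vec_lin(5)] linD[OF yb_leg_vec_lin(6)] yb_leg_vec_tp linD[OF id_cobracket_lin2] id_cobracket_tp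
        linD[OF lin_cyc_vec] cyc_vec_tp br_simps o br_derivation[of x])
qed

lemma cojacobiator_lin: "lin (\<lambda>r. cojacobiator r s x)" "lin (\<lambda>s. cojacobiator r s x)"
  unfolding cojacobiator_def
  by (intro lin_plus id_cobracket_lin1 lin_compose[OF id_cobracket_lin1 lin_cyc_vec] lin_compose[OF lin_compose[OF id_cobracket_lin1 lin_cyc_vec] lin_cyc_vec]
    lin_compose[OF act_lin2 id_cobracket_lin2] lin_compose[OF lin_compose[OF act_lin2 id_cobracket_lin2] lin_cyc_vec]
    lin_compose[OF lin_compose[OF lin_compose[OF act_lin2 id_cobracket_lin2] lin_cyc_vec] lin_cyc_vec])+

lemma yb_vec_lin: "lin (\<lambda>r. yb_vec r s)" "lin (\<lambda>s. yb_vec r s)"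
  unfolding yb_vec_def by (intro lin_plus yb_leg_vec_lin)+

text \<open>The tensors \<open>p - \<tau> p\<close> are spanned by the wedges \<open>a \<otimes> b - b \<otimes> a\<close>, so the polarised identity extends to
them; a skew \<open>r\<close> is \<open>p - \<tau> p\<close> for \<open>p = r / 2\<close>, and the diagonal of a symmetric bilinear identity
gives twice the claim.\<close>

lemma cojacobiator_skew:
  assumes r: "twist_vec r = - r"
  shows "cojacobiator r r x = act3 x (yb_vec r r)"
proof -
  let ?W = "\<lambda>r. r - twist_vec r"
  have W: "lin ?W" by (intro lin_minus lin_ident lin_twist_vec)
  have "cojacobiator (?W p) (?W q) x + cojacobiator (?W q) (?W p) x = act3 x (yb_vec (?W p) (?W q) + yb_vec (?W q) (?W p))" for p q
  proof (rule lin_eqI2[where F = "\<lambda>p q. cojacobiator (?W p) (?W q) x + cojacobiator (?W q) (?W p) x"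
      and G = "\<lambda>p q. act3 x (yb_vec (?W p) (?W q) + yb_vec (?W q) (?W p))"])
    fix i j :: "'i \<times> 'i"
    obtain a b c d where ij: "i = (a, b)" "j = (c, d)" by fastforce
    show "cojacobiator (?W (vec i)) (?W (vec j)) x + cojacobiator (?W (vec j)) (?W (vec i)) x
      = act3 x (yb_vec (?W (vec i)) (?W (vec j)) + yb_vec (?W (vec j)) (?W (vec i)))"
      unfolding ij tp_vec[symmetric] twist_vec_tp by (rule cojacobiator_wedge)
  qed (intro lin_plus lin_compose[OF W cojacobiator_lin(1)] lin_compose[OF W cojacobiator_lin(2)] lin_compose[OF _ act3_lin2]
      lin_compose[OF W yb_vec_lin(1)] lin_compose[OF W yb_vec_lin(2)])+
  from this[of "pscale (1/2) r" "pscale (1/2) r"]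
  have "cojacobiator r r x + cojacobiator r r x = act3 x (yb_vec r r) + act3 x (yb_vec r r)"
    by (simp add: linD[OF lin_twist_vec] r linD[OF act3_lin2] flip: pscale_add_left)
      (simp add: pscale_uminus flip: pscale_add_left add: pscale_1)
  moreover have "pscale 2 p = p + p" for p :: "'i \<times> 'i \<times> 'i \<Rightarrow>\<^sub>0 'f"
    using pscale_add_left[of 1 1 p] by (simp add: pscale_1)
  ultimately have "pscale 2 (cojacobiator r r x) = pscale 2 (act3 x (yb_vec r r))"
    by simp
  then have "pscale (1/2) (pscale 2 (cojacobiator r r x)) = pscale (1/2) (pscale 2 (act3 x (yb_vec r r)))" by simp
  then show ?thesis by (simp add: pscale_pscale pscale_1)
qed

end

section \<open>The integral Witt algebra acting on two-variable group algebras\<close>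

text \<open>The function with value \<open>c\<close> at \<open>(\<alpha>, \<beta>)\<close> and zero elsewhere stands for the monomial
\<open>c x\<^sup>\<alpha> y\<^sup>\<beta>\<close>; the exponents are arbitrary elements of the field, and the product is convolution.  The
monomial corresponds to \<open>L\<^sub>\<alpha> a \<otimes> L\<^sub>\<beta> b\<close> for fixed basis elements \<open>a\<close>, \<open>b\<close> of the coefficient algebra.\<close>

type_synonym 'f grp2 = "('f \<times> 'f) \<Rightarrow>\<^sub>0 'f"

text \<open>The Euler operators \<open>x \<partial>/\<partial>x\<close> and \<open>y \<partial>/\<partial>y\<close>.\<close>

definition eulerx :: "'f::field grp2 \<Rightarrow> 'f grp2"
  where "eulerx = Poly_Mapping.mapp (\<lambda>k v. fst k * v)"

definition eulery :: "'f::field grp2 \<Rightarrow> 'f grp2"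
  where "eulery = Poly_Mapping.mapp (\<lambda>k v. snd k * v)"

definition xpow :: "'f::field \<Rightarrow> 'f grp2"
  where "xpow n = single (n, 0) 1"

definition ypow :: "'f::field \<Rightarrow> 'f grp2"
  where "ypow n = single (0, n) 1"

lemma lookup_eulerx: "lookup (eulerx f) k = fst k * lookup f k"
  by (auto simp: eulerx_def lookup_mapp when_def in_keys_iff)

lemma lookup_eulery: "lookup (eulery f) k = snd k * lookup f k"
  by (auto simp: eulery_def lookup_mapp when_def in_keys_iff)

lemma eulerx_add: "eulerx (f + g) = eulerx f + eulerx g"
  by (rule poly_mapping_eqI) (simp add: lookup_eulerx lookup_add algebra_simps)

lemma eulery_add: "eulery (f + g) = eulery f + eulery g"
  by (rule poly_mapping_eqI) (simp add: lookup_eulery lookup_add algebra_simps)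

lemma eulerx_single: "eulerx (single k c) = single k (fst k * c)"
  by (rule poly_mapping_eqI) (simp add: lookup_eulerx lookup_single when_def)

lemma eulery_single: "eulery (single k c) = single k (snd k * c)"
  by (rule poly_mapping_eqI) (simp add: lookup_eulery lookup_single when_def)

lemma eulerx_mult: "eulerx (f * g) = eulerx f * g + f * eulerx g"
proof (induction f rule: poly_mapping_additive_induct)
  case (single i c)
  show ?case
    by (induction g rule: poly_mapping_additive_induct)
      (simp_all add: mult_single eulerx_single eulerx_add single_add[symmetric] algebra_simps)
qed (simp add: eulerx_add algebra_simps)

lemma eulery_mult: "eulery (f * g) = eulery f * g + f * eulery g"
proof (induction f rule: poly_mapping_additive_induct)
  case (single i c)
  show ?case
    by (induction g rule: poly_mapping_additive_induct)
      (simp_all add: mult_single eulery_single eulery_add single_add[symmetric] algebra_simps)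
qed (simp add: eulery_add algebra_simps)

lemma eulerx_diff: "eulerx (f - g) = eulerx f - eulerx g"
  by (rule poly_mapping_eqI) (simp add: lookup_eulerx lookup_minus algebra_simps)

lemma eulery_diff: "eulery (f - g) = eulery f - eulery g"
  by (rule poly_mapping_eqI) (simp add: lookup_eulery lookup_minus algebra_simps)

lemma eulerx_uminus: "eulerx (- g) = - eulerx g"
  by (rule poly_mapping_eqI) (simp add: lookup_eulerx algebra_simps)

lemma eulerx_const: "eulerx (single 0 c) = 0"
  by (simp add: eulerx_single)

lemma eulery_const: "eulery (single 0 c) = 0"
  by (simp add: eulery_single)

lemma eulerx_numeral: "eulerx (numeral n) = 0"
  by (metis eulerx_const single_numeral)

lemma eulerx_xpow: "eulerx (xpow n) = single 0 n * xpow n"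
  and eulery_xpow: "eulery (xpow n) = 0"
  and eulerx_ypow: "eulerx (ypow n) = 0"
  and eulery_ypow: "eulery (ypow n) = single 0 n * ypow n"
  by (simp_all add: xpow_def ypow_def eulerx_single eulery_single mult_single)

lemma xpow_add: "xpow m * xpow n = xpow (m + n)" and ypow_add: "ypow m * ypow n = ypow (m + n)"
  by (simp_all add: xpow_def ypow_def mult_single)

lemma xpow_0: "xpow 0 = 1" and ypow_0: "ypow 0 = 1"
  by (simp_all add: xpow_def ypow_def flip: zero_prod_def)

lemma lookup_xpow_mult: "lookup (xpow n * f) (\<alpha>, \<beta>) = lookup f (\<alpha> - n, \<beta>)"
  by (induction f rule: poly_mapping_additive_induct)
    (auto simp: xpow_def mult_single lookup_single when_def lookup_add distrib_left)

lemma lookup_ypow_mult: "lookup (ypow n * f) (\<alpha>, \<beta>) = lookup f (\<alpha>, \<beta> - n)"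
  by (induction f rule: poly_mapping_additive_induct)
    (auto simp: ypow_def mult_single lookup_single when_def lookup_add distrib_left)

lemma lookup_const_mult: "lookup (single 0 c * f) k = c * lookup f k"
  for f :: "'f::field grp2"
  by (induction f rule: poly_mapping_additive_induct)
    (auto simp: mult_single lookup_single when_def lookup_add distrib_left)

abbreviation cst :: "'f::field \<Rightarrow> 'f grp2"
  where "cst \<equiv> single 0"

lemma cst_simps: "cst (a + b) = cst a + cst b" "cst (a - b) = cst a - cst b" "cst (a * b) = cst a * cst b"
    "cst (- a) = - cst a" "cst 0 = 0" "cst 1 = 1" "cst (numeral k) = numeral k"
  by (simp_all add: single_add single_diff single_uminus mult_single)

text \<open>From \<open>[L\<^sub>n, L\<^sub>\<alpha>] = (\<alpha> - n) L\<^sub>\<alpha>\<^sub>+\<^sub>n\<close> in either variable.\<close>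

definition witt_act :: "'f::field \<Rightarrow> 'f grp2 \<Rightarrow> 'f grp2"
  where "witt_act n f = xpow n * (eulerx f - cst n * f) + ypow n * (eulery f - cst n * f)"

lemma lookup_witt_act: "lookup (witt_act n f) (\<alpha>, \<beta>) =
    (\<alpha> - 2 * n) * lookup f (\<alpha> - n, \<beta>) + (\<beta> - 2 * n) * lookup f (\<alpha>, \<beta> - n)"
  unfolding witt_act_def lookup_add lookup_xpow_mult lookup_ypow_mult lookup_minus lookup_eulerx
      lookup_eulery lookup_const_mult by (simp add: algebra_simps)

lemma witt_act_diff: "witt_act n (f - g) = witt_act n f - witt_act n g"
  by (simp add: witt_act_def eulerx_diff eulery_diff algebra_simps)

lemma witt_act_commutator_coeffs:
  fixes A B C D \<alpha> \<beta> m n :: "'f::field"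
  shows "(\<alpha> - 2 * m) * ((\<alpha> - m - 2 * n) * A + (\<beta> - 2 * n) * B)
      + (\<beta> - 2 * m) * ((\<alpha> - 2 * n) * C + (\<beta> - m - 2 * n) * D)
      - ((\<alpha> - 2 * n) * ((\<alpha> - n - 2 * m) * A + (\<beta> - 2 * m) * C)
      + (\<beta> - 2 * n) * ((\<alpha> - 2 * m) * B + (\<beta> - n - 2 * m) * D))
    = (n - m) * ((\<alpha> - 2 * (m + n)) * A + (\<beta> - 2 * (m + n)) * D)"
  by Groebner_Basis.algebra

lemma witt_act_commutator: "witt_act m (witt_act n f) - witt_act n (witt_act m f) = cst (n - m) * witt_act (m + n) f"
proof (rule poly_mapping_eqI)
  fix k :: "'a \<times> 'a"
  obtain \<alpha> \<beta> where k: "k = (\<alpha>, \<beta>)" by fastforce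
  have s: "\<alpha> - m - n = \<alpha> - n - m" "\<alpha> - (m + n) = \<alpha> - n - m" "\<beta> - m - n = \<beta> - n - m" "\<beta> - (m + n) = \<beta> - n - m"
    by simp_all
  show "lookup (witt_act m (witt_act n f) - witt_act n (witt_act m f)) k
    = lookup (cst (n - m) * witt_act (m + n) f) k"
    unfolding k lookup_minus lookup_witt_act lookup_const_mult s by (rule witt_act_commutator_coeffs)
qed

text \<open>If \<open>x f = y f\<close>, the coefficients of \<open>f\<close> are constant along each antidiagonal
\<open>(\<alpha> + n, \<beta> - n)\<close>, which is infinite in characteristic zero; so finite support forces them to vanish.\<close>

lemma shift_diff_cancel:
  fixes f :: "'f::field_char_0 grp2"
  assumes "(xpow 1 - ypow 1) * f = 0"
  shows "f = 0"
proof (rule ccontr)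
  assume "f \<noteq> 0"
  then obtain k where k: "lookup f k \<noteq> 0"
    by (metis poly_mapping_eqI lookup_zero)
  obtain a b where [simp]: "k = (a, b)" by fastforce
  have step: "lookup f (\<alpha> - 1, \<beta>) = lookup f (\<alpha>, \<beta> - 1)" for \<alpha> \<beta>
  proof -
    have "lookup ((xpow 1 - ypow 1) * f) (\<alpha>, \<beta>) = 0" using assms by simp
    then show ?thesis
      by (simp add: left_diff_distrib lookup_minus lookup_xpow_mult lookup_ypow_mult)
  qed
  have "lookup f (a + of_nat n, b - of_nat n) = lookup f (a, b)" for n
  proof (induction n)
    case (Suc n)
    then show ?case using step[of "a + of_nat (Suc n)" "b - of_nat n"] by (simp add: algebra_simps)
  qed simp
  then have "range (\<lambda>n::nat. (a + of_nat n, b - of_nat n)) \<subseteq> keys f"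
    using k by (auto simp: in_keys_iff)
  moreover have "inj (\<lambda>n::nat. (a + of_nat n, b - of_nat n))"
    by (rule injI) simp
  ultimately show False
    using finite_keys finite_subset range_inj_infinite by blast
qed

lemma shift_diff_cancel_eq: "(xpow 1 - ypow 1) * f - (xpow 1 - ypow 1) * g = r \<Longrightarrow> r = 0 \<Longrightarrow> f = g"
  for f :: "'f::field_char_0 grp2"
  using shift_diff_cancel[of "f - g"] by (simp add: right_diff_distrib)

lemma cst_inverse_numeral: "cst (1 / numeral c) * (numeral c * f) = (f :: 'f::field_char_0 grp2)"
proof -
  have "cst (1 / numeral c) * cst (numeral c) = (1 :: 'f grp2)"
    by (subst mult_single) simp
  then show ?thesis by (simp add: cst_simps flip: mult.assoc)
qed

text \<open>The factor \<open>c y\<close> is a unit.\<close>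

lemma shift_diff_dvd:
  fixes u p :: "'f::field_char_0 grp2"
  assumes "numeral c * ypow 1 * u = (xpow 1 - ypow 1) * p"
  obtains w where "u = (xpow 1 - ypow 1) * w"
proof -
  have "cst (1 / numeral c) * (numeral c * (ypow (-1) * ypow 1 * u)) = u"
    unfolding cst_inverse_numeral by (simp add: ypow_add ypow_0)
  then have "u = cst (1 / numeral c) * ypow (-1) * (numeral c * ypow 1 * u)"
    by (simp add: mult_ac)
  also have "\<dots> = (xpow 1 - ypow 1) * (cst (1 / numeral c) * ypow (-1) * p)"
    unfolding assms by (simp only: mult_ac)
  finally show ?thesis by (rule that)
qed

text \<open>On elements of total degree \<open>d\<close>, Euler's relation eliminates \<open>E\<^sub>y\<close> and leaves a first-order operator
in \<open>E\<^sub>x\<close> alone whose leading coefficient vanishes on the diagonal \<open>x = y\<close>.\<close>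

lemma witt_act_homogeneous:
  assumes "eulery f = cst d * f - eulerx f"
  shows "witt_act n f = (xpow n - ypow n) * eulerx f - cst n * xpow n * f + cst (d - n) * ypow n * f"
  by (simp add: witt_act_def assms cst_simps algebra_simps)

lemmas eulerx_simps = eulerx_add eulerx_diff eulerx_uminus eulerx_mult eulerx_xpow eulerx_ypow eulerx_const
  eulerx_numeral cst_simps

text \<open>Each first-order equation that occurs has the form \<open>(x - y) E\<^sub>x w = (p x + q y) w + b\<close> with \<open>b\<close>
divisible by \<open>x - y\<close>.  Modulo \<open>x - y\<close> it says that \<open>(p + q) y w\<close> vanishes, so \<open>w\<close> is divisible by \<open>x - y\<close> and the quotient satisfies
an equation of the same kind with \<open>p\<close> lowered by one.  Three divisions are possible for the obstruction
\<open>g\<close>, two for the candidate \<open>u\<close> for \<open>(x - y)\<^sup>2 v\<close>.  The final quotient \<open>h\<close> is a multiple of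
\<open>x\<^sup>-\<^sup>1 y\<^sup>-\<^sup>1\<close>, as the last two equations say, so the defect depends on one parameter only.\<close>

lemma witt_cocycle_up_to_defect:
  fixes f1 f2 fm :: "'f::field_char_0 grp2"
  assumes hom: "eulery f1 = f1 - eulerx f1" "eulery f2 = 2 * f2 - eulerx f2" "eulery fm = - fm - eulerx fm"
    and A: "witt_act 1 fm = witt_act (-1) f1"
    and B: "witt_act (-1) f2 - witt_act 2 fm = 3 * f1"
  obtains v h where
    "f1 - witt_act 1 v = (xpow 1 - ypow 1) * (xpow 1 ^ 2 - 3 * xpow 1 * ypow 1 + ypow 1 ^ 2) * h"
    "f2 - witt_act 2 v = (xpow 1 + ypow 1) * (f1 - witt_act 1 v)"
    "eulery v = - eulerx v" "eulerx h = - h" "eulery h = - h"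
proof -
  define x y :: "'f grp2" where "x = xpow 1" and "y = ypow 1"
  define x' y' :: "'f grp2" where "x' = xpow (-1)" and "y' = ypow (-1)"
  define E :: "'f grp2 \<Rightarrow> 'f grp2" where "E = eulerx"
  have inv: "x * x' = 1" "y * y' = 1" "x * (x' * f) = f" "y * (y' * f) = f"
    "x' * (x * f) = f" "y' * (y * f) = f" for f
    by (simp_all add: x_def x'_def y_def y'_def xpow_add ypow_add xpow_0 ypow_0 flip: mult.assoc)
  have x2: "xpow 2 = x * x" "ypow 2 = y * y"
    by (simp_all add: x_def y_def xpow_add ypow_add)
  have E: "E x = x" "E y = 0" "E x' = - x'" "E y' = 0"
    by (simp_all add: E_def x_def x'_def y_def y'_def eulerx_simps)
  have E': "\<And>p q. E (p + q) = E p + E q" "\<And>p q. E (p - q) = E p - E q" "\<And>p. E (- p) = - E p"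
    "\<And>p q. E (p * q) = E p * q + p * E q" "\<And>k. E (numeral k) = 0"
    by (simp_all add: E_def eulerx_simps)
  note canc = shift_diff_cancel_eq[where 'f = 'f, folded x_def y_def]
  note dvd = shift_diff_dvd[where 'f = 'f, folded x_def y_def]
  note ring = algebra_simps power2_eq_square power3_eq_cube
  have w1: "witt_act 1 fm = (x - y) * E fm - x * fm - 2 * y * fm"
    by (subst witt_act_homogeneous[where d = "-1"])
      (simp_all add: hom cst_simps x_def y_def E_def)
  have w2: "witt_act (-1) f1 = (x' - y') * E f1 + x' * f1 + 2 * y' * f1"
    by (subst witt_act_homogeneous[where d = "1"])
      (simp_all add: hom cst_simps x'_def y'_def E_def)
  have w3: "witt_act (-1) f2 = (x' - y') * E f2 + x' * f2 + 3 * y' * f2"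
    by (subst witt_act_homogeneous[where d = "2"])
      (simp_all add: hom cst_simps x'_def y'_def E_def)
  have w4: "witt_act 2 fm = (x*x - y*y) * E fm - 2 * (x*x) * fm - 3 * (y*y) * fm"
    by (subst witt_act_homogeneous[where d = "-1"])
      (simp_all add: hom cst_simps E_def x2 mult.assoc)
  \<comment> \<open>This combination vanishes when \<open>f1\<close> and \<open>fm\<close> are \<open>L\<^sub>1 v\<close> and \<open>L\<^sub>-\<^sub>1 v\<close> for some \<open>v\<close> of degree \<open>0\<close>.\<close>
  define g where "g = x * y * fm + f1"
  have fm: "x * (y * fm) = g - f1" by (simp add: g_def mult.assoc)
  have Efm: "x * (y * E fm) = E g - E f1 - g + f1"
    by (simp add: g_def E E' algebra_simps)
  have g1: "(x - y) * E g = (2 * x + y) * g"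
  proof -
    have "x * y * (witt_act 1 fm - witt_act (-1) f1) = (x - y) * (x * (y * E fm)) - (x + 2 * y) * (x * (y * fm))
      - ((y - x) * E f1 + y * f1 + 2 * x * f1)"
      unfolding w1 w2 by (simp add: ring inv)
    also have "\<dots> = (x - y) * E g - (2 * x + y) * g"
      unfolding fm Efm by (simp add: ring)
    finally show ?thesis using A by simp
  qed
  have "3 * y * g = (x - y) * (E g - 2 * g) - ((x - y) * E g - (2 * x + y) * g)"
    by (simp add: ring)
  then have "3 * y * g = (x - y) * (E g - 2 * g)" by (simp only: g1 diff_self diff_0_right)
  then obtain ga where ga: "g = (x - y) * ga" by (rule dvd)
  have "(x - y) * ((x - y) * E ga) - (x - y) * ((x + y) * ga) = (x - y) * E g - (2 * x + y) * g"
    unfolding ga by (simp add: E E' ring)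
  then have ga1: "(x - y) * E ga = (x + y) * ga" by (rule canc) (simp add: g1)
  have "2 * y * ga = (x - y) * (E ga - ga) - ((x - y) * E ga - (x + y) * ga)"
    by (simp add: ring)
  then have "2 * y * ga = (x - y) * (E ga - ga)" by (simp only: ga1 diff_self diff_0_right)
  then obtain gb where gb: "ga = (x - y) * gb" by (rule dvd)
  have "(x - y) * ((x - y) * E gb) - (x - y) * (y * gb) = (x - y) * E ga - (x + y) * ga"
    unfolding gb by (simp add: E E' ring)
  then have gb1: "(x - y) * E gb = y * gb" by (rule canc) (simp add: ga1)
  \<comment> \<open>the shape \<open>c y w = (x - y) p\<close> with \<open>c = 1\<close>\<close>
  then have "numeral num.One * y * gb = (x - y) * E gb" by simp
  then obtain h where h: "gb = (x - y) * h" by (rule dvd)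
  have "(x - y) * ((x - y) * E h) - (x - y) * ((x - y) * (- h)) = (x - y) * E gb - y * gb"
    unfolding h by (simp add: E E' ring)
  then have "(x - y) * E h = (x - y) * (- h)" by (rule canc) (simp add: gb1)
  then have "(x - y) * E h - (x - y) * (- h) = 0" by simp
  then have Eh: "E h = - h" by (rule canc) simp
  have gh: "g = (x - y) ^ 3 * h" by (simp add: ga gb h ring)
  have Eg: "E g = 3 * x * (x - y) ^ 2 * h - (x - y) ^ 3 * h"
    by (simp add: gh E E' Eh ring)
  \<comment> \<open>For a coboundary this is \<open>(x - y)\<^sup>2 v\<close>.\<close>
  define u where "u = (x + y) * f1 - f2"
  have f2: "f2 = (x + y) * f1 - u" by (simp add: u_def)
  have Ef2: "E f2 = (x + y) * E f1 + x * f1 - E u"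
    by (simp add: f2 E E' ring)
  \<comment> \<open>the contribution of \<open>g\<close> to the equation for \<open>u\<close>, divided by \<open>(x - y)\<^sup>3\<close>\<close>
  define W where "W = (3 * x * y - x * x - y * y) * h"
  have u1: "(x - y) * E u - (y + 3 * x) * u = (x - y) ^ 2 * f1 + (x - y) ^ 3 * W"
  proof -
    have "x * y * (witt_act (-1) f2 - witt_act 2 fm - 3 * f1) = (y - x) * E f2 + y * f2 + 3 * x * f2
      - ((x * x - y * y) * (x * (y * E fm)) - (2 * (x * x) + 3 * (y * y)) * (x * (y * fm))) - 3 * x * y * f1"
      unfolding w3 w4 by (simp add: ring inv)
    also have "\<dots> = (x - y) * E u - (y + 3 * x) * u - ((x - y) ^ 2 * f1
      + ((x * x - y * y) * (E g - g) - (2 * (x * x) + 3 * (y * y)) * g))"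
      unfolding fm Efm Ef2 unfolding f2 by (simp add: ring)
    also have "(x * x - y * y) * (E g - g) - (2 * (x * x) + 3 * (y * y)) * g = (x - y) ^ 3 * W"
      unfolding Eg unfolding gh W_def by (simp add: ring)
    finally show ?thesis using B by simp
  qed
  have "4 * y * u = (x - y) * (E u - 3 * u - (x - y) * f1 - (x - y)^2 * W)
    - ((x - y) * E u - (y + 3 * x) * u - ((x - y) ^ 2 * f1 + (x - y) ^ 3 * W))"
    by (simp add: ring)
  then have "4 * y * u = (x - y) * (E u - 3 * u - (x - y) * f1 - (x - y)^2 * W)"
    using u1 by simp
  then obtain ua where ua: "u = (x - y) * ua" by (rule dvd)
  have "(x - y) * ((x - y) * E ua - (2 * x + y) * ua) - (x - y) * ((x - y) * f1 + (x - y) ^ 2 * W)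
      = (x - y) * E u - (y + 3 * x) * u - ((x - y) ^ 2 * f1 + (x - y) ^ 3 * W)"
    unfolding ua by (simp add: E E' ring)
  then have ua1: "(x - y) * E ua - (2 * x + y) * ua = (x - y) * f1 + (x - y) ^ 2 * W"
    by (rule canc) (simp add: u1)
  have "3 * y * ua = (x - y) * (E ua - 2 * ua - f1 - (x - y) * W)
    - ((x - y) * E ua - (2 * x + y) * ua - ((x - y) * f1 + (x - y) ^ 2 * W))"
    by (simp add: ring)
  then have "3 * y * ua = (x - y) * (E ua - 2 * ua - f1 - (x - y) * W)"
    using ua1 by simp
  then obtain v where v: "ua = (x - y) * v" by (rule dvd)
  have "(x - y) * ((x - y) * E v - (x + y) * v) - (x - y) * (f1 + (x - y) * W)
    = (x - y) * E ua - (2 * x + y) * ua - ((x - y) * f1 + (x - y) ^ 2 * W)"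
    unfolding v by (simp add: E E' ring)
  then have v1: "(x - y) * E v - (x + y) * v = f1 + (x - y) * W"
    by (rule canc) (simp add: ua1)
  have uv: "(x - y) ^ 2 * v = u" unfolding ua v by (simp add: ring)
  \<comment> \<open>The quotients inherit homogeneity: \<open>v\<close> has degree \<open>0\<close>, and \<open>h\<close> has degree \<open>-1\<close> in \<open>y\<close>.\<close>
  have ey: "eulery x = 0" "eulery y = y"
    by (simp_all add: x_def y_def eulery_xpow eulery_ypow cst_simps)
  have ex: "eulerx x = x" "eulerx y = 0"
    using E by (simp_all add: E_def)
  have hu: "eulery u = 2 * u - E u"
    unfolding u_def E'
    by (simp add: eulery_diff eulery_add eulery_mult ey ex hom ring E_def)
  have "(x - y) * ((x - y) * eulery v) - (x - y) * ((x - y) * (- E v)) = eulery u - (2 * u - E u)"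
    unfolding ua v eulery_mult eulery_diff E' ey E by (simp add: ring)
  then have "(x - y) * eulery v = (x - y) * (- E v)" by (rule canc) (simp add: hu)
  then have "(x - y) * eulery v - (x - y) * (- E v) = 0" by simp
  then have hv: "eulery v = - E v" by (rule canc) simp
  have hg: "eulery g = g - E g"
    unfolding g_def E'
    by (simp add: eulery_diff eulery_add eulery_mult ey ex hom ring E_def)
  have "(x - y) * ((x - y) * ((x - y) * eulery h)) - (x - y) * ((x - y) * ((x - y) * (- h)))
    = eulery g - (g - E g)"
    unfolding ga gb h eulery_mult eulery_diff E' ey E Eh by (simp add: ring)
  then have "(x - y) * ((x - y) * eulery h) = (x - y) * ((x - y) * (- h))" by (rule canc) (simp add: hg)
  then have "(x - y) * ((x - y) * eulery h) - (x - y) * ((x - y) * (- h)) = 0" by simp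
  then have "(x - y) * eulery h = (x - y) * (- h)" by (rule canc) simp
  then have "(x - y) * eulery h - (x - y) * (- h) = 0" by simp
  then have hh: "eulery h = - h" by (rule canc) simp
  have wv1: "witt_act 1 v = (x - y) * E v - x * v - y * v"
    by (subst witt_act_homogeneous[where d = "0"])
      (simp_all add: hv cst_simps x_def y_def E_def)
  have wv2: "witt_act 2 v = (x*x - y*y) * E v - 2 * (x*x) * v - 2 * (y*y) * v"
    by (subst witt_act_homogeneous[where d = "0"])
      (simp_all add: hv cst_simps x2 E_def mult.assoc)
  have "f1 - witt_act 1 v = (f1 + (x - y) * W - ((x - y) * E v - (x + y) * v)) - (x - y) * W"
    unfolding wv1 by (simp add: ring)
  then have "f1 - witt_act 1 v = - ((x - y) * W)"
    unfolding v1 by simp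
  also have "\<dots> = (x - y) * (x ^ 2 - 3 * x * y + y ^ 2) * h"
    unfolding W_def by (simp add: ring)
  finally have r1: "f1 - witt_act 1 v = (x - y) * (x ^ 2 - 3 * x * y + y ^ 2) * h" .
  have r2: "f2 - witt_act 2 v = (x + y) * (f1 - witt_act 1 v)"
    unfolding wv1 wv2 f2 uv[symmetric] by (simp add: ring)
  show ?thesis
    by (rule that[of v h, folded x_def y_def]) (use r1 r2 hv Eh hh in \<open>simp_all only: E_def\<close>)
qed

text \<open>The defect is itself the value at \<open>L\<^sub>1\<close> and \<open>L\<^sub>2\<close> of a cocycle, which determines its values at
\<open>L\<^sub>3 = [L\<^sub>1, L\<^sub>2]\<close> and at \<open>L\<^sub>4\<close> through \<open>2 L\<^sub>4 = [L\<^sub>1, L\<^sub>3]\<close> as explicit polynomials times \<open>h\<close>.  In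
degree 5 there are two ways to compute, and their difference is a multiple of \<open>(x - y)\<^sup>7 h\<close>.\<close>

lemma witt_cocycle_defect_zero:
  fixes h :: "'f::field_char_0 grp2"
  assumes f1: "f1 = (xpow 1 - ypow 1) * (xpow 1 ^ 2 - 3 * xpow 1 * ypow 1 + ypow 1 ^ 2) * h"
    and f2: "f2 = (xpow 1 + ypow 1) * f1"
    and h: "eulerx h = - h" "eulery h = - h"
    and f3: "f3 = witt_act 1 f2 - witt_act 2 f1"
    and f4: "2 * f4 = witt_act 1 f3 - witt_act 3 f1"
    and f5: "3 * (witt_act 2 f3 - witt_act 3 f2) = witt_act 1 f4 - witt_act 4 f1"
  shows "h = 0"
proof -
  \<comment> \<open>Monomials with integral exponents, so that products of them are normalised by integer arithmetic.\<close>
  define M :: "int \<Rightarrow> int \<Rightarrow> 'f grp2" where "M i j = xpow (of_int i) * ypow (of_int j)" for i j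
  have M: "M i j * M k l = M (i + k) (j + l)" for i j k l
    by (simp add: M_def mult_ac flip: xpow_add ypow_add)
  have M': "M i j * (M k l * f) = M (i + k) (j + l) * f" for i j k l f
    by (simp add: M flip: mult.assoc)
  have Mn: "M i j * (numeral k * f) = numeral k * (M i j * f)" "M i j * numeral k = numeral k * M i j" for i j k f
    by (simp_all add: algebra_simps)
  note ring = distrib_left distrib_right left_diff_distrib right_diff_distrib add_ac
    diff_diff_eq diff_diff_eq2 add_diff_eq diff_add_eq mult.assoc Mn M M'
  have xM: "xpow 1 = M 1 0" "xpow 2 = M 2 0" "xpow 3 = M 3 0" "xpow 4 = M 4 0"
      "ypow 1 = M 0 1" "ypow 2 = M 0 2" "ypow 3 = M 0 3" "ypow 4 = M 0 4"
    by (simp_all add: M_def xpow_0 ypow_0)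
  have E: "eulerx (M i j) = of_int i * M i j" "eulery (M i j) = of_int j * M i j" for i j
    by (simp_all add: M_def eulerx_mult eulerx_xpow eulerx_ypow eulery_mult eulery_xpow eulery_ypow mult_ac)
  have w: "witt_act (of_int n) (p * h) = (M n 0 * (eulerx p - of_int (n + 1) * p) + M 0 n * (eulery p - of_int (n + 1) * p)) * h" for n p
    by (simp add: witt_act_def M_def xpow_0 ypow_0 eulerx_mult eulery_mult h algebra_simps)
  have numeral_der: "eulerx (numeral k * p) = numeral k * eulerx p" "eulery (numeral k * p) = numeral k * eulery p" for k p
    by (metis add_0 eulerx_const eulerx_mult mult_zero_left single_numeral)
      (metis add_0 eulery_const eulery_mult mult_zero_left single_numeral)
  note der = eulerx_add eulery_add eulerx_diff eulery_diff numeral_der E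
  note w1 = w[of 1, simplified] and w2 = w[of 2, simplified] and w3 = w[of 3, simplified] and w4 = w[of 4, simplified]
  define p1 where "p1 = M 3 0 - 4 * M 2 1 + 4 * M 1 2 - M 0 3"
  have f1: "f1 = p1 * h"
    unfolding f1 xM p1_def by (simp add: power2_eq_square ring)
  define p2 where "p2 = M 4 0 - 3 * M 3 1 + 3 * M 1 3 - M 0 4"
  have f2: "f2 = p2 * h"
    unfolding f2 f1 xM p1_def p2_def by (simp add: ring)
  define p3 where "p3 = 2 * M 5 0 - 9 * M 4 1 + 14 * M 3 2 - 14 * M 2 3 + 9 * M 1 4 - 2 * M 0 5"
  have f3: "f3 = p3 * h"
    unfolding f3 f2 f1 w1 w2 unfolding p1_def p2_def p3_def by (simp add: der ring)
  define p4 where "p4 = 7 * M 6 0 - 30 * M 5 1 + 35 * M 4 2 - 35 * M 2 4 + 30 * M 1 5 - 7 * M 0 6"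
  have f4': "2 * f4 = p4 * h"
    unfolding f4 f3 f1 w1 w3 unfolding p1_def p3_def p4_def by (simp add: der ring)
  have w4': "2 * witt_act 1 f4 = witt_act 1 (p4 * h)"
    unfolding f4'[symmetric] by (simp add: witt_act_def numeral_der ring)
  define d where "d = M 1 0 - M 0 1"
  define Z where "Z = M 7 0 - 7 * M 6 1 + 21 * M 5 2 - 35 * M 4 3 + 35 * M 3 4 - 21 * M 2 5 + 7 * M 1 6 - M 0 7"
  have d2: "d * d = M 2 0 - 2 * M 1 1 + M 0 2"
    unfolding d_def by (simp add: ring)
  have d4: "(d * d) * (d * d) = M 4 0 - 4 * M 3 1 + 6 * M 2 2 - 4 * M 1 3 + M 0 4"
    unfolding d2 by (simp add: ring)
  have "d ^ 7 = ((d * d) * (d * d)) * (d * d) * d"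
    by (simp add: eval_nat_numeral mult.assoc)
  also have "\<dots> = Z"
    unfolding d4 unfolding d2 unfolding d_def Z_def by (simp add: ring)
  finally have d7: "d ^ 7 = Z" .
  have "0 = 2 * (3 * (witt_act 2 f3 - witt_act 3 f2)) - (2 * witt_act 1 f4 - 2 * witt_act 4 f1)"
    unfolding right_diff_distrib[symmetric] using f5 by simp
  also have "\<dots> = - 8 * (Z * h)"
    unfolding w4' f3 f2 f1 w1 w2 w3 w4 unfolding p1_def p2_def p3_def p4_def Z_def
    by (simp add: der ring)
  finally have "cst (1 / 8) * (8 * (Z * h)) = 0"
    by simp
  then have "d ^ 7 * h = 0"
    unfolding d7 cst_inverse_numeral .
  moreover have "d ^ n * h = 0 \<Longrightarrow> h = 0" for n
    unfolding d_def xM[symmetric] by (induction n) (auto simp: mult.assoc dest: shift_diff_cancel)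
  ultimately show "h = 0" by blast
qed

section \<open>The first cohomology in coordinates\<close>

text \<open>The source of generic shifts: finitely many exceptional values are always avoided by a positive integer.\<close>

lemma exists_nat_avoiding:
  assumes "finite (S :: 'f::field_char_0 set)"
  obtains n :: nat where "n \<ge> 1" "of_nat n \<notin> S"
proof -
  have "infinite (of_nat ` {1..} :: 'f set)"
    by (simp add: finite_image_iff inj_on_def infinite_Ici)
  then obtain x where "x \<in> of_nat ` {1..}" "x \<notin> S"
    using assms by (meson finite_subset subsetI)
  then show ?thesis using that by auto
qed

lemma witt_act_zero: "witt_act n 0 = 0"
  using witt_act_diff[of n 0 0] by simp

text \<open>Subtracting the coboundary of the approximate solution \<open>v\<close> leaves a cocycle whose values at \<open>L\<^sub>1\<close> and
\<open>L\<^sub>2\<close> are the defect.\<close>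

lemma witt_cocycle_coboundary:
  fixes f :: "int \<Rightarrow> 'f::field_char_0 grp2"
  assumes cocycle: "\<And>m n. witt_act (of_int m) (f n) - witt_act (of_int n) (f m) = cst (of_int (n - m)) * f (m + n)"
    and f0: "f 0 = 0" and hom: "\<And>n. eulery (f n) = cst (of_int n) * f n - eulerx (f n)"
  obtains v where "f 1 = witt_act 1 v" "f 2 = witt_act 2 v"
proof -
  have A: "witt_act 1 (f (-1)) = witt_act (-1) (f 1)"
    using cocycle[of 1 "-1"] by (simp add: f0)
  have B: "witt_act (-1) (f 2) - witt_act 2 (f (-1)) = 3 * f 1"
    using cocycle[of "-1" 2] by (simp add: cst_simps)
  obtain v h where v:
    "f 1 - witt_act 1 v = (xpow 1 - ypow 1) * (xpow 1 ^ 2 - 3 * xpow 1 * ypow 1 + ypow 1 ^ 2) * h"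
    "f 2 - witt_act 2 v = (xpow 1 + ypow 1) * (f 1 - witt_act 1 v)"
    "eulery v = - eulerx v" "eulerx h = - h" "eulery h = - h"
  proof (rule witt_cocycle_up_to_defect[OF _ _ _ A B])
    show "eulery (f 1) = f 1 - eulerx (f 1)" "eulery (f 2) = 2 * f 2 - eulerx (f 2)"
      "eulery (f (-1)) = - f (-1) - eulerx (f (-1))"
      using hom[of 1] hom[of 2] hom[of "-1"] by (simp_all add: cst_simps)
  qed (rule that)
  define g where "g n = f n - witt_act (of_int n) v" for n
  have g: "witt_act (of_int m) (g n) - witt_act (of_int n) (g m) = cst (of_int (n - m)) * g (m + n)" for m n
  proof -
    have "witt_act (of_int m) (g n) - witt_act (of_int n) (g m) =
      (witt_act (of_int m) (f n) - witt_act (of_int n) (f m))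
      - (witt_act (of_int m) (witt_act (of_int n) v) - witt_act (of_int n) (witt_act (of_int m) v))"
      by (simp add: g_def witt_act_diff)
    also have "\<dots> = cst (of_int (n - m)) * g (m + n)"
      unfolding cocycle witt_act_commutator by (simp add: g_def right_diff_distrib)
    finally show ?thesis .
  qed
  have "h = 0"
  proof (rule witt_cocycle_defect_zero[where ?f1.0 = "g 1" and ?f2.0 = "g 2" and ?f3.0 = "g 3" and ?f4.0 = "g 4"])
    show "g 3 = witt_act 1 (g 2) - witt_act 2 (g 1)" using g[of 1 2] by (simp add: cst_simps)
    show "2 * g 4 = witt_act 1 (g 3) - witt_act 3 (g 1)" using g[of 1 3] by (simp add: cst_simps)
    show "3 * (witt_act 2 (g 3) - witt_act 3 (g 2)) = witt_act 1 (g 4) - witt_act 4 (g 1)"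
      using g[of 2 3] g[of 1 4] by (simp add: cst_simps)
  qed (use v in \<open>simp_all add: g_def\<close>)
  then show ?thesis using that[of v] v by simp
qed

text \<open>Compare coefficients at \<open>(\<alpha> + n, \<beta>)\<close> in \<open>L\<^sub>n g = 0\<close>.  For large \<open>n\<close> only the term coming from
\<open>(\<alpha>, \<beta>)\<close> is present, with factor \<open>\<alpha> - n\<close>.\<close>

lemma witt_act_invariant_zero:
  fixes g :: "'f::field_char_0 grp2"
  assumes "\<And>n :: nat. witt_act (of_nat n) g = 0"
  shows "g = 0"
proof (rule poly_mapping_eqI)
  fix k :: "'f \<times> 'f"
  obtain \<alpha> \<beta> where k: "k = (\<alpha>, \<beta>)" by fastforce
  obtain n :: nat where n: "of_nat n \<notin> {\<alpha>} \<union> (\<lambda>(x, y). x - \<alpha>) ` keys g"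
    using exists_nat_avoiding[of "{\<alpha>} \<union> (\<lambda>(x, y). x - \<alpha>) ` keys g"] by auto
  have "lookup g (\<alpha> + of_nat n, \<beta> - of_nat n) = 0"
  proof (rule ccontr)
    assume "\<not> ?thesis"
    then have "(\<alpha> + of_nat n, \<beta> - of_nat n) \<in> keys g" by (simp add: in_keys_iff)
    then have "of_nat n \<in> (\<lambda>(x, y). x - \<alpha>) ` keys g" by (force intro!: image_eqI)
    with n show False by simp
  qed
  then have "(\<alpha> - of_nat n) * lookup g (\<alpha>, \<beta>) = 0"
    using lookup_witt_act[of "of_nat n" g "\<alpha> + of_nat n" \<beta>] assms by (auto simp: algebra_simps)
  then show "lookup g k = lookup 0 k" using n by (auto simp: k)
qed

text \<open>Compare coefficients at \<open>(\<alpha> + n, \<beta> + m)\<close>.  On the left one of the terms arises from \<open>(\<alpha>, \<beta>)\<close> by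
shifting each variable once; the operator \<open>L\<^sub>m\<^sub>+\<^sub>n\<close> on the right shifts a single variable and reaches that
place only from points that lie outside the support for generic \<open>m\<close>, \<open>n\<close>.\<close>

lemma witt_act_equivariant_zero:
  fixes g :: "'f::field_char_0 grp2"
  assumes rel: "\<And>m n :: nat. m \<ge> 1 \<Longrightarrow> n \<ge> 1 \<Longrightarrow>
    cst (\<gamma> - of_nat m - of_nat n) * witt_act (of_nat n) (witt_act (of_nat m) g)
      = cst ((\<gamma> - of_nat m) * (\<gamma> + of_nat m - of_nat n)) * witt_act (of_nat (m + n)) g"
  shows "g = 0"
proof (rule poly_mapping_eqI)
  fix k :: "'f \<times> 'f"
  obtain \<alpha> \<beta> where k: "k = (\<alpha>, \<beta>)" by fastforce
  let ?K = "keys g"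
  obtain m :: nat where m: "m \<ge> 1" "of_nat m \<notin> {\<beta>} \<union> (\<lambda>(x, y). \<alpha> - x) ` ?K"
    using exists_nat_avoiding[of "{\<beta>} \<union> (\<lambda>(x, y). \<alpha> - x) ` ?K"] by auto
  \<comment> \<open>The excluded values are the zeros of the scalar factors and the shifts that lead back into the support.\<close>
  obtain n :: nat where n: "n \<ge> 1"
    "of_nat n \<notin> {\<alpha>, \<gamma> - of_nat m} \<union> (\<lambda>(x, y). x - \<alpha>) ` ?K \<union> (\<lambda>(x, y). x - \<alpha> + of_nat m) ` ?K"
    using exists_nat_avoiding[of "{\<alpha>, \<gamma> - of_nat m} \<union> (\<lambda>(x, y). x - \<alpha>) ` ?K \<union> (\<lambda>(x, y). x - \<alpha> + of_nat m) ` ?K"]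
    by auto
  have zero: "lookup g (x, y) = 0" if "h x \<notin> (\<lambda>(x, y). h x) ` ?K" for h :: "'f \<Rightarrow> 'f" and x y
    using that by (force simp: in_keys_iff)
  have z: "lookup g (\<alpha> - of_nat m, y) = 0" "lookup g (\<alpha> + of_nat n, y) = 0"
      "lookup g (\<alpha> + of_nat n - of_nat m, y) = 0" for y
    using zero[of "\<lambda>x. \<alpha> - x" "\<alpha> - of_nat m" y] zero[of "\<lambda>x. x - \<alpha>" "\<alpha> + of_nat n" y]
      zero[of "\<lambda>x. x - \<alpha> + of_nat m" "\<alpha> + of_nat n - of_nat m" y] m n by simp_all
  have "lookup (witt_act (of_nat n) (witt_act (of_nat m) g)) (\<alpha> + of_nat n, \<beta> + of_nat m)
      = (\<alpha> - of_nat n) * ((\<beta> - of_nat m) * lookup g (\<alpha>, \<beta>))"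
    by (simp add: lookup_witt_act z)
  moreover have "lookup (witt_act (of_nat (m + n)) g) (\<alpha> + of_nat n, \<beta> + of_nat m) = 0"
    by (simp add: lookup_witt_act z)
  moreover have "lookup (cst (\<gamma> - of_nat m - of_nat n) * witt_act (of_nat n) (witt_act (of_nat m) g)) (\<alpha> + of_nat n, \<beta> + of_nat m)
      = lookup (cst ((\<gamma> - of_nat m) * (\<gamma> + of_nat m - of_nat n)) * witt_act (of_nat (m + n)) g) (\<alpha> + of_nat n, \<beta> + of_nat m)"
    by (simp only: rel[OF m(1) n(1)])
  ultimately have "(\<gamma> - of_nat m - of_nat n) * ((\<alpha> - of_nat n) * ((\<beta> - of_nat m) * lookup g (\<alpha>, \<beta>))) = 0"
    by (simp only: lookup_const_mult mult_zero_right)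
  then show "lookup g k = lookup 0 k" using m n by (auto simp: k)
qed

text \<open>The truncation to exponents in \<open>\<Gamma> \<times> \<Gamma>\<close>; it commutes with the action of \<open>L\<^sub>n\<close> for
integral \<open>n\<close> because \<open>\<Gamma>\<close> is stable under integral shifts.\<close>

definition restrict :: "'f set \<Rightarrow> 'f::field grp2 \<Rightarrow> 'f grp2"
  where "restrict \<Gamma> = ext (\<lambda>(\<alpha>, \<beta>). if \<alpha> \<in> \<Gamma> \<and> \<beta> \<in> \<Gamma> then vec (\<alpha>, \<beta>) else 0)"

lemma lookup_restrict: "lookup (restrict \<Gamma> f) (\<alpha>, \<beta>) =
    (if \<alpha> \<in> \<Gamma> \<and> \<beta> \<in> \<Gamma> then lookup f (\<alpha>, \<beta>) else 0)"
proof -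
  have "keys f \<subseteq> UNIV" by simp
  then show ?thesis
    by (induction f rule: vec_span_induct)
      (auto simp: restrict_def ext_pscale ext_add lookup_add lookup_pscale lookup_vec split: if_splits)
qed

lemma keys_add_subset: "keys p \<subseteq> K \<Longrightarrow> keys q \<subseteq> K \<Longrightarrow> keys (p + q) \<subseteq> K"
  by (intro order_trans[OF Poly_Mapping.keys_add] Un_least)

lemma keys_pscale_subset: "keys p \<subseteq> K \<Longrightarrow> keys (pscale c p) \<subseteq> K"
  by (intro order_trans[OF keys_pscale])

lemma keys_diff_subset: "keys p \<subseteq> K \<Longrightarrow> keys q \<subseteq> K \<Longrightarrow> keys (p - q) \<subseteq> K"
  for p q :: "'i \<Rightarrow>\<^sub>0 'f::field"
  using keys_add_subset[OF _ keys_pscale_subset[of q K "- 1"], of p] by (simp add: pscale_uminus_left pscale_1)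

text \<open>The map Virasoro algebra in coordinates: the index \<open>(\<alpha>, a)\<close> stands for \<open>L\<^sub>\<alpha> a\<close> with \<open>a\<close> from a basis
\<open>I\<close> of the coefficient algebra, and \<open>ell n\<close> for \<open>L\<^sub>n 1\<close>, which is a combination of basis vectors as
the unit need not belong to the basis.\<close>

locale virasoro_vec = lie_algebra_vec br
  for br :: "('f::field_char_0 \<times> 'a \<Rightarrow>\<^sub>0 'f) \<Rightarrow> ('f \<times> 'a \<Rightarrow>\<^sub>0 'f) \<Rightarrow> ('f \<times> 'a \<Rightarrow>\<^sub>0 'f)" +
  fixes \<Gamma> :: "'f set" and I :: "'a set" and ell :: "'f \<Rightarrow> (('f \<times> 'a) \<Rightarrow>\<^sub>0 'f)"
  assumes one_mem: "1 \<in> \<Gamma>" and diff_mem: "\<alpha> \<in> \<Gamma> \<Longrightarrow> \<beta> \<in> \<Gamma> \<Longrightarrow> \<alpha> - \<beta> \<in> \<Gamma>"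
    and keys_ell: "n \<in> \<Gamma> \<Longrightarrow> keys (ell n) \<subseteq> \<Gamma> \<times> I"
    and br_ell: "n \<in> \<Gamma> \<Longrightarrow> \<alpha> \<in> \<Gamma> \<Longrightarrow> a \<in> I \<Longrightarrow> br (ell n) (vec (\<alpha>, a)) = pscale (\<alpha> - n) (vec (\<alpha> + n, a))"
    and ell_ell: "m \<in> \<Gamma> \<Longrightarrow> n \<in> \<Gamma> \<Longrightarrow> br (ell m) (ell n) = pscale (n - m) (ell (m + n))"
    and keys_br: "keys x \<subseteq> \<Gamma> \<times> I \<Longrightarrow> keys y \<subseteq> \<Gamma> \<times> I \<Longrightarrow> keys (br x y) \<subseteq> \<Gamma> \<times> I"
begin

abbreviation "J \<equiv> \<Gamma> \<times> I"

lemma zero_mem: "0 \<in> \<Gamma>" using diff_mem[OF one_mem one_mem] by simp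

lemma add_mem: "\<alpha> \<in> \<Gamma> \<Longrightarrow> \<beta> \<in> \<Gamma> \<Longrightarrow> \<alpha> + \<beta> \<in> \<Gamma>"
  using diff_mem[of \<alpha> "0 - \<beta>"] diff_mem[of 0 \<beta>] zero_mem by simp

lemma nat_mem: "of_nat n \<in> \<Gamma>"
  by (induction n) (simp_all add: zero_mem add_mem one_mem)

lemma int_mem: "of_int n \<in> \<Gamma>"
  by (cases n rule: int_diff_cases) (simp add: nat_mem diff_mem)

lemma keys_act:
  assumes x: "keys x \<subseteq> J" and t: "keys t \<subseteq> J \<times> J"
  shows "keys (act x t) \<subseteq> J \<times> J"
  unfolding act_def
proof (rule keys_ext[OF t])
  fix k assume "k \<in> J \<times> J"
  then obtain i j where k: "k = (i, j)" "i \<in> J" "j \<in> J" by blast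
  then have "keys (vec i) \<subseteq> J" "keys (vec j) \<subseteq> J"
    by (simp_all add: keys_vec)
  then show "keys (case k of (i, j) \<Rightarrow> tp (br x (vec i)) (vec j) + tp (vec i) (br x (vec j))) \<subseteq> J \<times> J"
    unfolding k(1) case_prod_conv by (intro keys_add_subset keys_tp keys_br x)
qed

lemma lookup_act:
  assumes n: "n \<in> \<Gamma>" and f: "keys f \<subseteq> J \<times> J"
  shows "lookup (act (ell n) f) ((\<alpha>, a), (\<beta>, b)) =
    (\<alpha> - 2 * n) * lookup f ((\<alpha> - n, a), (\<beta>, b))
    + (\<beta> - 2 * n) * lookup f ((\<alpha>, a), (\<beta> - n, b))"
  using f
proof (induction f rule: vec_span_induct)
  case (vec k c)
  then obtain \<alpha>' a' \<beta>' b' where k: "k = ((\<alpha>', a'), (\<beta>', b'))" "\<alpha>' \<in> \<Gamma>" "a' \<in> I" "\<beta>' \<in> \<Gamma>" "b' \<in> I"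
    by auto
  have "act (ell n) (vec k) = pscale (\<alpha>' - n) (vec ((\<alpha>' + n, a'), (\<beta>', b'))) + pscale (\<beta>' - n) (vec ((\<alpha>', a'), (\<beta>' + n, b')))"
    unfolding k(1) tp_vec[symmetric] act_tp using k n by (simp add: br_ell tp_simps)
  then show ?case
    unfolding lin_pscale[OF act_lin2] k(1)
    by (auto simp: lookup_pscale lookup_add lookup_vec algebra_simps)
qed (simp_all add: linD[OF act_lin2] lookup_add algebra_simps)

text \<open>The component of a tensor at the pair of basis elements \<open>a\<close>, \<open>b\<close> of the coefficient algebra.\<close>

definition slice :: "'a \<Rightarrow> 'a \<Rightarrow> (('f \<times> 'a) \<times> ('f \<times> 'a) \<Rightarrow>\<^sub>0 'f) \<Rightarrow> 'f grp2"
  where "slice a b = ext (\<lambda>((\<alpha>, a'), (\<beta>, b')). if a' = a \<and> b' = b then vec (\<alpha>, \<beta>) else 0)"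

lemma slice_lin: "lin (slice a b)"
  unfolding slice_def by (rule lin_ext)

lemma lookup_slice: "lookup (slice a b f) (\<alpha>, \<beta>) = lookup f ((\<alpha>, a), (\<beta>, b))"
proof -
  have "keys f \<subseteq> UNIV" by simp
  then show ?thesis
    by (induction f rule: vec_span_induct)
      (auto simp: slice_def ext_pscale ext_add lookup_add lookup_pscale lookup_vec split: if_splits)
qed

text \<open>Since \<open>ell n\<close> multiplies the coefficient algebra by its unit, it preserves the components; this reduces
questions about its action to two-variable group algebras.\<close>

lemma slice_act:
  assumes "n \<in> \<Gamma>" "keys f \<subseteq> J \<times> J"
  shows "slice a b (act (ell n) f) = witt_act n (slice a b f)"
proof (rule poly_mapping_eqI)
  fix k :: "'f \<times> 'f"
  obtain \<alpha> \<beta> where "k = (\<alpha>, \<beta>)" by fastforce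
  then show "lookup (slice a b (act (ell n) f)) k = lookup (witt_act n (slice a b f)) k"
    by (simp add: lookup_slice lookup_act[OF assms] lookup_witt_act)
qed

lemma slice_eqI:
  assumes "\<And>a b. slice a b f = slice a b g"
  shows "f = g"
proof (rule poly_mapping_eqI)
  fix k :: "('f \<times> 'a) \<times> ('f \<times> 'a)"
  obtain \<alpha> a \<beta> b where "k = ((\<alpha>, a), (\<beta>, b))" by (metis surj_pair)
  then show "lookup f k = lookup g k"
    using assms[of a b] lookup_slice[of a b f \<alpha> \<beta>] lookup_slice[of a b g \<alpha> \<beta>] by simp
qed

lemma slice_pscale: "slice a b (pscale c f) = cst c * slice a b f"
proof (rule poly_mapping_eqI)
  fix k :: "'f \<times> 'f"
  obtain \<alpha> \<beta> where "k = (\<alpha>, \<beta>)" by fastforce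
  then show "lookup (slice a b (pscale c f)) k = lookup (cst c * slice a b f) k"
    by (simp add: lookup_slice lookup_pscale lookup_const_mult)
qed

text \<open>A vector is assembled from prescribed components if all but finitely many of them vanish.\<close>

lemma slice_family:
  assumes fin: "finite S" and zero: "\<And>a b. (a, b) \<notin> S \<Longrightarrow> v a b = 0"
  obtains f where "\<And>a b. slice a b f = v a b"
proof -
  define f where "f = (\<Sum>(a, b)\<in>S. ext (\<lambda>(\<alpha>, \<beta>). vec ((\<alpha>, a), (\<beta>, b))) (v a b))"
  have s: "slice a b (ext (\<lambda>(\<alpha>, \<beta>). vec ((\<alpha>, a'), (\<beta>, b'))) p) = (if a' = a \<and> b' = b then p else 0)" for a b a' b' p
  proof -
    have l: "lin (\<lambda>p. slice a b (ext (\<lambda>(\<alpha>, \<beta>). vec ((\<alpha>, a'), (\<beta>, b'))) p))"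
      by (intro lin_compose[OF lin_ext slice_lin])
    have r: "lin (\<lambda>p. if a' = a \<and> b' = b then p else (0 :: 'f grp2))"
      by (cases "a' = a \<and> b' = b") (auto simp: lin_def pscale_zero)
    show ?thesis
      by (rule lin_eqI[OF l r]) (auto simp: slice_def)
  qed
  have sum: "slice a b (\<Sum>i\<in>T. g i) = (\<Sum>i\<in>T. slice a b (g i))" for a b T and g :: "'a \<times> 'a \<Rightarrow> _"
    by (induction T rule: infinite_finite_induct) (simp_all add: linD[OF slice_lin])
  have "slice a b f = v a b" for a b
  proof -
    have "slice a b f = (\<Sum>i\<in>S. if i = (a, b) then v a b else 0)"
      unfolding f_def sum by (rule sum.cong) (auto simp: s split: if_splits)
    also have "\<dots> = v a b" using fin zero[of a b] by (simp add: sum.delta)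
    finally show ?thesis .
  qed
  then show ?thesis by (rule that)
qed

lemma keys_sliceI:
  assumes "\<And>a b \<alpha> \<beta>. lookup (slice a b f) (\<alpha>, \<beta>) \<noteq> 0 \<Longrightarrow> \<alpha> \<in> \<Gamma> \<and> \<beta> \<in> \<Gamma> \<and> a \<in> I \<and> b \<in> I"
  shows "keys f \<subseteq> J \<times> J"
  using assms by (auto simp: lookup_slice in_keys_iff)

lemma act_invariant_zero:
  assumes f: "keys f \<subseteq> J \<times> J" and inv: "\<And>n :: nat. act (ell (of_nat n)) f = 0"
  shows "f = 0"
proof (rule slice_eqI)
  show "slice a b f = slice a b 0" for a b
    unfolding lin_0[OF slice_lin]
    by (rule witt_act_invariant_zero) (simp add: inv lin_0[OF slice_lin] flip: slice_act[OF nat_mem f])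
qed

lemma lookup_act3:
  assumes n: "n \<in> \<Gamma>" and f: "keys f \<subseteq> J \<times> J \<times> J"
  shows "lookup (act3 (ell n) f) ((\<alpha>, a), (\<beta>, b), (\<gamma>, c)) =
    (\<alpha> - 2 * n) * lookup f ((\<alpha> - n, a), (\<beta>, b), (\<gamma>, c))
    + (\<beta> - 2 * n) * lookup f ((\<alpha>, a), (\<beta> - n, b), (\<gamma>, c))
    + (\<gamma> - 2 * n) * lookup f ((\<alpha>, a), (\<beta>, b), (\<gamma> - n, c))"
  using f
proof (induction f rule: vec_span_induct)
  case (vec k d)
  then obtain \<alpha>' a' \<beta>' b' \<gamma>' c' where k: "k = ((\<alpha>', a'), (\<beta>', b'), (\<gamma>', c'))"
    "\<alpha>' \<in> \<Gamma>" "a' \<in> I" "\<beta>' \<in> \<Gamma>" "b' \<in> I" "\<gamma>' \<in> \<Gamma>" "c' \<in> I"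
    by auto
  have "act3 (ell n) (vec k) = pscale (\<alpha>' - n) (vec ((\<alpha>' + n, a'), (\<beta>', b'), (\<gamma>', c')))
      + pscale (\<beta>' - n) (vec ((\<alpha>', a'), (\<beta>' + n, b'), (\<gamma>', c')))
      + pscale (\<gamma>' - n) (vec ((\<alpha>', a'), (\<beta>', b'), (\<gamma>' + n, c')))"
    unfolding k(1) tp_vec[symmetric] act3_tp act_tp using k n by (simp add: br_ell tp_simps add.assoc)
  then show ?case
    unfolding lin_pscale[OF act3_lin2] k(1)
    by (auto simp: lookup_pscale lookup_add lookup_vec algebra_simps)
qed (simp_all add: linD[OF act3_lin2] lookup_add algebra_simps)

text \<open>As for two factors: shift the first factor by a generic \<open>n\<close>, so that only one term remains.\<close>

lemma act3_invariant_zero: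
  assumes f: "keys f \<subseteq> J \<times> J \<times> J" and inv: "\<And>n :: nat. act3 (ell (of_nat n)) f = 0"
  shows "f = 0"
proof (rule poly_mapping_eqI)
  fix k :: "('f \<times> 'a) \<times> ('f \<times> 'a) \<times> ('f \<times> 'a)"
  obtain \<alpha> a \<beta> b \<gamma> c where k: "k = ((\<alpha>, a), (\<beta>, b), (\<gamma>, c))" by (metis surj_pair)
  let ?S = "(\<lambda>i. fst (fst i) - \<alpha>) ` keys f"
  obtain n :: nat where n: "of_nat n \<notin> {\<alpha>} \<union> ?S"
    using exists_nat_avoiding[of "{\<alpha>} \<union> ?S"] by auto
  have z: "lookup f ((\<alpha> + of_nat n, a), j) = 0" for j
  proof (rule ccontr)
    assume "\<not> ?thesis"
    then have "((\<alpha> + of_nat n, a), j) \<in> keys f" by (simp add: in_keys_iff)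
    then have "of_nat n \<in> ?S" by (force intro!: image_eqI)
    with n show False by simp
  qed
  have "(\<alpha> - of_nat n) * lookup f k = 0"
    using lookup_act3[OF nat_mem[of n] f, of "\<alpha> + of_nat n" a \<beta> b \<gamma> c] inv[of n]
    by (simp add: z k)
  then show "lookup f k = lookup 0 k" using n by auto
qed

text \<open>The vanishing of the first cohomology with values in the tensor square.  The coboundary is found in two
steps, \<open>v0\<close> making the cocycle vanish at \<open>ell 0\<close> and \<open>v1\<close> at \<open>ell 1\<close> and \<open>ell 2\<close>; the cocycle \<open>D2\<close>
that remains vanishes at every \<open>ell n\<close> with \<open>n\<close> positive, then everywhere.\<close>

lemma cocycle_coboundary:
  assumes D: "lin D" and keys_D: "\<And>x. keys x \<subseteq> J \<Longrightarrow> keys (D x) \<subseteq> J \<times> J"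
    and cocycle: "\<And>x y. keys x \<subseteq> J \<Longrightarrow> keys y \<subseteq> J \<Longrightarrow> D (br x y) = act x (D y) - act y (D x)"
  obtains r where "keys r \<subseteq> J \<times> J" "\<And>x. keys x \<subseteq> J \<Longrightarrow> D x = act x r"
proof -
  \<comment> \<open>\<open>ell 0\<close> multiplies a vector of weight \<open>\<alpha> + \<beta>\<close> by its weight.  As \<open>c / 0 = 0\<close>, the division omits the
    part of weight zero, which remains as \<open>z\<close> below.\<close>
  define v0 where "v0 = Poly_Mapping.mapp (\<lambda>k c. c / (fst (fst k) + fst (snd k))) (D (ell 0))"
  have v0: "lookup v0 k = lookup (D (ell 0)) k / (fst (fst k) + fst (snd k))" for k
    by (auto simp: v0_def lookup_mapp when_def in_keys_iff)
  have keys_v0: "keys v0 \<subseteq> J \<times> J"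
    using keys_D[OF keys_ell[OF zero_mem]] by (auto simp: in_keys_iff v0 subset_iff)
  define D1 where "D1 x = D x - act x v0" for x
  have D1: "lin D1" unfolding D1_def by (intro lin_minus D act_lin1)
  have keys_D1: "keys (D1 x) \<subseteq> J \<times> J" if "keys x \<subseteq> J" for x
    unfolding D1_def by (intro keys_diff_subset keys_D keys_act keys_v0 that)
  have cocycle1: "D1 (br x y) = act x (D1 y) - act y (D1 x)"
    if "keys x \<subseteq> J" "keys y \<subseteq> J" for x y
    unfolding D1_def by (simp add: cocycle[OF that] act_br linD[OF act_lin2])
  note kell = keys_ell[OF int_mem]
  have l0: "lookup (act (ell 0) f) ((\<alpha>, a), (\<beta>, b)) = (\<alpha> + \<beta>) * lookup f ((\<alpha>, a), (\<beta>, b))"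
    if "keys f \<subseteq> J \<times> J" for f \<alpha> a \<beta> b
    by (simp add: lookup_act[OF zero_mem that] algebra_simps)
  define z where "z = D1 (ell 0)"
  have z_weight: "lookup z ((\<alpha>, a), (\<beta>, b)) = 0" if "\<alpha> + \<beta> \<noteq> 0" for \<alpha> a \<beta> b
    using that by (simp add: z_def D1_def lookup_minus l0[OF keys_v0] v0)
  have keys_z: "keys z \<subseteq> J \<times> J"
    unfolding z_def by (intro keys_D1 keys_ell zero_mem)
  have weight: "(\<alpha> + \<beta> - of_int n) * lookup (D1 (ell (of_int n))) ((\<alpha>, a), (\<beta>, b))
      = lookup (act (ell (of_int n)) z) ((\<alpha>, a), (\<beta>, b))" for n \<alpha> a \<beta> b
  proof -
    have "pscale (of_int n) (D1 (ell (of_int n))) = act (ell 0) (D1 (ell (of_int n))) - act (ell (of_int n)) z"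
      using cocycle1[OF keys_ell[OF zero_mem] kell[of n]]
      by (simp add: ell_ell zero_mem int_mem lin_pscale[OF D1] z_def)
    then have "lookup (pscale (of_int n) (D1 (ell (of_int n)))) ((\<alpha>, a), (\<beta>, b))
      = lookup (act (ell 0) (D1 (ell (of_int n))) - act (ell (of_int n)) z) ((\<alpha>, a), (\<beta>, b))"
      by simp
    then show ?thesis
      by (simp add: lookup_pscale lookup_minus l0[OF keys_D1[OF kell]] algebra_simps)
  qed
  \<comment> \<open>As \<open>z\<close> has weight zero, its image lives in weight \<open>n\<close>; there the cocycle identity for
    \<open>[L\<^sub>0, L\<^sub>n] = n L\<^sub>n\<close> says that it vanishes.\<close>
  have inv_z: "act (ell (of_int n)) z = 0" for n
  proof (rule poly_mapping_eqI)
    fix k :: "('f \<times> 'a) \<times> ('f \<times> 'a)"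
    obtain \<alpha> a \<beta> b where k: "k = ((\<alpha>, a), (\<beta>, b))" by (metis surj_pair)
    have "lookup (act (ell (of_int n)) z) k = 0" if "\<alpha> + \<beta> \<noteq> of_int n"
    proof -
      have "\<alpha> - of_int n + \<beta> \<noteq> 0" "\<alpha> + (\<beta> - of_int n) \<noteq> 0" using that by (auto simp: algebra_simps)
      then show ?thesis by (simp add: k lookup_act[OF int_mem keys_z] z_weight)
    qed
    moreover have "lookup (act (ell (of_int n)) z) k = 0" if "\<alpha> + \<beta> = of_int n"
      using weight[of \<alpha> \<beta> n a b] that by (simp add: k)
    ultimately show "lookup (act (ell (of_int n)) z) k = lookup 0 k" by auto
  qed
  have "z = 0"
    by (rule act_invariant_zero[OF keys_z]) (use inv_z[of "int n" for n] in simp)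
  define f where "f a b n = slice a b (D1 (ell (of_int n)))" for a b and n :: int
  have f_cocycle: "witt_act (of_int m) (f a b n) - witt_act (of_int n) (f a b m) = cst (of_int (n - m)) * f a b (m + n)" for a b m n
  proof -
    have "witt_act (of_int m) (f a b n) - witt_act (of_int n) (f a b m)
      = slice a b (act (ell (of_int m)) (D1 (ell (of_int n))) - act (ell (of_int n)) (D1 (ell (of_int m))))"
      unfolding f_def lin_diff[OF slice_lin] by (simp only: slice_act[OF int_mem keys_D1[OF kell]])
    also have "\<dots> = slice a b (D1 (pscale (of_int (n - m)) (ell (of_int (m + n)))))"
      using cocycle1[OF kell[of m] kell[of n]] by (simp add: ell_ell int_mem)
    finally show ?thesis by (simp only: lin_pscale[OF D1] slice_pscale f_def)
  qed
  have f_hom: "eulery (f a b n) = cst (of_int n) * f a b n - eulerx (f a b n)" for a b n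
  proof (rule poly_mapping_eqI)
    fix k :: "'f \<times> 'f"
    obtain \<alpha> \<beta> where k: "k = (\<alpha>, \<beta>)" by fastforce
    have "(\<alpha> + \<beta> - of_int n) * lookup (D1 (ell (of_int n))) ((\<alpha>, a), (\<beta>, b)) = 0"
      using weight[of \<alpha> \<beta> n a b] \<open>z = 0\<close> by (simp add: lin_0[OF act_lin2])
    then show "lookup (eulery (f a b n)) k = lookup (cst (of_int n) * f a b n - eulerx (f a b n)) k"
      unfolding k f_def lookup_eulery lookup_minus lookup_const_mult lookup_eulerx lookup_slice fst_conv snd_conv
      by (simp only: left_diff_distrib distrib_right) (simp add: eq_diff_eq diff_eq_eq add_ac)
  qed
  have f0: "f a b 0 = 0" for a b
    using \<open>z = 0\<close> by (simp add: f_def z_def lin_0[OF slice_lin])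
  \<comment> \<open>The solutions for the components must be supported in \<open>\<Gamma> \<times> \<Gamma>\<close> and must vanish for almost all
    \<open>(a, b)\<close> in order to form a tensor; hence the last two conditions.\<close>
  let ?P = "\<lambda>a b v. f a b 1 = witt_act 1 v \<and> f a b 2 = witt_act 2 v \<and> (\<forall>\<alpha> \<beta>. lookup v (\<alpha>, \<beta>) \<noteq> 0 \<longrightarrow> \<alpha> \<in> \<Gamma> \<and> \<beta> \<in> \<Gamma>)
      \<and> (f a b 1 = 0 \<and> f a b 2 = 0 \<longrightarrow> v = 0)"
  have "\<exists>v. ?P a b v" for a b
  proof (cases "f a b 1 = 0 \<and> f a b 2 = 0")
    case True
    then have "?P a b 0" by (simp add: witt_act_zero)
    then show ?thesis by blast
  next
    case False
    obtain v where v: "f a b 1 = witt_act 1 v" "f a b 2 = witt_act 2 v"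
      using witt_cocycle_coboundary[of "f a b", OF f_cocycle f0 f_hom] by blast
    have "f a b n = witt_act (of_int n) (restrict \<Gamma> v)" if n: "f a b n = witt_act (of_int n) v" for n
    proof (rule poly_mapping_eqI)
      fix k :: "'f \<times> 'f"
      obtain \<alpha> \<beta> where k: "k = (\<alpha>, \<beta>)" by fastforce
      have mem: "\<alpha> - of_int n \<in> \<Gamma> \<longleftrightarrow> \<alpha> \<in> \<Gamma>" for \<alpha>
        using diff_mem[of \<alpha> "of_int n"] add_mem[of "\<alpha> - of_int n" "of_int n"] int_mem[of n] by auto
      have "lookup (f a b n) (\<alpha>, \<beta>) = 0" if "\<not> (\<alpha> \<in> \<Gamma> \<and> \<beta> \<in> \<Gamma>)"
        using keys_D1[OF kell[of n]] that by (auto simp: f_def lookup_slice in_keys_iff subset_iff)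
      then show "lookup (f a b n) k = lookup (witt_act (of_int n) (restrict \<Gamma> v)) k"
        using n by (cases "\<alpha> \<in> \<Gamma> \<and> \<beta> \<in> \<Gamma>") (auto simp: k lookup_witt_act lookup_restrict mem)
    qed
    from this[of 1] this[of 2] v have "?P a b (restrict \<Gamma> v)" using False
      by (auto simp: lookup_restrict)
    then show ?thesis by blast
  qed
  then have "\<forall>a b. \<exists>v. ?P a b v" by blast
  then obtain v where v: "\<And>a b. ?P a b (v a b)"
    by metis
  define S where "S = (\<lambda>i. (snd (fst i), snd (snd i))) ` (keys (D1 (ell 1)) \<union> keys (D1 (ell 2)))"
  have S: "f a b 1 = 0 \<and> f a b 2 = 0" if "(a, b) \<notin> S" for a b
  proof -
    have "lookup (D1 (ell 1)) ((\<alpha>, a), (\<beta>, b)) = 0" "lookup (D1 (ell 2)) ((\<alpha>, a), (\<beta>, b)) = 0" for \<alpha> \<beta>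
      using that by (force simp: S_def in_keys_iff)+
    then show ?thesis
      by (auto intro!: poly_mapping_eqI simp: f_def lookup_slice)
  qed
  have v_zero: "v a b = 0" if "(a, b) \<notin> S" for a b
    using v[of a b] S[OF that] by blast
  then obtain v1 where v1: "\<And>a b. slice a b v1 = v a b"
    using slice_family[of S v] by (auto simp: S_def)
  have keys_v1: "keys v1 \<subseteq> J \<times> J"
  proof (rule keys_sliceI)
    fix a b \<alpha> \<beta> assume nz: "lookup (slice a b v1) (\<alpha>, \<beta>) \<noteq> 0"
    then have "(a, b) \<in> S"
      unfolding v1 using v_zero[of a b] by (metis lookup_zero)
    then have "a \<in> I \<and> b \<in> I"
      using keys_D1[OF keys_ell[OF one_mem]] keys_D1[OF kell[of 2]] by (auto simp: S_def)
    then show "\<alpha> \<in> \<Gamma> \<and> \<beta> \<in> \<Gamma> \<and> a \<in> I \<and> b \<in> I"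
      using v[THEN conjunct2, THEN conjunct2, THEN conjunct1, of a b] nz unfolding v1 by blast
  qed
  define D2 where "D2 x = D1 x - act x v1" for x
  have D2: "lin D2" unfolding D2_def by (intro lin_minus D1 act_lin1)
  have keys_D2: "keys (D2 x) \<subseteq> J \<times> J" if "keys x \<subseteq> J" for x
    unfolding D2_def by (intro keys_diff_subset keys_D1 keys_act keys_v1 that)
  have cocycle2: "D2 (br x y) = act x (D2 y) - act y (D2 x)"
    if "keys x \<subseteq> J" "keys y \<subseteq> J" for x y
    unfolding D2_def by (simp add: cocycle1[OF that] act_br linD[OF act_lin2])
  have D2_12: "D2 (ell 1) = 0" "D2 (ell 2) = 0"
  proof -
    have vv: "f a b 1 = witt_act 1 (v a b)" "f a b 2 = witt_act 2 (v a b)" for a b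
      using v[of a b] by blast+
    have s: "slice a b (D2 (ell (of_int n))) = f a b n - witt_act (of_int n) (v a b)" for a b n
      by (simp add: D2_def lin_diff[OF slice_lin] slice_act[OF int_mem keys_v1] v1 f_def)
    show "D2 (ell 1) = 0"
      by (rule slice_eqI) (use s[of _ _ 1] in \<open>simp add: vv(1) lin_0[OF slice_lin]\<close>)
    show "D2 (ell 2) = 0"
      by (rule slice_eqI) (use s[of _ _ 2] in \<open>simp add: vv(2) lin_0[OF slice_lin]\<close>)
  qed
  \<comment> \<open>\<open>ell 1\<close> and \<open>ell 2\<close> generate: \<open>[L\<^sub>1, L\<^sub>m] = (m - 1) L\<^sub>m\<^sub>+\<^sub>1\<close>.\<close>
  have D2_ell: "D2 (ell (of_nat n)) = 0" if "n \<ge> 1" for n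
    using that
  proof (induction n rule: less_induct)
    case (less n)
    show ?case
    proof (cases "n \<le> 2")
      case True
      then have "n = 1 \<or> n = 2" using less.prems by auto
      then show ?thesis using D2_12 by auto
    next
      case False
      then obtain m where n: "n = Suc m" "m \<ge> 2" by (cases n) auto
      have "D2 (br (ell 1) (ell (of_nat m))) = 0"
        using less.IH[of m] n D2_12 cocycle2[OF keys_ell[OF one_mem] keys_ell[OF nat_mem[of m]]]
        by (simp add: linD[OF act_lin2])
      then have "pscale (of_nat m - 1) (D2 (ell (of_nat n))) = 0"
        by (simp add: ell_ell one_mem nat_mem n linD[OF D2])
      then have "pscale (1 / (of_nat m - 1)) (pscale (of_nat m - 1) (D2 (ell (of_nat n)))) = 0"
        by (simp add: pscale_zero)
      moreover have "of_nat m - 1 \<noteq> (0 :: 'f)" using n by (simp add: of_nat_eq_1_iff)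
      ultimately show ?thesis by (simp add: pscale_pscale pscale_1)
    qed
  qed
  have D2_vec: "D2 (vec (\<gamma>, c)) = 0" if "(\<gamma>, c) \<in> J" for \<gamma> c
  proof (rule slice_eqI)
    fix a b
    define d where "d = D2 (vec (\<gamma>, c))"
    have keys_d: "keys d \<subseteq> J \<times> J"
      unfolding d_def using that by (intro keys_D2) (simp add: keys_vec)
    have eq: "act (ell (of_nat m)) (D2 (vec (\<beta>, c))) = pscale (\<beta> - of_nat m) (D2 (vec (\<beta> + of_nat m, c)))"
      if "\<beta> \<in> \<Gamma>" "m \<ge> 1" for m \<beta>
    proof -
      have "D2 (br (ell (of_nat m)) (vec (\<beta>, c))) = act (ell (of_nat m)) (D2 (vec (\<beta>, c)))"
        using cocycle2[OF keys_ell[OF nat_mem[of m]], of "vec (\<beta>, c)"] D2_ell[OF that(2)] that \<open>(\<gamma>, c) \<in> J\<close>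
        by (simp add: keys_vec linD[OF act_lin2])
      then show ?thesis
        using that \<open>(\<gamma>, c) \<in> J\<close> by (simp add: br_ell nat_mem lin_pscale[OF D2])
    qed
    show "slice a b (D2 (vec (\<gamma>, c))) = slice a b 0"
      unfolding lin_0[OF slice_lin] d_def[symmetric]
    proof (rule witt_act_equivariant_zero[where \<gamma> = \<gamma>])
      fix m n :: nat assume m: "m \<ge> 1" and n: "n \<ge> 1"
      have \<gamma>: "\<gamma> \<in> \<Gamma>" "\<gamma> + of_nat m \<in> \<Gamma>" using that add_mem nat_mem by auto
      let ?y = "D2 (vec (\<gamma> + of_nat m + of_nat n, c))"
      have 1: "act (ell (of_nat n)) (act (ell (of_nat m)) d) = pscale ((\<gamma> - of_nat m) * (\<gamma> + of_nat m - of_nat n)) ?y"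
        unfolding d_def eq[OF \<gamma>(1) m] lin_pscale[OF act_lin2] eq[OF \<gamma>(2) n] by (simp add: pscale_pscale)
      have 2: "act (ell (of_nat (m + n))) d = pscale (\<gamma> - of_nat m - of_nat n) ?y"
        unfolding d_def using eq[OF \<gamma>(1), of "m + n"] m by (simp add: add.assoc diff_diff_eq)
      have "pscale (\<gamma> - of_nat m - of_nat n) (act (ell (of_nat n)) (act (ell (of_nat m)) d))
        = pscale ((\<gamma> - of_nat m) * (\<gamma> + of_nat m - of_nat n)) (act (ell (of_nat (m + n))) d)"
        unfolding 1 2 pscale_pscale by (simp add: mult_ac)
      then have "slice a b (pscale (\<gamma> - of_nat m - of_nat n) (act (ell (of_nat n)) (act (ell (of_nat m)) d)))
        = slice a b (pscale ((\<gamma> - of_nat m) * (\<gamma> + of_nat m - of_nat n)) (act (ell (of_nat (m + n))) d))"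
        by simp
      then show "cst (\<gamma> - of_nat m - of_nat n) * witt_act (of_nat n) (witt_act (of_nat m) (slice a b d))
        = cst ((\<gamma> - of_nat m) * (\<gamma> + of_nat m - of_nat n)) * witt_act (of_nat (m + n)) (slice a b d)"
        unfolding slice_pscale slice_act[OF nat_mem keys_d]
          slice_act[OF nat_mem keys_act[OF keys_ell[OF nat_mem] keys_d]] .
    qed
  qed
  have "D2 x = 0" if "keys x \<subseteq> J" for x
    using that
  proof (induction x rule: vec_span_induct)
    case (vec i c)
    then show ?case using D2_vec[of "fst i" "snd i"] by (simp add: linD[OF D2] pscale_zero)
  qed (simp_all add: linD[OF D2])
  then have "D x = act x (v0 + v1)" if "keys x \<subseteq> J" for x
    using that by (simp add: D2_def D1_def linD[OF act_lin2] diff_eq_eq add.commute)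
  then show ?thesis
    using that[of "v0 + v1"] keys_add_subset[OF keys_v0 keys_v1] by blast
qed

end

section \<open>Coordinates of vector spaces and tensor products\<close>

definition coord_space :: "('f::field, 'i \<Rightarrow>\<^sub>0 'f) module"
  where "coord_space = free_alg \<lparr>carrier = UNIV, monoid.mult = undefined, one = undefined\<rparr>"

lemma coord_space_simps [simp]:
  "carrier coord_space = UNIV" "p \<oplus>\<^bsub>coord_space\<^esub> q = p + q"
  "\<zero>\<^bsub>coord_space\<^esub> = 0" "c \<odot>\<^bsub>coord_space\<^esub> p = pscale c p"
  by (simp_all add: coord_space_def free_alg_simps)

lemma coord_space_vspace: "vspace coord_space"
  unfolding coord_space_def by (rule free_alg_vspace)

text \<open>A basis of \<open>V\<close> indexed by \<open>J\<close>, given by its coordinate map.  Being a map into functions on a type, it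
can be composed with the carrier-free tensor calculus.\<close>

definition coords :: "('f::field, 'v) module \<Rightarrow> 'i set \<Rightarrow> ('v \<Rightarrow> ('i \<Rightarrow>\<^sub>0 'f)) \<Rightarrow> bool"
  where "coords V J \<Phi> \<longleftrightarrow> linear_map V coord_space \<Phi> \<and> bij_betw \<Phi> (carrier V) {p. keys p \<subseteq> J}"

lemma coords_linear: "coords V J \<Phi> \<Longrightarrow> linear_map V coord_space \<Phi>"
  by (simp add: coords_def)

lemma coords_keys: "coords V J \<Phi> \<Longrightarrow> x \<in> carrier V \<Longrightarrow> keys (\<Phi> x) \<subseteq> J"
  by (auto simp: coords_def bij_betw_def)

lemma coords_inj: "coords V J \<Phi> \<Longrightarrow> x \<in> carrier V \<Longrightarrow> y \<in> carrier V \<Longrightarrow> \<Phi> x = \<Phi> y \<longleftrightarrow> x = y"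
  by (auto simp: coords_def bij_betw_def inj_on_eq_iff)

definition from_coords :: "('f::field, 'v) module \<Rightarrow> ('v \<Rightarrow> ('i \<Rightarrow>\<^sub>0 'f)) \<Rightarrow> ('i \<Rightarrow>\<^sub>0 'f) \<Rightarrow> 'v"
  where "from_coords V \<Phi> = inv_into (carrier V) \<Phi>"

lemma from_coords:
  assumes \<Phi>: "coords V J \<Phi>" and p: "keys p \<subseteq> J"
  shows "from_coords V \<Phi> p \<in> carrier V" and "\<Phi> (from_coords V \<Phi> p) = p"
proof -
  have "p \<in> \<Phi> ` carrier V" using assms by (auto simp: coords_def bij_betw_def)
  then show "from_coords V \<Phi> p \<in> carrier V" "\<Phi> (from_coords V \<Phi> p) = p"
    unfolding from_coords_def by (rule inv_into_into, rule f_inv_into_f)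
qed

lemma from_coords_eq: "coords V J \<Phi> \<Longrightarrow> x \<in> carrier V \<Longrightarrow> from_coords V \<Phi> (\<Phi> x) = x"
  by (simp add: from_coords_def coords_def bij_betw_def)

lemma from_coords_eqI: "coords V J \<Phi> \<Longrightarrow> x \<in> carrier V \<Longrightarrow> p = \<Phi> x \<Longrightarrow> from_coords V \<Phi> p = x"
  by (simp add: from_coords_eq)

lemma from_coords_linear:
  assumes V: "vspace V" and \<Phi>: "coords V J \<Phi>"
  shows "keys p \<subseteq> J \<Longrightarrow> keys q \<subseteq> J \<Longrightarrow>
      from_coords V \<Phi> (p + q) = from_coords V \<Phi> p \<oplus>\<^bsub>V\<^esub> from_coords V \<Phi> q"
    and "keys p \<subseteq> J \<Longrightarrow> from_coords V \<Phi> (pscale c p) = c \<odot>\<^bsub>V\<^esub> from_coords V \<Phi> p"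
    and "from_coords V \<Phi> 0 = \<zero>\<^bsub>V\<^esub>"
  using linear_map_zero[OF V coord_space_vspace coords_linear[OF \<Phi>]]
  by (auto intro!: from_coords_eqI[OF \<Phi>] vspaceD(1-3)[OF V]
      simp: from_coords[OF \<Phi>] linear_mapD[OF coords_linear[OF \<Phi>]])

lemma lin_linear_map:
  assumes "lin h"
  shows "linear_map coord_space coord_space h"
proof (rule linear_mapI)
  show "h (p \<oplus>\<^bsub>coord_space\<^esub> q) = h p \<oplus>\<^bsub>coord_space\<^esub> h q" for p q
    unfolding coord_space_simps by (rule lin_add[OF assms])
  show "h (c \<odot>\<^bsub>coord_space\<^esub> p) = c \<odot>\<^bsub>coord_space\<^esub> h p" for c p
    unfolding coord_space_simps by (rule lin_pscale[OF assms])
qed (simp only: coord_space_simps UNIV_I)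

lemma coords_compose_lin:
  assumes "linear_map V coord_space \<Phi>" "lin h"
  shows "linear_map V coord_space (\<lambda>x. h (\<Phi> x))"
  by (rule linear_map_compose[OF assms(1) lin_linear_map[OF assms(2)]])

lemma coords_bilinear:
  assumes "linear_map V coord_space \<Phi>" "linear_map W coord_space \<Psi>" "\<And>p. lin (h p)" "\<And>q. lin (\<lambda>p. h p q)"
  shows "bilinear_on V W coord_space (\<lambda>x y. h (\<Phi> x) (\<Psi> y))"
  by (rule bilinear_onI)
    (rule coords_compose_lin[OF assms(2) assms(3)], rule coords_compose_lin[OF assms(1) assms(4)])

definition tensor_coords :: "('v \<Rightarrow> ('i \<Rightarrow>\<^sub>0 'f::field)) \<Rightarrow> ('w \<Rightarrow> ('j \<Rightarrow>\<^sub>0 'f)) \<Rightarrow> ('v \<times> 'w \<Rightarrow>\<^sub>0 'f) set \<Rightarrow> ('i \<times> 'j \<Rightarrow>\<^sub>0 'f)"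
  where "tensor_coords \<Phi> \<Psi> = tensor_lift coord_space (\<lambda>x y. tp (\<Phi> x) (\<Psi> y))"

lemma tensor_coords_tens:
  assumes V: "vspace V" and W: "vspace W" and \<Phi>: "coords V J \<Phi>" and \<Psi>: "coords W K \<Psi>"
    and x: "x \<in> carrier V" and y: "y \<in> carrier W"
  shows "tensor_coords \<Phi> \<Psi> (tens V W x y) = tp (\<Phi> x) (\<Psi> y)"
  unfolding tensor_coords_def
  by (rule tensor_lift_tens[OF V W coord_space_vspace coords_bilinear[OF coords_linear[OF \<Phi>] coords_linear[OF \<Psi>] tp_lin2 tp_lin1] x y])

text \<open>Pairs of basis elements form a basis of the tensor product.  They span because pure tensors of spanning
vectors do; they are independent because \<open>tensor_coords\<close>, a lift by the universal property, sends them
to distinct basis vectors.  The inverse is the linear extension of \<open>e\<close>, the pairs of basis elements.\<close>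

lemma tensor_coords:
  assumes V: "vspace V" and W: "vspace W" and \<Phi>: "coords V J \<Phi>" and \<Psi>: "coords W K \<Psi>"
  shows "coords (tensor V W) (J \<times> K) (tensor_coords \<Phi> \<Psi>)"
proof -
  let ?T = "tensor V W" and ?H = "tensor_coords \<Phi> \<Psi>"
  note vT = tensor_vspace[OF V W] and bT = tens_bilinear[OF V W]
  have lin: "linear_map ?T coord_space ?H"
    unfolding tensor_coords_def
    by (rule tensor_lift_linear[OF V W coord_space_vspace coords_bilinear[OF coords_linear[OF \<Phi>] coords_linear[OF \<Psi>] tp_lin2 tp_lin1]])
  note tens = tensor_coords_tens[OF V W \<Phi> \<Psi>]
  let ?G = "free_alg \<lparr>carrier = J \<times> K, monoid.mult = undefined, one = undefined\<rparr>"
  define e where "e = (\<lambda>(i, j). tens V W (from_coords V \<Phi> (vec i)) (from_coords W \<Psi> (vec j)))"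
  note fV = from_coords[OF \<Phi>] and fW = from_coords[OF \<Psi>]
  have e: "k \<in> J \<times> K \<Longrightarrow> e k \<in> carrier ?T" for k
    by (auto simp: e_def keys_vec intro!: tens_closed V W fV fW)
  have bk: "linear_map ?G ?T (lin_comb ?T e)"
    by (rule lin_comb_linear[OF vT]) (simp add: e)
  have backD: "lin_comb ?T e (p + q) = lin_comb ?T e p \<oplus>\<^bsub>?T\<^esub> lin_comb ?T e q"
     "lin_comb ?T e (pscale c p) = c \<odot>\<^bsub>?T\<^esub> lin_comb ?T e p"
    if "keys p \<subseteq> J \<times> K" "keys q \<subseteq> J \<times> K" for p q c
    using linear_mapD(2,3)[OF bk] that by (simp_all add: free_alg_simps)
  have lc_vec: "lin_comb ?T e (vec k) = e k" if "k \<in> J \<times> K" for k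
    unfolding vec_def lin_comb_single[OF vT, of e, OF e[OF that]] by (rule vspaceD(6)[OF vT e[OF that]])
  have lc_zero: "lin_comb ?T e 0 = \<zero>\<^bsub>?T\<^esub>"
    by (simp add: lin_comb_def abelian_monoid.finsum_empty[OF abelian_group.axioms(1)[OF module.axioms(2)[OF vT]]])
  have bz: "tens V W \<zero>\<^bsub>V\<^esub> y = \<zero>\<^bsub>?T\<^esub>" if "y \<in> carrier W" for y
    by (rule linear_map_zero[OF V vT bilinear_onD(2)[OF bT that]])
  have bz': "tens V W x \<zero>\<^bsub>W\<^esub> = \<zero>\<^bsub>?T\<^esub>" if "x \<in> carrier V" for x
    by (rule linear_map_zero[OF W vT bilinear_onD(1)[OF bT that]])
  have keys: "keys (tp p q) \<subseteq> J \<times> K"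
    if "keys p \<subseteq> J" "keys q \<subseteq> K" for p q using keys_tp[OF that] .
  have back_vec: "lin_comb ?T e (tp (vec i) q) = tens V W (from_coords V \<Phi> (vec i)) (from_coords W \<Psi> q)"
    if i: "i \<in> J" and q: "keys q \<subseteq> K" for i q
  proof -
    have vi: "keys (vec i) \<subseteq> J" using i by (simp add: keys_vec)
    have vj: "j \<in> K \<Longrightarrow> keys (vec j) \<subseteq> K" for j by (simp add: keys_vec)
    note D = linear_mapD[OF bilinear_onD(1)[OF bT fV(1)[OF vi]]]
    show ?thesis using q
    proof (induction q rule: vec_span_induct)
      case zero
      then show ?case using i by (simp add: tp_simps lc_zero from_coords_linear[OF W \<Psi>] bz' fV vi)
    next
      case (vec j c)
      then have ij: "keys (vec (i, j)) \<subseteq> J \<times> K" using i by (simp add: keys_vec)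
      have "lin_comb ?T e (pscale c (vec (i, j))) = c \<odot>\<^bsub>?T\<^esub> e (i, j)"
        using backD(2)[OF ij ij] lc_vec[of "(i, j)"] i vec by simp
      then show ?case
        unfolding tp_simps(7) tp_vec from_coords_linear(2)[OF W \<Psi> vj[OF vec]] D(3)[OF fW(1)[OF vj[OF vec]]]
        by (simp add: e_def)
    next
      case (add p q)
      then show ?case
        by (simp add: tp_simps(6) backD(1) keys vi from_coords_linear(1)[OF W \<Psi>] D fW(1))
    qed
  qed
  have back_tp: "lin_comb ?T e (tp p q) = tens V W (from_coords V \<Phi> p) (from_coords W \<Psi> q)"
    if p: "keys p \<subseteq> J" and q: "keys q \<subseteq> K" for p q
  proof -
    note D = linear_mapD[OF bilinear_onD(2)[OF bT fW(1)[OF q]]]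
    have vi: "i \<in> J \<Longrightarrow> keys (vec i) \<subseteq> J" for i by (simp add: keys_vec)
    show ?thesis using p
    proof (induction p rule: vec_span_induct)
      case zero
      then show ?case using q by (simp add: tp_simps lc_zero from_coords_linear[OF V \<Phi>] bz fW)
    next
      case (vec i c)
      then show ?case
        by (simp add: tp_simps(2) backD(2)[OF keys[OF vi q] keys[OF vi q]] back_vec[OF _ q] from_coords_linear(2)[OF V \<Phi> vi] D fV(1)[OF vi])
    next
      case (add p q')
      then show ?case
        by (simp add: tp_simps(1) backD(1) keys q from_coords_linear(1)[OF V \<Phi>] D fV(1))
    qed
  qed
  have keysH: "keys (?H t) \<subseteq> J \<times> K" if "t \<in> carrier ?T" for t
    using V W that
  proof (induction rule: tensor_induct)
    case (tens x y)
    then show ?case by (simp add: tensor_coords_tens[OF V W \<Phi> \<Psi>] keys coords_keys[OF \<Phi>] coords_keys[OF \<Psi>])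
  next
    case (add s t)
    then show ?case
      by (simp add: linear_mapD[OF lin]) (intro order_trans[OF Poly_Mapping.keys_add] Un_least)
  next
    case (smult c t)
    then show ?case
      by (simp add: linear_mapD[OF lin]) (intro order_trans[OF keys_pscale])
  qed
  have inverse: "lin_comb ?T e (?H t) = t" if "t \<in> carrier ?T" for t
    using V W that
  proof (induction rule: tensor_induct)
    case (tens x y)
    then show ?case
      by (simp add: tensor_coords_tens[OF V W \<Phi> \<Psi>] back_tp coords_keys[OF \<Phi>] coords_keys[OF \<Psi>] from_coords_eq[OF \<Phi>] from_coords_eq[OF \<Psi>])
  next
    case (add s t)
    then show ?case by (simp add: linear_mapD[OF lin] backD keysH)
  next
    case (smult c t)
    then show ?case by (simp add: linear_mapD[OF lin] backD(2)[OF keysH keysH])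
  qed
  have "p \<in> ?H ` carrier ?T" if "keys p \<subseteq> J \<times> K" for p
    using that
  proof (induction p rule: vec_span_induct)
    case zero
    have "?H \<zero>\<^bsub>?T\<^esub> = 0" using linear_map_zero[OF vT coord_space_vspace lin] by simp
    then show ?case using vspaceD(3)[OF vT] by (metis imageI)
  next
    case (vec k c)
    then obtain i j where k: "k = (i, j)" "i \<in> J" "j \<in> K" by blast
    have "?H (c \<odot>\<^bsub>?T\<^esub> e k) = pscale c (?H (e k))"
      using linear_mapD(3)[OF lin e] vec by simp
    also have "?H (e k) = vec k"
      using k by (simp add: e_def tens fV fW keys_vec)
    finally show ?case using vspaceD(2)[OF vT e[OF vec]] by (metis imageI)
  next
    case (add p q)
    then obtain s t where "p = ?H s" "s \<in> carrier ?T" "q = ?H t" "t \<in> carrier ?T" by blast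
    then have "p + q = ?H (s \<oplus>\<^bsub>?T\<^esub> t)" "s \<oplus>\<^bsub>?T\<^esub> t \<in> carrier ?T"
      by (simp_all add: linear_mapD[OF lin] vspaceD(1)[OF vT])
    then show ?case by blast
  qed
  then have "?H ` carrier ?T = {p. keys p \<subseteq> J \<times> K}" using keysH by blast
  moreover have "inj_on ?H (carrier ?T)" using inverse by (metis inj_onI)
  ultimately show ?thesis using lin by (simp add: coords_def bij_betw_def)
qed

section \<open>Existence of a basis\<close>

text \<open>A maximal linearly independent set spans: by maximality each further vector is part of a dependence, in
which its coefficient cannot vanish.\<close>

lemma coords_exist:
  fixes A :: "('f::field, 'a) module"
  assumes A: "vspace A"
  shows "\<exists>I \<Phi>. coords A (I :: 'a set) \<Phi>"
proof -
  let ?G = "\<lambda>I. free_alg \<lparr>carrier = I, monoid.mult = undefined, one = undefined\<rparr> :: ('f, 'a \<Rightarrow>\<^sub>0 'f) module"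
  let ?E = "lin_comb A (\<lambda>a. a)"
  have E: "linear_map (?G (carrier A)) A ?E"
    by (rule lin_comb_linear[OF A]) simp
  have ED: "?E (p + q) = ?E p \<oplus>\<^bsub>A\<^esub> ?E q" "?E (pscale c p) = c \<odot>\<^bsub>A\<^esub> ?E p" "?E p \<in> carrier A"
    if "keys p \<subseteq> carrier A" "keys q \<subseteq> carrier A" for p q c
    using linear_mapD[OF E] that by (simp_all add: free_alg_simps)
  have Evec: "?E (vec a) = a" if "a \<in> carrier A" for a
    unfolding vec_def using lin_comb_single[OF A, of "\<lambda>a. a", OF that] vspaceD(6)[OF A that] by simp
  define ind where "ind I \<longleftrightarrow> I \<subseteq> carrier A \<and> (\<forall>p. keys p \<subseteq> I \<longrightarrow> ?E p = \<zero>\<^bsub>A\<^esub> \<longrightarrow> p = 0)" for I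
  have "\<exists>I\<in>{I. ind I}. \<forall>I'\<in>{I. ind I}. I \<subseteq> I' \<longrightarrow> I' = I"
  proof (rule subset_Zorn')
    fix C assume C: "subset.chain {I. ind I} C"
    show "\<Union>C \<in> {I. ind I}"
    proof (cases "C = {}")
      case True
      then show ?thesis by (simp add: ind_def)
    next
      case False
      have "p = 0" if p: "keys p \<subseteq> \<Union>C" and E0: "?E p = \<zero>\<^bsub>A\<^esub>" for p
      proof -
        obtain I where "I \<in> C" "keys p \<subseteq> I"
          using finite_subset_Union_chain[OF finite_keys p False C] by blast
        then show ?thesis using C E0 by (auto simp: subset.chain_def ind_def)
      qed
      then show ?thesis using C by (auto simp: subset.chain_def ind_def)
    qed
  qed
  then obtain I where I: "ind I" and max: "\<And>I'. ind I' \<Longrightarrow> I \<subseteq> I' \<Longrightarrow> I' = I" by blast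
  have IA: "I \<subseteq> carrier A" using I by (simp add: ind_def)
  have span: "\<exists>p. keys p \<subseteq> I \<and> ?E p = x" if x: "x \<in> carrier A" for x
  proof (cases "x \<in> I")
    case True
    then show ?thesis using Evec[OF x] by (intro exI[of _ "vec x"]) (simp add: keys_vec)
  next
    case False
    then have "\<not> ind (insert x I)" using max[of "insert x I"] by auto
    then obtain p where p: "keys p \<subseteq> insert x I" "?E p = \<zero>\<^bsub>A\<^esub>" "p \<noteq> 0"
      using x IA by (auto simp: ind_def)
    define c where "c = lookup p x"
    define q where "q = p - pscale c (vec x)"
    have q: "keys q \<subseteq> I"
      using p(1) by (auto simp: q_def in_keys_iff lookup_minus lookup_pscale lookup_vec c_def subset_iff split: if_splits)
    have pq: "p = q + pscale c (vec x)" by (simp add: q_def)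
    have qA: "keys q \<subseteq> carrier A" and xA: "keys (vec x) \<subseteq> carrier A"
        and cxA: "keys (pscale c (vec x)) \<subseteq> carrier A"
      using q IA x keys_pscale[of c "vec x"] by (auto simp: keys_vec)
    have "c \<noteq> 0"
    proof
      assume "c = 0"
      then have "p = q" using pq by (simp add: pscale_0)
      then show False using I p q by (auto simp: ind_def)
    qed
    have sum: "?E q \<oplus>\<^bsub>A\<^esub> c \<odot>\<^bsub>A\<^esub> x = \<zero>\<^bsub>A\<^esub>"
      using p(2) unfolding pq ED(1)[OF qA cxA] ED(2)[OF xA xA] Evec[OF x] .
    interpret A: abelian_group A using A by (rule module.axioms(2))
    have cx: "c \<odot>\<^bsub>A\<^esub> x \<in> carrier A" by (rule vspaceD(2)[OF A x])
    have "c \<odot>\<^bsub>A\<^esub> x \<oplus>\<^bsub>A\<^esub> ?E q = \<zero>\<^bsub>A\<^esub>"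
      using sum A.a_comm[OF cx ED(3)[OF qA qA]] by simp
    then have "\<ominus>\<^bsub>A\<^esub> ?E q = c \<odot>\<^bsub>A\<^esub> x"
      by (rule A.minus_equality[OF _ ED(3)[OF qA qA] cx])
    then have "c \<odot>\<^bsub>A\<^esub> x = (- 1) \<odot>\<^bsub>A\<^esub> ?E q"
      using vspaceD(7)[OF A ED(3)[OF qA qA]] by metis
    then have "(1 / c) \<odot>\<^bsub>A\<^esub> (c \<odot>\<^bsub>A\<^esub> x) = (1 / c) \<odot>\<^bsub>A\<^esub> ((- 1) \<odot>\<^bsub>A\<^esub> ?E q)" by simp
    then have "x = ?E (pscale (- 1 / c) q)"
      using \<open>c \<noteq> 0\<close> vspaceD(6)[OF A x] ED(2)[OF qA qA, of "- 1 / c"]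
      by (simp flip: vspaceD(13)[OF A x] vspaceD(13)[OF A ED(3)[OF qA qA]])
    then show ?thesis using q keys_pscale[of "- 1 / c" q] by (metis order_trans)
  qed
  have unique: "p = q" if "keys p \<subseteq> I" "keys q \<subseteq> I" "?E p = ?E q" for p q
  proof -
    have pA: "keys p \<subseteq> carrier A" and qA: "keys q \<subseteq> carrier A" using that IA by auto
    have nq: "keys (pscale (- 1) q) \<subseteq> I" using that(2) by (intro order_trans[OF keys_pscale])
    then have nqA: "keys (pscale (- 1) q) \<subseteq> carrier A" using IA by auto
    have "?E (p + pscale (- 1) q) = ?E q \<oplus>\<^bsub>A\<^esub> (- 1) \<odot>\<^bsub>A\<^esub> ?E q"
      by (simp only: ED(1)[OF pA nqA] ED(2)[OF qA qA] that(3))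
    also have "\<dots> = \<zero>\<^bsub>A\<^esub>"
      using vspaceD(8)[OF A] vspaceD(14)[OF A] ED(3)[OF qA qA] by metis
    finally have "p + pscale (- 1) q = 0"
      using I that(1) nq Poly_Mapping.keys_add[of p "pscale (- 1) q"] unfolding ind_def by blast
    then show ?thesis by (simp add: pscale_uminus_left pscale_1)
  qed
  define \<Phi> where "\<Phi> x = (THE p. keys p \<subseteq> I \<and> ?E p = x)" for x
  have \<Phi>: "keys (\<Phi> x) \<subseteq> I \<and> ?E (\<Phi> x) = x" if "x \<in> carrier A" for x
    unfolding \<Phi>_def by (rule theI') (use span[OF that] unique in blast)
  have eqI: "\<Phi> x = p" if "x \<in> carrier A" "keys p \<subseteq> I" "?E p = x" for x p
    using \<Phi>[OF that(1)] that unique by blast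
  have \<Phi>A: "keys (\<Phi> x) \<subseteq> carrier A" if "x \<in> carrier A" for x
    using \<Phi>[OF that] IA by blast
  have "linear_map A coord_space \<Phi>"
  proof (rule linear_mapI)
    fix x y c assume x: "x \<in> carrier A"
    show "\<Phi> (c \<odot>\<^bsub>A\<^esub> x) = c \<odot>\<^bsub>coord_space\<^esub> \<Phi> x"
      using \<Phi>[OF x] keys_pscale[of c "\<Phi> x"] ED(2)[OF \<Phi>A[OF x] \<Phi>A[OF x]]
      by (intro eqI) (auto simp: vspaceD(2)[OF A x])
    assume y: "y \<in> carrier A"
    show "\<Phi> (x \<oplus>\<^bsub>A\<^esub> y) = \<Phi> x \<oplus>\<^bsub>coord_space\<^esub> \<Phi> y"
      using \<Phi>[OF x] \<Phi>[OF y] Poly_Mapping.keys_add[of "\<Phi> x" "\<Phi> y"] ED(1)[OF \<Phi>A[OF x] \<Phi>A[OF y]]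
      by (intro eqI) (auto simp: vspaceD(1)[OF A x y])
  qed simp
  moreover have "bij_betw \<Phi> (carrier A) {p. keys p \<subseteq> I}"
  proof (rule bij_betw_byWitness[where f' = ?E])
    show "\<forall>p\<in>{p. keys p \<subseteq> I}. \<Phi> (?E p) = p"
      using eqI ED(3) IA by blast
    show "?E ` {p. keys p \<subseteq> I} \<subseteq> carrier A"
      using ED(3) IA by blast
  qed (use \<Phi> in auto)
  ultimately show ?thesis unfolding coords_def by blast
qed

section \<open>The Witt algebra and its bracket\<close>

lemma deriv_op_add: "deriv_op (f + g) = deriv_op f + deriv_op g"
  and deriv_op_single: "deriv_op (single \<alpha> c) = single \<alpha> (\<alpha> * c)"
  and deriv_op_pscale: "deriv_op (pscale c f) = pscale c (deriv_op f)"
  and keys_deriv_op: "keys (deriv_op f) \<subseteq> keys f"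
proof -
  have l: "lookup (deriv_op f) \<alpha> = \<alpha> * lookup f \<alpha>" for f :: "'a \<Rightarrow>\<^sub>0 'a" and \<alpha>
    by (simp add: deriv_op_def lookup_sum lookup_single when_def in_keys_iff)
  show "deriv_op (f + g) = deriv_op f + deriv_op g"
    by (rule poly_mapping_eqI) (simp add: l lookup_add algebra_simps)
  show "deriv_op (single \<alpha> c) = single \<alpha> (\<alpha> * c)"
    by (rule poly_mapping_eqI) (simp add: l lookup_single when_def)
  show "deriv_op (pscale c f) = pscale c (deriv_op f)"
    by (rule poly_mapping_eqI) (simp add: l lookup_pscale)
  show "keys (deriv_op f) \<subseteq> keys f"
    by (auto simp: in_keys_iff l)
qed

lemma pscale_mult: "pscale c f * g = pscale c (f * g)" "f * pscale c g = pscale c (f * g)"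
  for f g :: "'f::field \<Rightarrow>\<^sub>0 'f"
  by (simp_all add: mult_map_scale_conv_mult mult_ac)

lemma witt_simps:
  "carrier (witt \<Gamma>) = {f. keys f \<subseteq> \<Gamma>}" "f \<oplus>\<^bsub>witt \<Gamma>\<^esub> g = f + g" "\<zero>\<^bsub>witt \<Gamma>\<^esub> = 0"
  "c \<odot>\<^bsub>witt \<Gamma>\<^esub> f = pscale c f" "f \<otimes>\<^bsub>witt \<Gamma>\<^esub> g = f * deriv_op g - g * deriv_op f"
  by (simp_all add: witt_def)

lemma witt_vspace: "vspace (witt \<Gamma>)"
  by (rule vspace_image[OF free_alg_vspace[of "\<lparr>carrier = \<Gamma>, monoid.mult = undefined, one = undefined\<rparr>"], of _ "\<lambda>x. x"])
    (simp_all add: witt_simps free_alg_simps)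

lemma witt_algebra:
  fixes \<Gamma> :: "'f::field set"
  assumes add: "\<And>\<alpha> \<beta>. \<alpha> \<in> \<Gamma> \<Longrightarrow> \<beta> \<in> \<Gamma> \<Longrightarrow> \<alpha> + \<beta> \<in> \<Gamma>"
  shows "nonassoc_algebra (witt \<Gamma>)"
proof -
  have times: "keys (f * g) \<subseteq> \<Gamma>" if "keys f \<subseteq> \<Gamma>" "keys g \<subseteq> \<Gamma>" for f g :: "'f \<Rightarrow>\<^sub>0 'f"
    using keys_mult[of f g] add that by blast
  have closed: "keys (f * deriv_op g - g * deriv_op f) \<subseteq> \<Gamma>"
    if "keys f \<subseteq> \<Gamma>" "keys g \<subseteq> \<Gamma>" for f g :: "'f \<Rightarrow>\<^sub>0 'f"
    by (intro keys_diff_subset times order_trans[OF keys_deriv_op] that)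
  show ?thesis
    unfolding nonassoc_algebra_def
    by (intro conjI witt_vspace bilinear_onI linear_mapI)
      (simp_all add: witt_simps closed deriv_op_add deriv_op_pscale pscale_mult pscale_diff algebra_simps)
qed

lemma witt_coords: "coords (witt \<Gamma>) \<Gamma> (\<lambda>f. f)"
  by (simp add: coords_def linear_map_def witt_simps bij_betw_def)

section \<open>Lie bialgebra structures in coordinates\<close>

text \<open>Transport of the bracket, the tensor operations and the Yang-Baxter expression of \<open>L\<close> along a
coordinate map.\<close>

locale lie_algebra_with_basis = enveloping_algebra L for L :: "('f::field_char_0, 'l) module" +
  fixes J :: "'i set" and \<Phi> :: "'l \<Rightarrow> ('i \<Rightarrow>\<^sub>0 'f)"
  assumes \<Phi>: "coords L J \<Phi>"
begin

abbreviation \<Phi>2 where "\<Phi>2 \<equiv> tensor_coords \<Phi> \<Phi>"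
abbreviation \<Phi>3 where "\<Phi>3 \<equiv> tensor_coords \<Phi> \<Phi>2"
abbreviation inv\<Phi> where "inv\<Phi> \<equiv> from_coords L \<Phi>"

text \<open>The structure constants are extended by zero outside \<open>J\<close>, so that the bracket satisfies the axioms of a
Lie algebra on all functions, whatever their support.\<close>

definition struct_const :: "'i \<Rightarrow> 'i \<Rightarrow> ('i \<Rightarrow>\<^sub>0 'f)"
  where "struct_const i j = (if i \<in> J \<and> j \<in> J then \<Phi> (inv\<Phi> (vec i) \<otimes>\<^bsub>L\<^esub> inv\<Phi> (vec j)) else 0)"

definition br_vec where "br_vec p q = ext (\<lambda>i. ext (\<lambda>j. struct_const i j) q) p"

definition proj :: "('i \<Rightarrow>\<^sub>0 'f) \<Rightarrow> ('i \<Rightarrow>\<^sub>0 'f)"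
  where "proj = ext (\<lambda>i. if i \<in> J then vec i else 0)"

lemmas \<Phi>_lin = linear_mapD[OF coords_linear[OF \<Phi>]]
lemmas inv\<Phi>_lin = from_coords_linear[OF vL \<Phi>]
lemmas inv\<Phi>_closed = from_coords(1)[OF \<Phi>]
lemmas \<Phi>_inv = from_coords(2)[OF \<Phi>]
lemmas inv_\<Phi> = from_coords_eq[OF \<Phi>]
lemmas \<Phi>_keys = coords_keys[OF \<Phi>]

lemma \<Phi>2: "coords L2 (J \<times> J) \<Phi>2" and \<Phi>3: "coords L3 (J \<times> J \<times> J) \<Phi>3"
  using tensor_coords[OF vL vL \<Phi> \<Phi>] tensor_coords[OF vL vL2 \<Phi>] by blast+

lemmas \<Phi>2_tens = tensor_coords_tens[OF vL vL \<Phi> \<Phi>]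
lemmas \<Phi>3_tens = tensor_coords_tens[OF vL vL2 \<Phi> \<Phi>2]

lemma \<Phi>_zero: "\<Phi> \<zero>\<^bsub>L\<^esub> = 0" and \<Phi>2_zero: "\<Phi>2 \<zero>\<^bsub>L2\<^esub> = 0" and \<Phi>3_zero: "\<Phi>3 \<zero>\<^bsub>L3\<^esub> = 0"
  using linear_map_zero[OF vL coord_space_vspace coords_linear[OF \<Phi>]]
    linear_map_zero[OF vL2 coord_space_vspace coords_linear[OF \<Phi>2]]
    linear_map_zero[OF vL3 coord_space_vspace coords_linear[OF \<Phi>3]] by simp_all

lemma br_vec_lin1: "lin (\<lambda>p. br_vec p q)" and br_vec_lin2: "lin (br_vec p)"
  unfolding br_vec_def by (intro lin_ext_fun lin_ext)+

lemma br_vec_inv: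
  assumes p: "keys p \<subseteq> J" and q: "keys q \<subseteq> J"
  shows "br_vec p q = \<Phi> (inv\<Phi> p \<otimes>\<^bsub>L\<^esub> inv\<Phi> q)"
proof -
  have vi: "i \<in> J \<Longrightarrow> keys (vec i) \<subseteq> J" for i by (simp add: keys_vec)
  note l1 = linear_mapD[OF bracket_lin(1)] and l2 = linear_mapD[OF bracket_lin(2)]
  have zl: "\<zero>\<^bsub>L\<^esub> \<otimes>\<^bsub>L\<^esub> y = \<zero>\<^bsub>L\<^esub>" and zr: "y \<otimes>\<^bsub>L\<^esub> \<zero>\<^bsub>L\<^esub> = \<zero>\<^bsub>L\<^esub>" if "y \<in> carrier L" for y
    using linear_map_zero[OF vL vL bracket_lin(2)[OF that]] linear_map_zero[OF vL vL bracket_lin(1)[OF that]] by simp_all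
  have 1: "br_vec (vec i) q = \<Phi> (inv\<Phi> (vec i) \<otimes>\<^bsub>L\<^esub> inv\<Phi> q)" if i: "i \<in> J" for i
    using q
  proof (induction q rule: vec_span_induct)
    case zero
    then show ?case by (simp add: linD[OF br_vec_lin2] inv\<Phi>_lin zr inv\<Phi>_closed vi i \<Phi>_zero)
  next
    case (vec j c)
    have "br_vec (vec i) (vec j) = struct_const i j" by (simp add: br_vec_def)
    then show ?case using vec i
      by (simp add: lin_pscale[OF br_vec_lin2] struct_const_def inv\<Phi>_lin(2)[OF vi] l1 \<Phi>_lin inv\<Phi>_closed vi)
  next
    case (add q q')
    then show ?case by (simp add: lin_add[OF br_vec_lin2] inv\<Phi>_lin(1) l1 \<Phi>_lin inv\<Phi>_closed vi i)
  qed
  show ?thesis using p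
  proof (induction p rule: vec_span_induct)
    case zero
    then show ?case by (simp add: linD[OF br_vec_lin1] inv\<Phi>_lin zl inv\<Phi>_closed q \<Phi>_zero)
  next
    case (vec i c)
    then show ?case
      by (simp add: lin_pscale[OF br_vec_lin1] 1 inv\<Phi>_lin(2)[OF vi] l2 \<Phi>_lin inv\<Phi>_closed vi q bracket_lin(3))
  next
    case (add p p')
    then show ?case by (simp add: lin_add[OF br_vec_lin1] inv\<Phi>_lin(1) l2 \<Phi>_lin inv\<Phi>_closed q bracket_lin(3))
  qed
qed

lemma br_vec_\<Phi>: "x \<in> carrier L \<Longrightarrow> y \<in> carrier L \<Longrightarrow> br_vec (\<Phi> x) (\<Phi> y) = \<Phi> (x \<otimes>\<^bsub>L\<^esub> y)"
  by (simp add: br_vec_inv \<Phi>_keys inv_\<Phi>)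

lemma proj_lin: "lin proj"
  unfolding proj_def by (rule lin_ext)

lemma keys_proj: "keys (proj p) \<subseteq> J"
  unfolding proj_def by (rule keys_ext[of p UNIV]) (auto simp: keys_vec)

lemma proj_id: "keys p \<subseteq> J \<Longrightarrow> proj p = p"
  by (rule lin_eq_on[OF proj_lin lin_ident]) (auto simp: proj_def)

text \<open>The functions supported outside \<open>J\<close> are central.  Hence identities for the extended bracket follow from
those in \<open>L\<close>.\<close>

lemma br_vec_proj: "br_vec p q = br_vec (proj p) (proj q)"
proof (rule lin_eqI2[where F = br_vec and G = "\<lambda>p q. br_vec (proj p) (proj q)"])
  show "br_vec (vec i) (vec j) = br_vec (proj (vec i)) (proj (vec j))" for i j
    by (auto simp: proj_def struct_const_def br_vec_def)
qed (intro br_vec_lin1 br_vec_lin2 lin_compose[OF proj_lin br_vec_lin1] lin_compose[OF proj_lin br_vec_lin2])+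

lemma keys_br_vec: "keys (br_vec p q) \<subseteq> J"
  unfolding br_vec_proj[of p q] br_vec_inv[OF keys_proj keys_proj]
  by (intro \<Phi>_keys bracket_lin(3) inv\<Phi>_closed keys_proj)

sublocale lie_algebra_vec br_vec
proof
  show "lin (\<lambda>p. br_vec p q)" "lin (br_vec p)" for p q by (rule br_vec_lin1 br_vec_lin2)+
  show "br_vec x x = 0" for x
    unfolding br_vec_proj[of x x] br_vec_inv[OF keys_proj keys_proj]
    by (simp add: lie_algebra.bracket_self[OF L inv\<Phi>_closed[OF keys_proj]] \<Phi>_zero)
  show "br_vec x (br_vec y z) + br_vec y (br_vec z x) + br_vec z (br_vec x y) = 0" for x y z
  proof -
    define a b c where "a = inv\<Phi> (proj x)" and "b = inv\<Phi> (proj y)" and "c = inv\<Phi> (proj z)"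
    have abc: "a \<in> carrier L" "b \<in> carrier L" "c \<in> carrier L" "proj x = \<Phi> a" "proj y = \<Phi> b" "proj z = \<Phi> c"
      by (simp_all add: a_def b_def c_def inv\<Phi>_closed keys_proj \<Phi>_inv)
    have nest: "br_vec p (br_vec q r) = br_vec (proj p) (br_vec (proj q) (proj r))" for p q r
      by (metis br_vec_proj keys_br_vec proj_id)
    have "br_vec x (br_vec y z) + br_vec y (br_vec z x) + br_vec z (br_vec x y)
      = \<Phi> ((a \<otimes>\<^bsub>L\<^esub> (b \<otimes>\<^bsub>L\<^esub> c)) \<oplus>\<^bsub>L\<^esub> (b \<otimes>\<^bsub>L\<^esub> (c \<otimes>\<^bsub>L\<^esub> a)) \<oplus>\<^bsub>L\<^esub> (c \<otimes>\<^bsub>L\<^esub> (a \<otimes>\<^bsub>L\<^esub> b)))"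
      unfolding nest[of x y z] nest[of y z x] nest[of z x y] abc(4-6)
      by (simp add: br_vec_\<Phi> abc(1-3) bracket_lin(3) \<Phi>_lin vspaceD(1)[OF vL])
    then show ?thesis using lie_algebra.jacobi[OF L abc(1-3)] \<Phi>_zero by simp
  qed
qed

lemma \<Phi>2_ad:
  assumes x: "x \<in> carrier L" and t: "t \<in> carrier L2"
  shows "ad_action L x t \<in> carrier L2" and "\<Phi>2 (ad_action L x t) = act (\<Phi> x) (\<Phi>2 t)"
proof -
  have b: "bilinear_on L L L2 (\<lambda>a b. tens L L (x \<otimes>\<^bsub>L\<^esub> a) b \<oplus>\<^bsub>L2\<^esub> tens L L a (x \<otimes>\<^bsub>L\<^esub> b))"
    by (rule bilinear_on_add[OF vL2 bilinear_on_compose[OF tens_bilinear[OF vL vL] bracket_lin(1)[OF x] linear_map_ident]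
          bilinear_on_compose[OF tens_bilinear[OF vL vL] linear_map_ident bracket_lin(1)[OF x]]])
  have lin: "linear_map L2 L2 (ad_action L x)"
    unfolding ad_action_def by (rule tensor_lift_linear[OF vL vL vL2 b])
  show "ad_action L x t \<in> carrier L2" by (rule linear_mapD(1)[OF lin t])
  show "\<Phi>2 (ad_action L x t) = act (\<Phi> x) (\<Phi>2 t)"
  proof (rule tensor_eqI[OF vL vL linear_map_compose[OF lin coords_linear[OF \<Phi>2]]
        coords_compose_lin[OF coords_linear[OF \<Phi>2] act_lin2] _ t])
    fix a b assume "a \<in> carrier L" "b \<in> carrier L"
    then show "\<Phi>2 (ad_action L x (tens L L a b)) = act (\<Phi> x) (\<Phi>2 (tens L L a b))"
      unfolding ad_action_def using x
      by (simp add: tensor_lift_tens[OF vL vL vL2 b] linear_mapD(2)[OF coords_linear[OF \<Phi>2]] tens_closed vL bracket_lin(3)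
          \<Phi>2_tens act_tp br_vec_\<Phi>)
  qed
qed

lemma \<Phi>2_twist:
  assumes t: "t \<in> carrier L2"
  shows "twist L t \<in> carrier L2" and "\<Phi>2 (twist L t) = twist_vec (\<Phi>2 t)"
proof -
  note b = bilinear_on_swap[OF tens_bilinear[OF vL vL]]
  have lin: "linear_map L2 L2 (twist L)"
    unfolding twist_def by (rule tensor_lift_linear[OF vL vL vL2 b])
  show "twist L t \<in> carrier L2" by (rule linear_mapD(1)[OF lin t])
  show "\<Phi>2 (twist L t) = twist_vec (\<Phi>2 t)"
  proof (rule tensor_eqI[OF vL vL linear_map_compose[OF lin coords_linear[OF \<Phi>2]]
        coords_compose_lin[OF coords_linear[OF \<Phi>2] lin_twist_vec] _ t])
    fix a b' assume "a \<in> carrier L" "b' \<in> carrier L"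
    then show "\<Phi>2 (twist L (tens L L a b')) = twist_vec (\<Phi>2 (tens L L a b'))"
      unfolding twist_def by (simp add: tensor_lift_tens[OF vL vL vL2 b] \<Phi>2_tens twist_vec_tp)
  qed
qed

lemma L3_eqI:
  assumes h: "linear_map L3 M h" and k: "linear_map L3 M k"
    and eq: "\<And>a b c. a \<in> carrier L \<Longrightarrow> b \<in> carrier L \<Longrightarrow> c \<in> carrier L \<Longrightarrow> h (tens3 L a b c) = k (tens3 L a b c)"
    and t: "t \<in> carrier L3"
  shows "h t = k t"
proof (rule tensor_eqI[OF vL vL2 h k _ t])
  fix a s assume a: "a \<in> carrier L" and s: "s \<in> carrier L2"
  note l = bilinear_onD(1)[OF tens_bilinear[OF vL vL2] a]
  show "h (tens L L2 a s) = k (tens L L2 a s)"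
    by (rule tensor_eqI[OF vL vL linear_map_compose[OF l h] linear_map_compose[OF l k] eq[OF a] s])
qed

lemma \<Phi>3_cyc:
  assumes t: "t \<in> carrier L3"
  shows "cyc L t \<in> carrier L3" and "\<Phi>3 (cyc L t) = cyc_vec (\<Phi>3 t)"
proof -
  note tri = tens_trilinear[OF vL vL vL linear_map_ident linear_map_ident linear_map_ident]
  have b2: "bilinear_on L L L3 (\<lambda>y z. tens3 L y z x)" if "x \<in> carrier L" for x
    using that by (intro bilinear_onI tri)
  have b: "bilinear_on L L2 L3 (\<lambda>x. tensor_lift L3 (\<lambda>y z. tens3 L y z x))"
    by (rule tensor_lift_bilinear[OF vL vL vL3 vL b2 tri(3)])
  have lin: "linear_map L3 L3 (cyc L)"
    unfolding cyc_def by (rule tensor_lift_linear[OF vL vL2 vL3 b])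
  show "cyc L t \<in> carrier L3" by (rule linear_mapD(1)[OF lin t])
  show "\<Phi>3 (cyc L t) = cyc_vec (\<Phi>3 t)"
  proof (rule L3_eqI[OF linear_map_compose[OF lin coords_linear[OF \<Phi>3]]
        coords_compose_lin[OF coords_linear[OF \<Phi>3] lin_cyc_vec] _ t])
    fix x y z assume "x \<in> carrier L" "y \<in> carrier L" "z \<in> carrier L"
    then show "\<Phi>3 (cyc L (tens3 L x y z)) = cyc_vec (\<Phi>3 (tens3 L x y z))"
      unfolding cyc_def by (simp add: tensor_lift_tens[OF vL vL2 vL3 b] tensor_lift_tens[OF vL vL vL3 b2]
          tens_closed vL vL2 \<Phi>3_tens \<Phi>2_tens cyc_vec_tp)
  qed
qed

lemma \<Phi>3_id_tensor:
  assumes \<Delta>: "linear_map L L2 \<Delta>" and r: "\<And>y. y \<in> carrier L \<Longrightarrow> \<Phi>2 (\<Delta> y) = act (\<Phi> y) r" and t: "t \<in> carrier L2"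
  shows "id_tensor L \<Delta> t \<in> carrier L3" and "\<Phi>3 (id_tensor L \<Delta> t) = id_cobracket r (\<Phi>2 t)"
proof -
  have b: "bilinear_on L L L3 (\<lambda>x y. tens L L2 x (\<Delta> y))"
    by (rule bilinear_on_compose[OF tens_bilinear[OF vL vL2] linear_map_ident \<Delta>])
  have lin: "linear_map L2 L3 (id_tensor L \<Delta>)"
    unfolding id_tensor_def by (rule tensor_lift_linear[OF vL vL vL3 b])
  show "id_tensor L \<Delta> t \<in> carrier L3" by (rule linear_mapD(1)[OF lin t])
  show "\<Phi>3 (id_tensor L \<Delta> t) = id_cobracket r (\<Phi>2 t)"
  proof (rule tensor_eqI[OF vL vL linear_map_compose[OF lin coords_linear[OF \<Phi>3]]
        coords_compose_lin[OF coords_linear[OF \<Phi>2] id_cobracket_lin2] _ t])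
    fix x y assume "x \<in> carrier L" "y \<in> carrier L"
    then show "\<Phi>3 (id_tensor L \<Delta> (tens L L x y)) = id_cobracket r (\<Phi>2 (tens L L x y))"
      unfolding id_tensor_def by (simp add: tensor_lift_tens[OF vL vL vL3 b]
          \<Phi>3_tens linear_mapD(1)[OF \<Delta>] \<Phi>2_tens id_cobracket_tp r)
  qed
qed

lemma \<Phi>3_yb:
  assumes r: "r \<in> carrier L2"
  shows "yb r \<in> carrier L3" and "\<Phi>3 (yb r) = yb_vec (\<Phi>2 r) (\<Phi>2 r)"
proof -
  note c = bilinear_onD(3)[OF yb_bilinear(1) r r] bilinear_onD(3)[OF yb_bilinear(2) r r]
    bilinear_onD(3)[OF yb_bilinear(3) r r]
  note l2 = coords_linear[OF \<Phi>2] and l3 = coords_linear[OF \<Phi>3]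
  note E = tensor_eqI2[OF vL vL vL vL bilinear_on_linear[OF _ l3] coords_bilinear[OF l2 l2] _ r r]
  have 1: "\<Phi>3 (yb12_13 r r) = yb12_13_vec (\<Phi>2 r) (\<Phi>2 r)"
    by (rule E[OF yb_bilinear(1) yb_leg_vec_lin(2) yb_leg_vec_lin(1)])
      (simp add: yb_tens \<Phi>2_tens \<Phi>3_tens tens_closed vL bracket_lin(3) yb_leg_vec_tp br_vec_\<Phi>)
  have 2: "\<Phi>3 (yb12_23 r r) = yb12_23_vec (\<Phi>2 r) (\<Phi>2 r)"
    by (rule E[OF yb_bilinear(2) yb_leg_vec_lin(4) yb_leg_vec_lin(3)])
      (simp add: yb_tens \<Phi>2_tens \<Phi>3_tens tens_closed vL bracket_lin(3) yb_leg_vec_tp br_vec_\<Phi>)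
  have 3: "\<Phi>3 (yb13_23 r r) = yb13_23_vec (\<Phi>2 r) (\<Phi>2 r)"
    by (rule E[OF yb_bilinear(3) yb_leg_vec_lin(6) yb_leg_vec_lin(5)])
      (simp add: yb_tens \<Phi>2_tens \<Phi>3_tens tens_closed vL bracket_lin(3) yb_leg_vec_tp br_vec_\<Phi>)
  show "yb r \<in> carrier L3" unfolding yb_def by (intro vspaceD(1)[OF vL3] c)
  show "\<Phi>3 (yb r) = yb_vec (\<Phi>2 r) (\<Phi>2 r)"
    unfolding yb_def yb_vec_def using c
    by (simp add: linear_mapD(2)[OF l3] vspaceD(1)[OF vL3] 1 2 3)
qed

end

section \<open>Lie bialgebra structures on map Virasoro algebras\<close>

lemma twist_vec_involution: "twist_vec (twist_vec t) = t"
  by (rule lin_eqI[OF lin_compose[OF lin_twist_vec lin_twist_vec] lin_ident]) (auto simp: twist_vec_def)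

locale virasoro_with_basis =
  lie_algebra_with_basis L "\<Gamma> \<times> I" \<Phi> + virasoro_vec br_vec \<Gamma> I ell
  for L :: "('f::field_char_0, 'l) module" and \<Gamma> :: "'f set" and I :: "'a set"
    and \<Phi> :: "'l \<Rightarrow> ('f \<times> 'a \<Rightarrow>\<^sub>0 'f)" and ell
begin

lemma coord_space_minus: "p \<ominus>\<^bsub>coord_space\<^esub> q = p - q"
  by (subst vspaceD(8)[OF coord_space_vspace]) (simp_all add: pscale_uminus_left pscale_1)

lemma act_twist_vec: "act x (twist_vec t) = twist_vec (act x t)"
proof (rule lin_eqI[OF lin_compose[OF lin_twist_vec act_lin2] lin_compose[OF act_lin2 lin_twist_vec]])
  fix k :: "('f \<times> 'a) \<times> ('f \<times> 'a)"
  obtain i j where k: "k = (i, j)" by (metis surj_pair)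
  show "act x (twist_vec (vec k)) = twist_vec (act x (vec k))"
    unfolding k tp_vec[symmetric] twist_vec_tp act_tp lin_add[OF lin_twist_vec] by (simp add: add.commute)
qed

text \<open>The cobracket, in coordinates, is a cocycle and thus of the form \<open>x \<mapsto> x \<cdot> r\<close>.  Skewness and the
co-Jacobi identity make \<open>r + \<tau> r\<close> and the Yang-Baxter expression of \<open>r\<close> invariant, so both vanish.\<close>

theorem lie_bialgebra_triangular:
  assumes bi: "lie_bialgebra L \<Delta>"
  shows "\<exists>r. triangular_lie_bialgebra L \<Delta> r"
proof -
  have \<Delta>: "linear_map L L2 \<Delta>" and skew: "\<Delta> ` carrier L \<subseteq> skew_tensors L"
    and cojacobi: "x \<in> carrier L \<Longrightarrow> id_tensor L \<Delta> (\<Delta> x) \<oplus>\<^bsub>L3\<^esub> cyc L (id_tensor L \<Delta> (\<Delta> x))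
      \<oplus>\<^bsub>L3\<^esub> cyc L (cyc L (id_tensor L \<Delta> (\<Delta> x))) = \<zero>\<^bsub>L3\<^esub>"
    and cocycle: "x \<in> carrier L \<Longrightarrow> y \<in> carrier L \<Longrightarrow>
      \<Delta> (x \<otimes>\<^bsub>L\<^esub> y) = ad_action L x (\<Delta> y) \<ominus>\<^bsub>L2\<^esub> ad_action L y (\<Delta> x)" for x y
    using bi by (auto simp: lie_bialgebra_def lie_coalgebra_def Let_def)
  note \<Delta>D = linear_mapD[OF \<Delta>] and \<Phi>2D = linear_mapD[OF coords_linear[OF \<Phi>2]]
    and \<Phi>3D = linear_mapD[OF coords_linear[OF \<Phi>3]]
  have minus2: "\<Phi>2 (s \<ominus>\<^bsub>L2\<^esub> t) = \<Phi>2 s - \<Phi>2 t" if "s \<in> carrier L2" "t \<in> carrier L2" for s t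
    using linear_map_minus[OF vL2 coord_space_vspace coords_linear[OF \<Phi>2] that] by (simp add: coord_space_minus)
  \<comment> \<open>The projection makes \<open>D\<close> linear on all functions, not only on those supported in \<open>J\<close>.\<close>
  define D where "D p = \<Phi>2 (\<Delta> (inv\<Phi> (proj p)))" for p
  have D_lin: "lin D"
    unfolding lin_def D_def
    by (simp add: lin_add[OF proj_lin] lin_pscale[OF proj_lin] inv\<Phi>_lin(1,2) keys_proj inv\<Phi>_closed \<Delta>D \<Phi>2D)
  have D_\<Phi>: "D (\<Phi> x) = \<Phi>2 (\<Delta> x)" if "x \<in> carrier L" for x
    unfolding D_def using that by (simp only: proj_id[OF \<Phi>_keys] inv_\<Phi>)
  have \<Phi>_surj: "\<exists>x. x \<in> carrier L \<and> p = \<Phi> x" if "keys p \<subseteq> J" for p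
    using inv\<Phi>_closed[OF that] \<Phi>_inv[OF that] by metis
  obtain r' where r': "keys r' \<subseteq> J \<times> J" and Dr: "\<And>p. keys p \<subseteq> J \<Longrightarrow> D p = act p r'"
  proof (rule cocycle_coboundary[OF D_lin])
    show "keys (D p) \<subseteq> J \<times> J" if "keys p \<subseteq> J" for p
      unfolding D_def by (intro coords_keys[OF \<Phi>2] \<Delta>D inv\<Phi>_closed keys_proj)
    show "D (br_vec p q) = act p (D q) - act q (D p)" if p: "keys p \<subseteq> J" and q: "keys q \<subseteq> J" for p q
    proof -
      obtain x y where "x \<in> carrier L" "p = \<Phi> x" "y \<in> carrier L" "q = \<Phi> y"
        using \<Phi>_surj[OF p] \<Phi>_surj[OF q] by blast
      then show ?thesis
        by (simp add: br_vec_\<Phi> D_\<Phi> bracket_lin(3) cocycle minus2 \<Phi>2_ad \<Delta>D)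
    qed
  qed (rule that)
  define r where "r = from_coords L2 \<Phi>2 r'"
  have r: "r \<in> carrier L2" and \<Phi>2r: "\<Phi>2 r = r'"
    unfolding r_def using from_coords[OF \<Phi>2 r'] by simp_all
  have \<Delta>_act: "\<Phi>2 (\<Delta> x) = act (\<Phi> x) r'" if "x \<in> carrier L" for x
    using Dr[OF \<Phi>_keys[OF that]] D_\<Phi>[OF that] by simp
  have inner: "\<Delta> x = ad_action L x r" if "x \<in> carrier L" for x
    using that coords_inj[OF \<Phi>2 \<Delta>D(1)[OF that] \<Phi>2_ad(1)[OF that r]] by (simp add: \<Delta>_act \<Phi>2_ad r \<Phi>2r)
  have tw_keys: "keys (twist_vec r') \<subseteq> J \<times> J"
    using coords_keys[OF \<Phi>2 \<Phi>2_twist(1)[OF r]] by (simp add: \<Phi>2_twist(2)[OF r] \<Phi>2r)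
  have "r' + twist_vec r' = 0"
  proof (rule act_invariant_zero)
    show "keys (r' + twist_vec r') \<subseteq> J \<times> J" by (intro keys_add_subset r' tw_keys)
    fix n :: nat
    obtain x where x: "x \<in> carrier L" "ell (of_nat n) = \<Phi> x"
      using \<Phi>_surj[OF keys_ell[OF nat_mem]] by meson
    obtain t where t: "t \<in> carrier L2" "\<Delta> x = t \<ominus>\<^bsub>L2\<^esub> twist L t"
      using skew x(1) by (auto simp: skew_tensors_def)
    have "act (\<Phi> x) r' = \<Phi>2 t - twist_vec (\<Phi>2 t)"
      using \<Delta>_act[OF x(1)] t by (simp add: minus2 \<Phi>2_twist)
    then show "act (ell (of_nat n)) (r' + twist_vec r') = 0"
      by (simp add: x(2) lin_add[OF act_lin2] act_twist_vec lin_diff[OF lin_twist_vec] twist_vec_involution)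
  qed
  then have tw_r: "twist_vec r' = - r'" by (simp add: eq_neg_iff_add_eq_0 add.commute)
  have "r \<in> skew_tensors L"
  proof -
    have h: "(1/2) \<odot>\<^bsub>L2\<^esub> r \<in> carrier L2" using r by (rule vspaceD(2)[OF vL2])
    have "\<Phi>2 ((1/2) \<odot>\<^bsub>L2\<^esub> r \<ominus>\<^bsub>L2\<^esub> twist L ((1/2) \<odot>\<^bsub>L2\<^esub> r)) = pscale (1/2) r' - twist_vec (pscale (1/2) r')"
      using h r by (simp add: minus2 \<Phi>2_twist \<Phi>2D \<Phi>2r)
    also have "\<dots> = r'"
      by (simp add: lin_pscale[OF lin_twist_vec] tw_r pscale_uminus) (simp add: pscale_1 flip: pscale_add_left)
    finally have "r = (1/2) \<odot>\<^bsub>L2\<^esub> r \<ominus>\<^bsub>L2\<^esub> twist L ((1/2) \<odot>\<^bsub>L2\<^esub> r)"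
      using coords_inj[OF \<Phi>2 r vspaceD(9)[OF vL2 h \<Phi>2_twist(1)[OF h]]] by (simp add: \<Phi>2r)
    then show ?thesis unfolding skew_tensors_def using h by (rule image_eqI)
  qed
  have "yb_vec r' r' = 0"
  proof (rule act3_invariant_zero)
    show "keys (yb_vec r' r') \<subseteq> J \<times> J \<times> J"
      using coords_keys[OF \<Phi>3 \<Phi>3_yb(1)[OF r]] by (simp add: \<Phi>3_yb(2)[OF r] \<Phi>2r)
    fix n :: nat
    obtain x where x: "x \<in> carrier L" "ell (of_nat n) = \<Phi> x"
      using \<Phi>_surj[OF keys_ell[OF nat_mem]] by meson
    let ?t = "id_tensor L \<Delta> (\<Delta> x)"
    note t = \<Phi>3_id_tensor[OF \<Delta> \<Delta>_act \<Delta>D(1)[OF x(1)]]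
    note c = \<Phi>3_cyc(1)[OF t(1)] \<Phi>3_cyc(1)[OF \<Phi>3_cyc(1)[OF t(1)]]
    have "0 = \<Phi>3 (?t \<oplus>\<^bsub>L3\<^esub> cyc L ?t \<oplus>\<^bsub>L3\<^esub> cyc L (cyc L ?t))"
      by (simp add: cojacobi[OF x(1)] \<Phi>3_zero)
    also have "\<dots> = cojacobiator r' r' (\<Phi> x)"
      unfolding cojacobiator_def using t(1) c x(1)
      by (simp add: \<Phi>3D vspaceD(1)[OF vL3] \<Phi>3_cyc(2) t(2) \<Delta>_act)
    also have "\<dots> = act3 (\<Phi> x) (yb_vec r' r')" by (rule cojacobiator_skew[OF tw_r])
    finally show "act3 (ell (of_nat n)) (yb_vec r' r') = 0" by (simp add: x(2))
  qed
  then have "yb r = \<zero>\<^bsub>L3\<^esub>"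
    using coords_inj[OF \<Phi>3 \<Phi>3_yb(1)[OF r] vspaceD(3)[OF vL3]] by (simp add: \<Phi>3_yb(2)[OF r] \<Phi>2r \<Phi>3_zero)
  then have "cybe L r = \<zero>\<^bsub>U3\<^esub>"
    using cybe_eq[OF r] linear_map_zero[OF vL3 vU3 incl3_linear] by simp
  then show ?thesis
    using bi \<open>r \<in> skew_tensors L\<close> inner
    by (auto simp: triangular_lie_bialgebra_def coboundary_lie_bialgebra_def)
qed

end

lemma algebra_nonassoc:
  assumes A: "algebra scalars A"
  shows "nonassoc_algebra A"
proof -
  interpret A: algebra scalars A by fact
  have "x \<otimes>\<^bsub>A\<^esub> (c \<odot>\<^bsub>A\<^esub> y) = c \<odot>\<^bsub>A\<^esub> (x \<otimes>\<^bsub>A\<^esub> y)" if "x \<in> carrier A" "y \<in> carrier A" for c x y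
    using that A.smult_assoc2[of c y x] A.m_comm[of x "c \<odot>\<^bsub>A\<^esub> y"] A.m_comm[of x y] A.smult_closed[of c y] by simp
  then show ?thesis
    unfolding nonassoc_algebra_def
    using A.module_axioms A.smult_assoc2
    by (auto intro!: bilinear_onI linear_mapI simp: A.l_distr A.r_distr)
qed

theorem theorem4p6:
  fixes \<Gamma> :: "'f::field_char_0 set"
    and A :: "('f, 'a) module"
    and \<Delta> :: "(('f \<Rightarrow>\<^sub>0 'f) \<times> 'a \<Rightarrow>\<^sub>0 'f) set \<Rightarrow>
      ((('f \<Rightarrow>\<^sub>0 'f) \<times> 'a \<Rightarrow>\<^sub>0 'f) set \<times> (('f \<Rightarrow>\<^sub>0 'f) \<times> 'a \<Rightarrow>\<^sub>0 'f) set \<Rightarrow>\<^sub>0 'f) set"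
  assumes "additive_subgroup \<Gamma> scalars" and "1 \<in> \<Gamma>"
    and "algebra scalars A"
    and "domain (tensor A A)"
    and "lie_bialgebra (map_virasoro \<Gamma> A) \<Delta>"
  shows "\<exists>r. triangular_lie_bialgebra (map_virasoro \<Gamma> A) \<Delta> r"
proof -
  let ?W = "witt \<Gamma>" and ?L = "map_virasoro \<Gamma> A"
  have add: "\<alpha> + \<beta> \<in> \<Gamma>" if "\<alpha> \<in> \<Gamma>" "\<beta> \<in> \<Gamma>" for \<alpha> \<beta>
    using additive_subgroup.a_closed[OF assms(1) that] by simp
  have neg: "- \<beta> \<in> \<Gamma>" if "\<beta> \<in> \<Gamma>" for \<beta>
    using additive_subgroup.a_inv_closed[OF assms(1) that] by simp
  note aW = witt_algebra[OF add] and aA = algebra_nonassoc[OF assms(3)]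
  have vA: "vspace A" using aA by (simp add: nonassoc_algebra_def)
  obtain I :: "'a set" and \<Psi> where \<Psi>: "coords A I \<Psi>"
    using coords_exist[OF vA] by blast
  interpret A: algebra scalars A by fact
  define \<Phi> where "\<Phi> = tensor_coords (\<lambda>f :: 'f \<Rightarrow>\<^sub>0 'f. f) \<Psi>"
  have \<Phi>: "coords ?L (\<Gamma> \<times> I) \<Phi>"
    unfolding \<Phi>_def map_virasoro_def by (rule tensor_coords[OF witt_vspace vA witt_coords \<Psi>])
  have lie: "lie_algebra ?L" using assms(5) by (simp add: lie_bialgebra_def)
  interpret L: lie_algebra_with_basis ?L "\<Gamma> \<times> I" \<Phi>
    by (intro lie_algebra_with_basis.intro enveloping_algebra.intro lie_algebra_with_basis_axioms.intro lie \<Phi>)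
  define w where "w \<alpha> x = tens ?W A (single \<alpha> 1) x" for \<alpha> x
  have w_closed: "w \<alpha> x \<in> carrier ?L" if "\<alpha> \<in> \<Gamma>" "x \<in> carrier A" for \<alpha> x
    unfolding w_def map_virasoro_def using that by (intro tens_closed witt_vspace vA) (simp_all add: witt_simps)
  have w_bracket: "w \<alpha> x \<otimes>\<^bsub>?L\<^esub> w \<beta> y = (\<beta> - \<alpha>) \<odot>\<^bsub>?L\<^esub> w (\<alpha> + \<beta>) (x \<otimes>\<^bsub>A\<^esub> y)"
    if "\<alpha> \<in> \<Gamma>" "\<beta> \<in> \<Gamma>" "x \<in> carrier A" "y \<in> carrier A" for \<alpha> \<beta> x y
  proof -
    let ?e = "\<lambda>\<alpha>. single \<alpha> 1 :: 'f \<Rightarrow>\<^sub>0 'f"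
    have e: "?e \<alpha> \<in> carrier ?W" if "\<alpha> \<in> \<Gamma>" for \<alpha> using that by (simp add: witt_simps)
    have "?e \<alpha> \<otimes>\<^bsub>?W\<^esub> ?e \<beta> = (\<beta> - \<alpha>) \<odot>\<^bsub>?W\<^esub> ?e (\<alpha> + \<beta>)"
      by (simp add: witt_simps deriv_op_single mult_single pscale_single add.commute flip: single_diff)
    then have "w \<alpha> x \<otimes>\<^bsub>?L\<^esub> w \<beta> y = tens ?W A ((\<beta> - \<alpha>) \<odot>\<^bsub>?W\<^esub> ?e (\<alpha> + \<beta>)) (x \<otimes>\<^bsub>A\<^esub> y)"
      unfolding w_def map_virasoro_def using that e by (simp add: tens_mult[OF aW aA])
    also have "\<dots> = (\<beta> - \<alpha>) \<odot>\<^bsub>?L\<^esub> w (\<alpha> + \<beta>) (x \<otimes>\<^bsub>A\<^esub> y)"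
      unfolding w_def map_virasoro_def
      by (rule linear_mapD(3)[OF bilinear_onD(2)[OF tens_bilinear[OF witt_vspace vA]]])
        (use that add e in auto)
    finally show ?thesis .
  qed
  have \<Phi>_w: "\<Phi> (w \<alpha> x) = tp (vec \<alpha>) (\<Psi> x)" if "\<alpha> \<in> \<Gamma>" "x \<in> carrier A" for \<alpha> x
    unfolding \<Phi>_def w_def vec_def using that
    by (intro tensor_coords_tens[OF witt_vspace vA witt_coords \<Psi>]) (simp_all add: witt_simps)
  define ell where "ell n = \<Phi> (w n \<one>\<^bsub>A\<^esub>)" for n
  have br_vec_ell: "L.br_vec (ell n) (\<Phi> (w \<alpha> x)) = pscale (\<alpha> - n) (\<Phi> (w (\<alpha> + n) x))"
    if "n \<in> \<Gamma>" "\<alpha> \<in> \<Gamma>" "x \<in> carrier A" for n \<alpha> x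
    unfolding ell_def using that
    by (simp add: L.br_vec_\<Phi> w_closed w_bracket L.\<Phi>_lin(3) add add.commute)
  interpret V: virasoro_with_basis ?L \<Gamma> I \<Phi> ell
  proof unfold_locales
    show "1 \<in> \<Gamma>" by fact
    show "\<alpha> - \<beta> \<in> \<Gamma>" if "\<alpha> \<in> \<Gamma>" "\<beta> \<in> \<Gamma>" for \<alpha> \<beta>
      using add[OF that(1) neg[OF that(2)]] by simp
    show "keys (ell n) \<subseteq> \<Gamma> \<times> I" if "n \<in> \<Gamma>" for n
      unfolding ell_def using that by (intro L.\<Phi>_keys w_closed) simp_all
    show "L.br_vec (ell n) (vec (\<alpha>, a)) = pscale (\<alpha> - n) (vec (\<alpha> + n, a))" if "n \<in> \<Gamma>" "\<alpha> \<in> \<Gamma>" "a \<in> I" for n \<alpha> a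
    proof -
      have a: "keys (vec a) \<subseteq> I" using that by (simp add: keys_vec)
      show ?thesis
        using br_vec_ell[OF that(1,2) from_coords(1)[OF \<Psi> a]]
        by (simp add: \<Phi>_w that add from_coords[OF \<Psi> a])
    qed
    show "L.br_vec (ell m) (ell n) = pscale (n - m) (ell (m + n))" if "m \<in> \<Gamma>" "n \<in> \<Gamma>" for m n
      using br_vec_ell[OF that A.one_closed] by (simp add: ell_def add.commute)
    show "keys (L.br_vec x y) \<subseteq> \<Gamma> \<times> I" for x y by (rule L.keys_br_vec)
  qed
  show ?thesis by (rule V.lie_bialgebra_triangular[OF assms(5)])
qed

end
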